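(* If $\mathrm{NP}^{\mathrm{NEXP}[1]}=\mathrm{NP}^{\mathrm{NEXP}}$, then the Boolean hierarchy over $\mathrm{NEXP}$ collapses to its second level; more precisely, $\mathrm{BH}(\mathrm{NEXP})=\text{co-}\mathrm D^{\mathrm{Exp}}$.
   Context: $\mathrm{NP}^{\mathrm{NEXP}}$ is the class of languages decided by nondeterministic polynomial-time oracle machines with an oracle for a language in $\mathrm{NEXP}$; $\mathrm{NP}^{\mathrm{NEXP}[1]}$ is the same with at most one oracle query. $\mathrm D^{\mathrm{Exp}}=\{A\cap B: A\in\mathrm{NEXP},\ B\in\text{co-}\mathrm{NEXP}\}$ and $\text{co-}\mathrm D^{\mathrm{Exp}}$ is the class of complements of languages in $\mathrm D^{\mathrm{Exp}}$. The Boolean hierarchy over $\mathrm{NEXP}$, $\mathrm{BH}(\mathrm{NEXP})$, is $\bigcup_{k\ge1}\mathrm{BH}_k(\mathrm{NEXP})$, where $\mathrm{BH}_k(\mathrm{NEXP})$ is the class of languages $L$ for which there are languages $L_1\supseteq L_2\supseteq\cdots\supseteq L_k$ in $\mathrm{NEXP}$ with $L=(L_1\setminus L_2)\cup(L_3\setminus L_4)\cup\cdots$ (ending with $\cup L_k$ if $k$ is odd); equivalently, $w\in L$ iff $|\{z\le k: w\in L_z\}|$ is odd. Its second level is $\mathrm{BH}_2(\mathrm{NEXP})=\mathrm D^{\mathrm{Exp}}$. *)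

theory Defs
  imports Main
begin

text \<open>Words are binary strings (bool list); languages are sets of them.
Tape symbols are natural numbers: 0 is the blank, 1 encodes False, 2 encodes True.
Tape 1 is the input/work tape, tape 2 is the oracle tape (an ordinary second work
tape for machines without oracle access). A transition
(q, a, b, q', a', b', m1, m2) means: in state q reading a on tape 1 and b on tape 2,
go to q', write a' and b', move heads by m1 and m2 (each in {-1,0,1}).\<close>

record ntm =
  delta :: "(nat \<times> nat \<times> nat \<times> nat \<times> nat \<times> nat \<times> int \<times> int) set"
  start :: nat
  acc :: nat
  rej :: nat
  qry :: nat
  qyes :: nat
  qno :: nat

definition wf_ntm :: "ntm \<Rightarrow> bool" where
  "wf_ntm M \<longleftrightarrow> finite (delta M) \<and> acc M \<noteq> rej M \<and> qry M \<noteq> acc M \<and> qry M \<noteq> rej M \<and>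
     (\<forall>(q, a, b, q', a', b', m1, m2) \<in> delta M.
        q \<notin> {acc M, rej M, qry M} \<and> m1 \<in> {-1, 0, 1} \<and> m2 \<in> {-1, 0, 1})"

text \<open>Configurations; nq counts the oracle queries made so far (it does not
influence the computation).\<close>
record conf =
  cstate :: nat
  tp1 :: "int \<Rightarrow> nat"
  hd1 :: int
  tp2 :: "int \<Rightarrow> nat"
  hd2 :: int
  nq :: nat

definition init :: "ntm \<Rightarrow> bool list \<Rightarrow> conf" where
  "init M w = \<lparr>cstate = start M,
     tp1 = (\<lambda>i. if 0 \<le> i \<and> i < int (length w) then (if w ! nat i then 2 else 1) else 0),
     hd1 = 0, tp2 = (\<lambda>_. 0), hd2 = 0, nq = 0\<rparr>"

definition step :: "ntm \<Rightarrow> conf \<Rightarrow> conf \<Rightarrow> bool" where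
  "step M c c' \<longleftrightarrow> (\<exists>q' a' b' m1 m2.
      (cstate c, tp1 c (hd1 c), tp2 c (hd2 c), q', a', b', m1, m2) \<in> delta M \<and>
      c' = \<lparr>cstate = q', tp1 = (tp1 c)(hd1 c := a'), hd1 = hd1 c + m1,
            tp2 = (tp2 c)(hd2 c := b'), hd2 = hd2 c + m2, nq = nq c\<rparr>)"

definition query_word :: "(int \<Rightarrow> nat) \<Rightarrow> bool list" where
  "query_word t = map (\<lambda>i. t (int i) = 2) [0..<(LEAST k. t (int k) \<notin> {1, 2})]"

definition qstep :: "ntm \<Rightarrow> bool list set \<Rightarrow> conf \<Rightarrow> conf \<Rightarrow> bool" where
  "qstep M Orc c c' \<longleftrightarrow> cstate c = qry M \<and>
     c' = \<lparr>cstate = (if query_word (tp2 c) \<in> Orc then qyes M else qno M),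
           tp1 = tp1 c, hd1 = hd1 c, tp2 = (\<lambda>_. 0), hd2 = 0, nq = Suc (nq c)\<rparr>"

definition ostep :: "ntm \<Rightarrow> bool list set \<Rightarrow> conf \<Rightarrow> conf \<Rightarrow> bool" where
  "ostep M Orc c c' \<longleftrightarrow> step M c c' \<or> qstep M Orc c c'"

definition decides_in :: "(conf \<Rightarrow> conf \<Rightarrow> bool) \<Rightarrow> ntm \<Rightarrow> bool list set \<Rightarrow> (nat \<Rightarrow> nat) \<Rightarrow> bool" where
  "decides_in R M L t \<longleftrightarrow>
     (\<forall>w n c. (R ^^ n) (init M w) c \<longrightarrow> n \<le> t (length w)) \<and>
     (\<forall>w. w \<in> L \<longleftrightarrow> (\<exists>n c. (R ^^ n) (init M w) c \<and> cstate c = acc M))"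

definition NEXP :: "bool list set set" where
  "NEXP = {L. \<exists>M k. wf_ntm M \<and> decides_in (step M) M L (\<lambda>n. 2 ^ (n ^ k + k))}"

definition NP_with_oracle :: "bool list set \<Rightarrow> bool list set set" where
  "NP_with_oracle A = {L. \<exists>M k. wf_ntm M \<and> decides_in (ostep M A) M L (\<lambda>n. n ^ k + k)}"

definition NP_with_oracle_1 :: "bool list set \<Rightarrow> bool list set set" where
  "NP_with_oracle_1 A = {L. \<exists>M k. wf_ntm M \<and> decides_in (ostep M A) M L (\<lambda>n. n ^ k + k) \<and>
      (\<forall>w n c. (ostep M A ^^ n) (init M w) c \<longrightarrow> nq c \<le> 1)}"

definition NP_NEXP :: "bool list set set" where
  "NP_NEXP = (\<Union>A\<in>NEXP. NP_with_oracle A)"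

definition NP_NEXP_1 :: "bool list set set" where
  "NP_NEXP_1 = (\<Union>A\<in>NEXP. NP_with_oracle_1 A)"

definition DExp :: "bool list set set" where
  "DExp = {A \<inter> B | A B. A \<in> NEXP \<and> - B \<in> NEXP}"

definition coDExp :: "bool list set set" where
  "coDExp = {L. - L \<in> DExp}"

definition BH_NEXP_level :: "nat \<Rightarrow> bool list set set" where
  "BH_NEXP_level k = {L. \<exists>Ls :: nat \<Rightarrow> bool list set.
      (\<forall>z\<in>{1..k}. Ls z \<in> NEXP) \<and> (\<forall>z\<in>{1..<k}. Ls (Suc z) \<subseteq> Ls z) \<and>
      (\<forall>w. w \<in> L \<longleftrightarrow> odd (card {z \<in> {1..k}. w \<in> Ls z}))}"

definition BH_NEXP :: "bool list set set" where
  "BH_NEXP = (\<Union>k\<in>{1..}. BH_NEXP_level k)"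

end

theory Submission
  imports Defs "HOL-Library.Countable"
begin

text \<open>A machine with at most one query accepts iff it accepts on some path without query or with a
positively answered query, or on some path whose query is answered negatively. The first condition is in
NEXP. The complement of the second says that every path which accepts on the answer no asks a member of
the oracle; since there are only exponentially many paths, a nondeterministic exponential-time machine
can verify them one after the other. So one query stays within the class of complements of the difference
class. Conversely two queries decide every language of the difference class, so under the hypothesis that
class is closed under complement. It is closed under intersection anyway, hence under Boolean combinations,
and swallows the whole Boolean hierarchy.

Paths must be enumerated with an explicit clock: the time bound of an oracle machine concerns only runs with
correct answers.\<close>

section \<open>A nondeterministic tape language\<close>

text \<open>Membership in \<open>NEXP\<close> has to be shown for concrete machines, and
  \<open>decides_in\<close> bounds every run, rejecting and stuck ones included. So each algorithm
  is a program with a time bound for all its runs, and one compilation turns programs into machines.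
  A program accepts by finishing; a decider for the oracle can thus only confirm that a query
  belongs to the oracle. This one-sidedness decides which answer is treated existentially and which
  universally. The sizes fit together as follows. A path of polynomial length produces a query of at
  most that length, so checking the query takes exponential time. The number of paths is 2 to a
  polynomial, and a product of two exponential bounds is again one. Paths have length
  \<open>(n + 2) ^ k\<close>, which is at least the clock \<open>n ^ k + k\<close> and can be
  counted out exactly by nested loops over the input. In the other direction both queries must go to
  the same oracle although they concern two languages; a marked union of the two serves as that
  oracle.\<close>

datatype op = Wr nat nat nat | Ne nat nat | Mr nat | Ml nat | Cp nat nat nat

datatype prog = Op op | Skip | Fail | Seq prog prog | Cho prog prog | Star prog

instance op :: countable by countable_datatype
instance prog :: countable by countable_datatype

text \<open>Machines are written in a small nondeterministic language acting on a family of two-way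
infinite tapes, each a content together with a head position. \<open>Wr i a b\<close> tests that tape
\<open>i\<close> reads \<open>a\<close> and then writes \<open>b\<close>; \<open>Cp j a b\<close> gives tape \<open>j\<close> the content of tape \<open>a\<close> and
the head position of tape \<open>b\<close>. Failed tests kill the run, so \<open>Star\<close> with tests replaces
while loops.\<close>

type_synonym data = "nat \<Rightarrow> (int \<Rightarrow> nat) \<times> int"

definition rd :: "data \<Rightarrow> nat \<Rightarrow> nat" where
  "rd d i = fst (d i) (snd (d i))"

definition wr :: "data \<Rightarrow> nat \<Rightarrow> nat \<Rightarrow> data" where
  "wr d i b = d(i := ((fst (d i))(snd (d i) := b), snd (d i)))"

fun opsem :: "op \<Rightarrow> data \<Rightarrow> data \<Rightarrow> bool" where
  "opsem (Wr i a b) d d' \<longleftrightarrow> rd d i = a \<and> d' = wr d i b"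
| "opsem (Ne i a) d d' \<longleftrightarrow> rd d i \<noteq> a \<and> d' = d"
| "opsem (Mr i) d d' \<longleftrightarrow> d' = d(i := (fst (d i), snd (d i) + 1))"
| "opsem (Ml i) d d' \<longleftrightarrow> d' = d(i := (fst (d i), snd (d i) - 1))"
| "opsem (Cp j a b) d d' \<longleftrightarrow> d' = d(j := (fst (d a), snd (d b)))"

fun sem :: "prog \<Rightarrow> (data \<times> data) set" where
  "sem (Op x) = {(d, d'). opsem x d d'}"
| "sem Skip = Id"
| "sem Fail = {}"
| "sem (Seq p q) = sem p O sem q"
| "sem (Cho p q) = sem p \<union> sem q"
| "sem (Star p) = (sem p)\<^sup>*"

fun seml :: "prog list \<Rightarrow> (data \<times> data) set" where
  "seml [] = Id"
| "seml (p # K) = sem p O seml K"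

text \<open>\<open>sem\<close> relates only the ends of completed runs. Time bounds must also cover
  runs that die at a failed test, so the language gets a small-step semantics as well, with the
  programs still to be executed on a stack.\<close>

inductive cstep :: "prog list \<times> data \<Rightarrow> prog list \<times> data \<Rightarrow> bool" where
  "opsem x d d' \<Longrightarrow> cstep (Op x # K, d) (K, d')"
| "cstep (Skip # K, d) (K, d)"
| "cstep (Seq p q # K, d) (p # q # K, d)"
| "cstep (Cho p q # K, d) (p # K, d)"
| "cstep (Cho p q # K, d) (q # K, d)"
| "cstep (Star p # K, d) (K, d)"
| "cstep (Star p # K, d) (p # Star p # K, d)"

inductive_cases cstepE: "cstep (K, d) Y"
inductive_cases cstep_NilE: "cstep ([], d) Y"
inductive_cases cstep_OpE: "cstep (Op x # K, d) Y"
inductive_cases cstep_SkipE: "cstep (Skip # K, d) Y"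
inductive_cases cstep_FailE: "cstep (Fail # K, d) Y"
inductive_cases cstep_SeqE: "cstep (Seq p q # K, d) Y"
inductive_cases cstep_ChoE: "cstep (Cho p q # K, d) Y"
inductive_cases cstep_StarE: "cstep (Star p # K, d) Y"
lemmas cstep_elims = cstep_NilE cstep_OpE cstep_SkipE cstep_FailE cstep_SeqE cstep_ChoE cstep_StarE

lemma cstep_seml:
  assumes "cstep (K, d) (K', d')" "(d', e) \<in> seml K'"
  shows "(d, e) \<in> seml K"
  using assms
  by (cases rule: cstepE) (auto simp: relcomp.simps, blast, blast intro: converse_rtrancl_into_rtrancl)

lemma csteps_seml:
  assumes "cstep\<^sup>*\<^sup>* (K, d) ([], e)"
  shows "(d, e) \<in> seml K"
proof -
  have "cstep\<^sup>*\<^sup>* X Y \<Longrightarrow> Y = ([], e) \<Longrightarrow> (snd X, e) \<in> seml (fst X)" for X Y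
  proof (induction rule: converse_rtranclp_induct)
    case base
    then show ?case by simp
  next
    case (step X Z)
    then show ?case by (metis cstep_seml prod.collapse)
  qed
  then show ?thesis using assms by force
qed

lemma sem_csteps: "(d, e) \<in> sem p \<Longrightarrow> cstep\<^sup>*\<^sup>* (p # K, d) (K, e)"
proof (induction p arbitrary: d e K)
  case (Op x)
  then show ?case by (auto intro: cstep.intros)
next
  case Skip
  then show ?case by (auto intro: cstep.intros)
next
  case Fail
  then show ?case by simp
next
  case (Seq p q)
  then obtain f where "(d, f) \<in> sem p" "(f, e) \<in> sem q" by auto
  then have "cstep\<^sup>*\<^sup>* (p # q # K, d) (K, e)"
    using Seq.IH(1)[of d f "q # K"] Seq.IH(2)[of f e K] by auto
  then show ?case by (rule converse_rtranclp_into_rtranclp[of cstep, OF cstep.intros(3)])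
next
  case (Cho p q)
  then show ?case
    using converse_rtranclp_into_rtranclp[of cstep, OF cstep.intros(4)]
      converse_rtranclp_into_rtranclp[of cstep, OF cstep.intros(5)] by auto
next
  case (Star p)
  from Star.prems have "(d, e) \<in> (sem p)\<^sup>*" by simp
  then show ?case
  proof (induction rule: converse_rtrancl_induct)
    case base
    then show ?case by (auto intro: cstep.intros)
  next
    case (step y z)
    have "cstep\<^sup>*\<^sup>* (p # Star p # K, y) (Star p # K, z)" using Star.IH step by simp
    then have "cstep\<^sup>*\<^sup>* (p # Star p # K, y) (K, e)" using step.IH by auto
    then show ?case by (rule converse_rtranclp_into_rtranclp[of cstep, OF cstep.intros(7)])
  qed
qed

lemma csteps_iff_seml: "cstep\<^sup>*\<^sup>* (K, d) ([], e) \<longleftrightarrow> (d, e) \<in> seml K"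
proof
  show "(d, e) \<in> seml K \<Longrightarrow> cstep\<^sup>*\<^sup>* (K, d) ([], e)"
  proof (induction K arbitrary: d)
    case Nil
    then show ?case by simp
  next
    case (Cons p K)
    then obtain f where "(d, f) \<in> sem p" "(f, e) \<in> seml K" by auto
    then show ?case by (meson Cons.IH sem_csteps rtranclp_trans)
  qed
qed (rule csteps_seml)

section \<open>Time bounds for all runs of a program\<close>

fun bnd :: "nat \<Rightarrow> prog list \<times> data \<Rightarrow> bool" where
  "bnd 0 X \<longleftrightarrow> (\<forall>Y. \<not> cstep X Y)"
| "bnd (Suc t) X \<longleftrightarrow> (\<forall>Y. cstep X Y \<longrightarrow> bnd t Y)"

lemma bnd_Suc_mono: "bnd t X \<Longrightarrow> bnd (Suc t) X"
  by (induction t arbitrary: X) auto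

lemma bnd_mono: "bnd t X \<Longrightarrow> t \<le> t' \<Longrightarrow> bnd t' X"
  by (rotate_tac, induction rule: dec_induct) (auto simp: bnd_Suc_mono simp del: bnd.simps)

lemma bnd_step: "bnd t X \<Longrightarrow> cstep X Y \<Longrightarrow> \<exists>t'. t = Suc t' \<and> bnd t' Y"
  by (cases t) (simp_all del: split_paired_All split_paired_Ex)

lemma cstep_append:
  assumes "cstep (xs @ ys, d) Y" "xs \<noteq> []"
  obtains xs' d' where "Y = (xs' @ ys, d')" "cstep (xs, d) (xs', d')"
proof -
  obtain p K where xs: "xs = p # K" using assms(2) by (cases xs) auto
  have st: "cstep (p # K @ ys, d) Y" using assms xs by simp
  have "\<exists>xs' d'. Y = (xs' @ ys, d') \<and> cstep (p # K, d) (xs', d')"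
  proof (cases p)
    case (Seq q r)
    then show ?thesis
      using st cstep.intros(3)[of q r K d]
      by (auto elim!: cstep_elims intro!: exI[of _ "q # r # K"] cstep.intros(3))
  next
    case (Cho q r)
    then have "Y = (q # K @ ys, d) \<or> Y = (r # K @ ys, d)"
      using st by (auto elim!: cstep_elims)
    then show ?thesis
      using Cho cstep.intros(4,5)[of q r K d] by (metis append_Cons)
  next
    case (Star q)
    then have "Y = (K @ ys, d) \<or> Y = (q # Star q # K @ ys, d)"
      using st by (auto elim!: cstep_elims)
    then show ?thesis
      using Star cstep.intros(6,7)[of q K d] by (metis append_Cons)
  qed (use st in \<open>auto elim!: cstep_elims intro: cstep.intros\<close>)
  then show ?thesis using that xs by auto
qed

text \<open>A run either never leaves \<open>xs\<close>, at a cost of at most \<open>s\<close>, or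
  reaches \<open>ys\<close> in a state that \<open>seml xs\<close> allows. The bound for
  \<open>ys\<close> is needed only in such states, so it may rely on what \<open>xs\<close> has
  established.\<close>

lemma bnd_append:
  assumes "bnd s (xs, d)" "\<And>e. (d, e) \<in> seml xs \<Longrightarrow> bnd t (ys, e)"
  shows "bnd (s + t) (xs @ ys, d)"
  using assms
proof (induction s arbitrary: xs d)
  case 0
  show ?case
  proof (cases "xs = []")
    case True
    then show ?thesis using 0 by simp
  next
    case False
    have "\<not> cstep (xs @ ys, d) Y" for Y
    proof
      assume "cstep (xs @ ys, d) Y"
      then obtain xs' d' where "cstep (xs, d) (xs', d')" using False by (rule cstep_append)
      then show False using 0(1) by auto
    qed
    then have "bnd 0 (xs @ ys, d)" by simp
    then show ?thesis by (rule bnd_mono) simp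
  qed
next
  case (Suc s)
  show ?case
  proof (cases "xs = []")
    case True
    then show ?thesis using Suc.prems(2)[of d] bnd_mono[of t _ "Suc s + t"] by simp
  next
    case False
    have "bnd (s + t) Y" if step: "cstep (xs @ ys, d) Y" for Y
    proof -
      obtain xs' d' where Y: "Y = (xs' @ ys, d')" and c: "cstep (xs, d) (xs', d')"
        using step False by (rule cstep_append)
      have b: "bnd s (xs', d')" using Suc.prems(1) c by simp
      show ?thesis unfolding Y
        using Suc.IH[OF b] Suc.prems(2) cstep_seml[OF c] by blast
    qed
    then show ?thesis by simp
  qed
qed

text \<open>\<open>tb p d t\<close> bounds all runs, including the ones that get stuck: \<open>decides_in\<close> counts them too.\<close>

definition tb :: "prog \<Rightarrow> data \<Rightarrow> nat \<Rightarrow> bool" where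
  "tb p d t \<longleftrightarrow> bnd t ([p], d)"

lemma tb_mono: "tb p d t \<Longrightarrow> t \<le> t' \<Longrightarrow> tb p d t'"
  unfolding tb_def by (rule bnd_mono)

lemma bnd_Nil [simp]: "bnd t ([], d)"
  by (rule bnd_mono[of 0]) (auto elim: cstep_elims)

lemma tb_Op [simp]: "tb (Op x) d (Suc t)"
  unfolding tb_def by (auto elim!: cstep_elims)

lemma tb_Skip [simp]: "tb Skip d (Suc t)"
  unfolding tb_def by (auto elim!: cstep_elims)

lemma tb_Fail [simp]: "tb Fail d t"
  unfolding tb_def by (rule bnd_mono[of 0]) (auto elim!: cstep_elims)

lemma tb_Seq:
  assumes "tb p d s" "\<And>e. (d, e) \<in> sem p \<Longrightarrow> tb q e t"
  shows "tb (Seq p q) d (Suc (s + t))"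
  using bnd_append[of s "[p]" d t "[q]"] assms unfolding tb_def
  by (auto elim!: cstep_elims)

lemma tb_Cho:
  assumes "tb p d t" "tb q d t"
  shows "tb (Cho p q) d (Suc t)"
  using assms unfolding tb_def by (auto elim!: cstep_elims)

text \<open>The number \<open>m\<close> is a variant that every completed round decreases. This
  leaves room for \<open>m\<close> rounds and a last one that may get stuck, each at the cost of its
  body and one step for unfolding the loop.\<close>

lemma tb_Star:
  assumes inv: "I m d"
    and body: "\<And>m d. I m d \<Longrightarrow> tb p d t"
    and dec: "\<And>m d e. I m d \<Longrightarrow> (d, e) \<in> sem p \<Longrightarrow> \<exists>m'<m. I m' e"
  shows "tb (Star p) d ((m + 1) * (t + 1))"
  using inv
proof (induction m arbitrary: d rule: less_induct)
  case (less m)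
  have b: "bnd (t + m * (t + 1)) ([p] @ [Star p], d)"
  proof (rule bnd_append)
    show "bnd t ([p], d)" using body[OF less.prems] by (simp add: tb_def)
    fix e assume "(d, e) \<in> seml [p]"
    then obtain m' where m': "m' < m" "I m' e" using dec[OF less.prems] by auto
    have "(m' + 1) * (t + 1) \<le> m * (t + 1)" using m' by (intro mult_le_mono) auto
    then show "bnd (m * (t + 1)) ([Star p], e)"
      using less.IH[OF m'] bnd_mono unfolding tb_def by blast
  qed
  have "bnd (Suc (t + m * (t + 1))) ([Star p], d)"
    using b by (auto elim!: cstep_elims)
  moreover have "Suc (t + m * (t + 1)) = (m + 1) * (t + 1)" by simp
  ultimately show ?case unfolding tb_def by metis
qed

lemma tb_Cho': "tb p d s \<Longrightarrow> tb q d t \<Longrightarrow> tb (Cho p q) d (Suc (s + t))"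
  by (rule tb_Cho) (auto intro: tb_mono)

lemma Star_count:
  assumes "J 0 d" and st: "\<forall>l e f. J l e \<longrightarrow> (e, f) \<in> sem p \<longrightarrow> l < n \<and> J (Suc l) f"
  shows "(d, e) \<in> sem (Star p) \<Longrightarrow> \<exists>l\<le>n. J l e"
    and "\<forall>l e. J l e \<longrightarrow> tb p e t \<Longrightarrow> tb (Star p) d ((n + 1) * (t + 1))"
proof -
  show "\<exists>l\<le>n. J l e" if "(d, e) \<in> sem (Star p)"
    using that[unfolded sem.simps]
  proof induction
    case (step e g)
    then show ?case using st by (meson Suc_leI)
  qed (use assms(1) in auto)
  show "tb (Star p) d ((n + 1) * (t + 1))" if t: "\<forall>l e. J l e \<longrightarrow> tb p e t"
  proof (rule tb_Star[where I = "\<lambda>m e. \<exists>l. m = n - l \<and> J l e"])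
    show "\<exists>l. n = n - l \<and> J l d" using assms(1) by (intro exI[of _ 0]) simp
    fix m e g assume "\<exists>l. m = n - l \<and> J l e" "(e, g) \<in> sem p"
    then obtain l where "l < n" "m = n - l" "J (Suc l) g" using st by blast
    then show "\<exists>m'<m. \<exists>l. m' = n - l \<and> J l g" by (intro exI[of _ "n - Suc l"]) auto
  qed (use t in blast)
qed

text \<open>Covers deterministic loops, whose states run through \<open>f 0, f 1, ...\<close> while
  the guard \<open>Q\<close> holds. Since \<open>Star\<close> may stop after any number of rounds,
  the loop alone does not fix the result; the test placed behind it does.\<close>

lemma Star_chain:
  assumes st: "\<And>i e. i \<le> n \<Longrightarrow> (f i, e) \<in> sem p \<longleftrightarrow> i < n \<and> Q i \<and> e = f (Suc i)"
  shows "(f 0, e) \<in> sem (Star p) \<longleftrightarrow> (\<exists>i\<le>n. (\<forall>j<i. Q j) \<and> e = f i)"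
    and "(\<And>d. tb p d t) \<Longrightarrow> tb (Star p) (f 0) ((n + 1) * (t + 1))"
proof -
  let ?J = "\<lambda>i e. i \<le> n \<and> (\<forall>j<i. Q j) \<and> e = f i"
  have J: "?J 0 (f 0)" "\<forall>l e g. ?J l e \<longrightarrow> (e, g) \<in> sem p \<longrightarrow> l < n \<and> ?J (Suc l) g"
    using st by (auto simp: less_Suc_eq)
  have bwd: "(f 0, f i) \<in> (sem p)\<^sup>*" if "i \<le> n" "\<forall>j<i. Q j" for i
    using that
  proof (induction i)
    case (Suc i)
    then have "(f i, f (Suc i)) \<in> sem p" by (simp add: st)
    with Suc show ?case by (meson Suc_leD less_SucI rtrancl_into_rtrancl)
  qed simp
  show "(f 0, e) \<in> sem (Star p) \<longleftrightarrow> (\<exists>i\<le>n. (\<forall>j<i. Q j) \<and> e = f i)"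
  proof
    assume "(f 0, e) \<in> sem (Star p)"
    then show "\<exists>i\<le>n. (\<forall>j<i. Q j) \<and> e = f i" using Star_count(1)[where J = ?J, OF J] by blast
  qed (use bwd in auto)
  show "tb (Star p) (f 0) ((n + 1) * (t + 1))" if "\<And>d. tb p d t"
    using Star_count(2)[where J = ?J, OF J] that by blast
qed

text \<open>A time bound for loop-free programs only. A loop counts 1, and where such a number
  enters a bound it serves merely as a constant independent of the input.\<close>

fun cost :: "prog \<Rightarrow> nat" where
  "cost (Seq p q) = Suc (cost p + cost q)"
| "cost (Cho p q) = Suc (cost p + cost q)"
| "cost _ = 1"

fun loopfree :: "prog \<Rightarrow> bool" where
  "loopfree (Seq p q) \<longleftrightarrow> loopfree p \<and> loopfree q"
| "loopfree (Cho p q) \<longleftrightarrow> loopfree p \<and> loopfree q"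
| "loopfree (Star p) \<longleftrightarrow> False"
| "loopfree _ \<longleftrightarrow> True"

lemma tb_loopfree: "loopfree p \<Longrightarrow> tb p d (cost p)"
proof (induction p arbitrary: d)
  case (Cho p q)
  have "tb p d (cost p + cost q)" "tb q d (cost p + cost q)"
    using Cho by (simp_all add: tb_mono[OF _ le_add1] tb_mono[OF _ le_add2])
  then show ?case by (simp add: tb_Cho)
qed (auto intro: tb_Seq)

fun seqs :: "prog list \<Rightarrow> prog" where
  "seqs [] = Skip"
| "seqs (p # ps) = Seq p (seqs ps)"

fun chos :: "prog list \<Rightarrow> prog" where
  "chos [] = Fail"
| "chos (p # ps) = Cho p (chos ps)"

lemma sem_seqs_Cons: "(d, e) \<in> sem (seqs (p # ps)) \<longleftrightarrow> (\<exists>f. (d, f) \<in> sem p \<and> (f, e) \<in> sem (seqs ps))"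
  by auto

lemma tb_seqs_Nil [simp]: "tb (seqs []) d (Suc t)"
  by simp

lemma tb_seqs_Cons:
  assumes "tb p d s" "\<And>e. (d, e) \<in> sem p \<Longrightarrow> tb (seqs ps) e t"
  shows "tb (seqs (p # ps)) d (Suc (s + t))"
  using tb_Seq[OF assms] by simp

lemma loopfree_seqs [simp]: "loopfree (seqs ps) \<longleftrightarrow> (\<forall>p\<in>set ps. loopfree p)"
  by (induction ps) auto

lemma sem_chos [simp]: "sem (chos ps) = (\<Union>p\<in>set ps. sem p)"
  by (induction ps) auto

lemma loopfree_chos [simp]: "loopfree (chos ps) \<longleftrightarrow> (\<forall>p\<in>set ps. loopfree p)"
  by (induction ps) auto

section \<open>Compilation to Turing machines\<close>

text \<open>The control part of \<open>cstep\<close>, labelled with the operation to be carried out.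
  The data is left out, because the finite control of a machine has to manage without it.\<close>

inductive kstep :: "prog list \<Rightarrow> op option \<Rightarrow> prog list \<Rightarrow> bool" where
  "kstep (Op x # K) (Some x) K"
| "kstep (Skip # K) None K"
| "kstep (Seq p q # K) None (p # q # K)"
| "kstep (Cho p q # K) None (p # K)"
| "kstep (Cho p q # K) None (q # K)"
| "kstep (Star p # K) None K"
| "kstep (Star p # K) None (p # Star p # K)"

lemma cstep_iff_kstep:
  "cstep (K, d) (K', d') \<longleftrightarrow>
     kstep K None K' \<and> d' = d \<or> (\<exists>x. kstep K (Some x) K' \<and> opsem x d d')"
  by (auto simp: cstep.simps kstep.simps)

text \<open>The stacks that can arise from \<open>p # K\<close>. They are finite in number because a
  loop body is always started on the same stack \<open>Star p # K\<close>; hence they can serve as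
  states of a machine.\<close>

fun conts :: "prog \<Rightarrow> prog list \<Rightarrow> prog list set" where
  "conts (Seq p q) K = {Seq p q # K} \<union> conts p (q # K) \<union> conts q K"
| "conts (Cho p q) K = {Cho p q # K} \<union> conts p K \<union> conts q K"
| "conts (Star p) K = {Star p # K} \<union> conts p (Star p # K)"
| "conts p K = {p # K}"

fun ops :: "prog \<Rightarrow> op set" where
  "ops (Seq p q) = ops p \<union> ops q"
| "ops (Cho p q) = ops p \<union> ops q"
| "ops (Star p) = ops p"
| "ops (Op x) = {x}"
| "ops Skip = {}"
| "ops Fail = {}"

lemma finite_conts: "finite (conts p K)"
  by (induction p arbitrary: K) auto

lemma finite_ops: "finite (ops p)"
  by (induction p) auto

lemma conts_refl: "p # K \<in> conts p K"
  by (cases p) auto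

lemma conts_kstep: "K0 \<in> conts p K \<Longrightarrow> kstep K0 x K1 \<Longrightarrow> K1 \<in> insert K (conts p K)"
proof (induction p arbitrary: K)
  case (Seq p q)
  then show ?case
    using conts_refl[of p "q # K"] conts_refl[of q K] by (fastforce elim: kstep.cases)
next
  case (Cho p q)
  then show ?case
    using conts_refl[of p K] conts_refl[of q K] by (fastforce elim: kstep.cases)
next
  case (Star p)
  then show ?case
    using conts_refl[of p "Star p # K"] by (fastforce elim: kstep.cases)
qed (auto elim: kstep.cases)

lemma conts_ops: "K0 \<in> conts p K \<Longrightarrow> kstep K0 (Some x) K1 \<Longrightarrow> x \<in> ops p"
  by (induction p arbitrary: K) (auto elim: kstep.cases)

fun tapes :: "op \<Rightarrow> nat set" where
  "tapes (Wr i a b) = {i}" | "tapes (Ne i a) = {i}" | "tapes (Mr i) = {i}"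
| "tapes (Ml i) = {i}" | "tapes (Cp j a b) = {j, a, b}"

fun symb :: "op \<Rightarrow> nat" where
  "symb (Wr i a b) = b"
| "symb _ = 0"

text \<open>All tapes are tracks of one tape. A visited cell stores, for every track, its symbol and whether
the head of that track is here; \<open>0\<close> marks cells that were never visited. Each operation is one
sweep from the unvisited cell on the left to the unvisited cell on the right (state \<open>Sw\<close>), which
enlarges the visited interval by one on both sides, followed by a run back to the left (state \<open>Bk\<close>).\<close>

datatype ctl = Ac | I0 | I1 | Bk "prog list" | Sw op "prog list" bool

instance ctl :: countable by countable_datatype

type_synonym cell = "(nat \<times> bool) list"

text \<open>The offset separates codes from the raw input symbols \<open>1\<close> and \<open>2\<close> and from the unvisited \<open>0\<close>.\<close>

definition code :: "cell \<Rightarrow> nat" where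
  "code u = to_nat u + 3"

lemma code_inj [simp]: "code u = code v \<longleftrightarrow> u = v"
  by (simp add: code_def)

lemma code_nz [simp]: "code u \<noteq> 0" "0 \<noteq> code u" "code u \<noteq> Suc 0" "code u \<noteq> 2"
  by (simp_all add: code_def)

text \<open>One cell of a sweep, with the state before and after. When a head moves right, the state carries
the mark to the next cell; when it moves left, the state is a guess that the next cell is the marked
one, which that cell then has to confirm.\<close>

fun sw :: "op \<Rightarrow> bool \<Rightarrow> cell \<Rightarrow> cell \<Rightarrow> bool \<Rightarrow> bool" where
  "sw (Wr i a b) s u v s' \<longleftrightarrow> \<not> s \<and> \<not> s' \<and>
     (snd (u ! i) \<longrightarrow> fst (u ! i) = a) \<and> v = u[i := (if snd (u ! i) then b else fst (u ! i), snd (u ! i))]"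
| "sw (Ne i a) s u v s' \<longleftrightarrow> \<not> s \<and> \<not> s' \<and> v = u \<and> (snd (u ! i) \<longrightarrow> fst (u ! i) \<noteq> a)"
| "sw (Mr i) s u v s' \<longleftrightarrow> v = u[i := (fst (u ! i), s)] \<and> s' = snd (u ! i)"
| "sw (Ml i) s u v s' \<longleftrightarrow> v = u[i := (fst (u ! i), s')] \<and> s = snd (u ! i)"
| "sw (Cp j a b) s u v s' \<longleftrightarrow> \<not> s \<and> \<not> s' \<and> v = u[j := (fst (u ! a), snd (u ! b))]"

definition blank :: "nat \<Rightarrow> cell" where
  "blank k = replicate k (0, False)"

text \<open>\<open>I0\<close> and \<open>I1\<close> recode the input. \<open>I0\<close> also accepts
  a blank, so that the empty input still yields one visited cell, the one carrying all head marks. A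
  sweep starts and must end in state \<open>False\<close>: no mark enters from the left or is
  carried out on the right, and no guess stays unconfirmed.\<close>

inductive tr :: "nat \<Rightarrow> prog \<Rightarrow> ctl \<Rightarrow> nat \<Rightarrow> ctl \<Rightarrow> nat \<Rightarrow> int \<Rightarrow> bool" for k p where
  "x \<in> {0, 1, 2} \<Longrightarrow> tr k p I0 x I1 (code ((x, True) # replicate (k - 1) (0, True))) 1"
| "x \<in> {1, 2} \<Longrightarrow> tr k p I1 x I1 (code ((x, False) # replicate (k - 1) (0, False))) 1"
| "tr k p I1 0 (Bk [p]) 0 (-1)"
| "tr k p (Bk K) (code u) (Bk K) (code u) (-1)"
| "tr k p (Bk []) 0 Ac 0 0"
| "kstep K None K' \<Longrightarrow> tr k p (Bk K) 0 (Bk K') 0 0"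
| "kstep K (Some x) K' \<Longrightarrow> sw x False (blank k) v s \<Longrightarrow> tr k p (Bk K) 0 (Sw x K' s) (code v) 1"
| "sw x s u v s' \<Longrightarrow> tr k p (Sw x K s) (code u) (Sw x K s') (code v) 1"
| "sw x s (blank k) v False \<Longrightarrow> tr k p (Sw x K s) 0 (Bk K) (code v) (-1)"

text \<open>The numbers 0, 1, 2 are reserved for the accepting, the rejecting and the query state of
  the machine.\<close>

definition en :: "ctl \<Rightarrow> nat" where
  "en s = (if s = Ac then 0 else to_nat s + 3)"

lemma en_inj [simp]: "en s = en s' \<longleftrightarrow> s = s'"
  by (auto simp: en_def)

lemma en_simps [simp]: "en s = 0 \<longleftrightarrow> s = Ac" "en s \<noteq> Suc 0" "en s \<noteq> 2"
  by (auto simp: en_def)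

definition cellof :: "nat \<Rightarrow> data \<Rightarrow> int \<Rightarrow> cell" where
  "cellof k d x = map (\<lambda>i. (fst (d i) x, snd (d i) = x)) [0..<k]"

definition enc :: "bool list \<Rightarrow> int \<Rightarrow> nat" where
  "enc w = (\<lambda>i. if 0 \<le> i \<and> i < int (length w) then (if w ! nat i then 2 else 1) else 0)"

definition d0 :: "bool list \<Rightarrow> data" where
  "d0 w = (\<lambda>i. (if i = 0 then enc w else (\<lambda>_. 0), 0))"

text \<open>\<open>k\<close> is the number of tracks and \<open>S\<close> bounds the symbols, so
  that the cells form a finite alphabet; the input itself requires the symbol 2.\<close>

locale comp =
  fixes p :: prog and k S :: nat
  assumes k: "0 < k" "\<And>x. x \<in> ops p \<Longrightarrow> tapes x \<subseteq> {..<k}"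
    and S: "2 \<le> S" "\<And>x. x \<in> ops p \<Longrightarrow> symb x \<le> S"
begin

definition KK :: "prog list set" where "KK = insert [] (conts p [])"

definition St :: "ctl set" where
  "St = {Ac, I0, I1} \<union> Bk ` KK \<union> (\<lambda>(x, K, s). Sw x K s) ` (ops p \<times> KK \<times> UNIV)"

definition Cells :: "cell set" where
  "Cells = {u. set u \<subseteq> {..S} \<times> UNIV \<and> length u = k}"

definition Sym :: "nat set" where
  "Sym = {0, 1, 2} \<union> code ` Cells"

definition M :: ntm where
  "M = \<lparr>delta = {(en s, x, 0, en s', x', 0, m, 0) | s x s' x' m.
                  tr k p s x s' x' m \<and> s \<in> St \<and> x \<in> Sym \<and> s' \<in> St \<and> x' \<in> Sym},
        start = en I0, acc = 0, rej = 1, qry = 2, qyes = 0, qno = 0\<rparr>"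

lemma tr_dir: "tr k p s x s' x' m \<Longrightarrow> m \<in> {-1, 0, 1}"
  by (auto elim: tr.cases)

lemma tr_Ac [simp]: "\<not> tr k p Ac x s' x' m"
  by (auto elim: tr.cases)

lemma fin: "finite St" "finite Sym"
proof -
  have "finite KK" by (simp add: KK_def finite_conts)
  then show "finite St" by (simp add: St_def finite_ops)
  have "finite Cells" unfolding Cells_def by (rule finite_lists_length_eq) simp
  then show "finite Sym" by (simp add: Sym_def)
qed

lemma wf_M: "wf_ntm M"
proof -
  have "delta M \<subseteq> (en ` St) \<times> Sym \<times> {0} \<times> (en ` St) \<times> Sym \<times> {0} \<times> {-1, 0, 1} \<times> {0}"
  proof
    fix e assume "e \<in> delta M"
    then obtain s x s' x' m where "e = (en s, x, 0, en s', x', 0, m, 0)" "tr k p s x s' x' m"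
      "s \<in> St" "x \<in> Sym" "s' \<in> St" "x' \<in> Sym" unfolding M_def by auto
    then show "e \<in> (en ` St) \<times> Sym \<times> {0} \<times> (en ` St) \<times> Sym \<times> {0} \<times> {-1, 0, 1} \<times> {0}"
      using tr_dir[of s x s' x' m] by simp
  qed
  moreover have "finite \<dots>" using fin by (intro finite_cartesian_product finite_imageI) simp_all
  ultimately have "finite (delta M)" by (rule finite_subset)
  moreover have "q \<notin> {acc M, rej M, qry M} \<and> m1 \<in> {-1, 0, 1} \<and> m2 \<in> {-1, 0, 1}"
    if "(q, a, b, q', a', b', m1, m2) \<in> delta M" for q a b q' a' b' m1 m2
  proof -
    from that obtain s s' where "q = en s" "tr k p s a s' a' m1" "m2 = 0"
      unfolding M_def by auto
    then show ?thesis using tr_dir[of s a s' a' m1] by (auto simp: M_def)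
  qed
  ultimately show ?thesis unfolding wf_ntm_def by (auto simp: M_def)
qed

definition tst :: "ctl \<times> (int \<Rightarrow> nat) \<times> int \<Rightarrow> ctl \<times> (int \<Rightarrow> nat) \<times> int \<Rightarrow> bool" where
  "tst = (\<lambda>(s, c, x) (s', c', x'). \<exists>b m. tr k p s (c x) s' b m \<and> s \<in> St \<and> s' \<in> St \<and>
      c x \<in> Sym \<and> b \<in> Sym \<and> c' = c(x := b) \<and> x' = x + m)"

definition conc :: "ctl \<times> (int \<Rightarrow> nat) \<times> int \<Rightarrow> conf" where
  "conc = (\<lambda>(s, c, x). \<lparr>cstate = en s, tp1 = c, hd1 = x, tp2 = (\<lambda>_. 0), hd2 = 0, nq = 0\<rparr>)"

lemma step_conc: "step M (conc a) y \<longleftrightarrow> (\<exists>b. tst a b \<and> y = conc b)"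
proof -
  obtain s c x where a: "a = (s, c, x)" by (cases a)
  have id: "(\<lambda>_. 0 :: nat)(0 :: int := 0) = (\<lambda>_. 0)" by auto
  have D: "(en s, c x, 0, q', a', b', m1, m2) \<in> delta M \<longleftrightarrow>
    (\<exists>s'. q' = en s' \<and> b' = 0 \<and> m2 = 0 \<and> tr k p s (c x) s' a' m1 \<and> s \<in> St \<and> c x \<in> Sym \<and>
       s' \<in> St \<and> a' \<in> Sym)" for q' a' b' m1 m2
    by (auto simp: M_def)
  show ?thesis (is "?L \<longleftrightarrow> ?R")
  proof
    assume ?L
    then obtain s' a' m1 where *: "tr k p s (c x) s' a' m1" "s \<in> St" "c x \<in> Sym" "s' \<in> St" "a' \<in> Sym"
      "y = conc (s', c(x := a'), x + m1)"
      unfolding a step_def by (auto simp: conc_def D id)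
    then have "tst a (s', c(x := a'), x + m1)" unfolding a tst_def by auto
    with * show ?R by blast
  next
    assume ?R
    then obtain s' a' m1 where *: "tr k p s (c x) s' a' m1" "s \<in> St" "c x \<in> Sym" "s' \<in> St" "a' \<in> Sym"
      "y = conc (s', c(x := a'), x + m1)"
      unfolding a tst_def by auto
    then have "(en s, c x, 0, en s', a', 0, m1, 0) \<in> delta M" by (simp add: D)
    with * show ?L unfolding a step_def by (fastforce simp: conc_def id)
  qed
qed

lemma steps_conc: "(step M ^^ n) (conc a) y \<longleftrightarrow> (\<exists>b. (tst ^^ n) a b \<and> y = conc b)"
proof (induction n arbitrary: y)
  case (Suc n)
  have "(step M ^^ Suc n) (conc a) y \<longleftrightarrow> (\<exists>b. (tst ^^ n) a b \<and> step M (conc b) y)"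
    using Suc.IH by (auto simp del: split_paired_Ex simp: relcompp.simps)
  also have "\<dots> \<longleftrightarrow> (\<exists>b. (tst ^^ Suc n) a b \<and> y = conc b)"
    by (auto simp del: split_paired_Ex simp: relcompp.simps step_conc)
  finally show ?case .
qed auto

section \<open>One operation as one sweep\<close>

definition valid :: "int \<Rightarrow> int \<Rightarrow> data \<Rightarrow> bool" where
  "valid lo hi d \<longleftrightarrow> lo \<le> hi \<and> (\<forall>x. x < lo \<or> hi < x \<longrightarrow> cellof k d x = blank k) \<and>
     (\<forall>x. cellof k d x \<in> Cells)"

definition tape :: "int \<Rightarrow> int \<Rightarrow> data \<Rightarrow> int \<Rightarrow> nat" where
  "tape lo hi d = (\<lambda>x. if lo \<le> x \<and> x \<le> hi then code (cellof k d x) else 0)"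

lemma cellof_nth [simp]: "i < k \<Longrightarrow> cellof k d x ! i = (fst (d i) x, snd (d i) = x)"
  by (simp add: cellof_def)

lemma length_cellof [simp]: "length (cellof k d x) = k"
  by (simp add: cellof_def)

lemma cellof_eq_iff:
  "u = cellof k d x \<longleftrightarrow> length u = k \<and> (\<forall>i<k. u ! i = (fst (d i) x, snd (d i) = x))"
  by (metis cellof_nth length_cellof nth_equalityI)

lemma blank_iff: "cellof k d x = blank k \<longleftrightarrow> (\<forall>i<k. fst (d i) x = 0 \<and> snd (d i) \<noteq> x)"
  by (auto simp: list_eq_iff_nth_eq blank_def)

lemma Cells_iff: "cellof k d x \<in> Cells \<longleftrightarrow> (\<forall>i<k. fst (d i) x \<le> S)"
  by (fastforce simp: Cells_def cellof_def)

lemma valid_iff: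
  "valid lo hi d \<longleftrightarrow> lo \<le> hi \<and>
     (\<forall>i<k. (\<forall>x. x < lo \<or> hi < x \<longrightarrow> fst (d i) x = 0) \<and> (\<forall>x. fst (d i) x \<le> S) \<and>
            lo \<le> snd (d i) \<and> snd (d i) \<le> hi)"
  unfolding valid_def blank_iff Cells_iff by (auto simp flip: linorder_not_less)

lemma opsem_valid:
  assumes "opsem x d d'" "valid lo hi d" "tapes x \<subseteq> {..<k}" "symb x \<le> S"
  shows "valid (lo - 1) (hi + 1) d'"
  using assms by (cases x) (auto simp: valid_iff wr_def split: if_splits) 

text \<open>Local consistency along the tape amounts to the global operation. \<open>st z\<close> is
  the state on entering cell \<open>z\<close>. For \<open>Mr\<close> the states are forced from the
  left, for \<open>Ml\<close> from the right, each time starting at a boundary value; in the other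
  cases they are constantly \<open>False\<close>. Old heads lie between \<open>lo\<close> and
  \<open>hi\<close>, so every test meets its head and the widened interval contains the new
  positions.\<close>

lemma sweep_iff:
  assumes v: "valid lo hi d" and t: "tapes x \<subseteq> {..<k}"
  shows "(\<exists>st. \<not> st (lo - 1) \<and> \<not> st (hi + 2) \<and>
            (\<forall>z\<in>{lo-1..hi+1}. sw x (st z) (cellof k d z) (f z) (st (z + 1)))) \<longleftrightarrow>
         (\<exists>d'. opsem x d d' \<and> (\<forall>z\<in>{lo-1..hi+1}. f z = cellof k d' z))"
proof -
  let ?I = "{lo-1..hi+1}"
  have vi: "lo \<le> snd (d i) \<and> snd (d i) \<le> hi" if "i < k" for i
    using v that by (auto simp: valid_iff)
  have le: "lo \<le> hi" using v by (simp add: valid_def)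
  have upd: "cellof k (d(i := (g, h))) z = (cellof k d z)[i := (g z, h = z)]" if "i < k" for i g h z
    using that by (intro sym[OF cellof_eq_iff[THEN iffD2]]) (auto simp: nth_list_update)
  show ?thesis
  proof (cases x)
    case (Wr i a b)
    then have i: "i < k" using t by simp
    have s: "sw x s (cellof k d z) (f z) s' \<longleftrightarrow> \<not> s \<and> \<not> s' \<and> (snd (d i) = z \<longrightarrow> rd d i = a) \<and>
        f z = cellof k (wr d i b) z" for s s' z
      using i by (auto simp: Wr wr_def upd rd_def)
    have "snd (d i) \<in> ?I" using vi[OF i] by simp
    then show ?thesis unfolding s unfolding Wr by (auto intro!: exI[of _ "\<lambda>_. False"])
  next
    case (Ne i a)
    then have i: "i < k" using t by simp
    have s: "sw x s (cellof k d z) (f z) s' \<longleftrightarrow> \<not> s \<and> \<not> s' \<and> (snd (d i) = z \<longrightarrow> rd d i \<noteq> a) \<and>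
        f z = cellof k d z" for s s' z
      using i by (auto simp: Ne rd_def)
    have "snd (d i) \<in> ?I" using vi[OF i] by simp
    then show ?thesis unfolding s unfolding Ne by (auto intro!: exI[of _ "\<lambda>_. False"])
  next
    case (Mr i)
    then have i: "i < k" using t by simp
    have s: "sw x s (cellof k d z) (f z) s' \<longleftrightarrow>
        f z = (cellof k d z)[i := (fst (d i) z, s)] \<and> s' = (snd (d i) = z)" for s s' z
      using i by (auto simp: Mr)
    let ?st = "\<lambda>z. snd (d i) + 1 = z"
    have "(\<exists>st. \<not> st (lo - 1) \<and> \<not> st (hi + 2) \<and> (\<forall>z\<in>?I. sw x (st z) (cellof k d z) (f z) (st (z + 1)))) \<longleftrightarrow>
        (\<forall>z\<in>?I. f z = (cellof k d z)[i := (fst (d i) z, ?st z)])" (is "?L \<longleftrightarrow> ?R")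
    proof
      assume ?L
      then obtain st where st: "\<not> st (lo - 1)" "\<And>z. z \<in> ?I \<Longrightarrow> f z = (cellof k d z)[i := (fst (d i) z, st z)]"
          "\<And>z. z \<in> ?I \<Longrightarrow> st (z + 1) = (snd (d i) = z)" unfolding s by blast
      have "st z = ?st z" if "z \<in> ?I" for z
        using st(3)[of "z - 1"] st(1) vi[OF i] that by (cases "z = lo - 1") auto
      then show ?R using st(2) by auto
    next
      assume ?R
      then show ?L unfolding s using vi[OF i] by (intro exI[of _ ?st]) auto
    qed
    then show ?thesis using i by (simp add: Mr upd)
  next
    case (Ml i)
    then have i: "i < k" using t by simp
    have s: "sw x s (cellof k d z) (f z) s' \<longleftrightarrow>
        f z = (cellof k d z)[i := (fst (d i) z, s')] \<and> s = (snd (d i) = z)" for s s' z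
      using i by (auto simp: Ml)
    let ?st = "\<lambda>z. snd (d i) - 1 = z"
    have "(\<exists>st. \<not> st (lo - 1) \<and> \<not> st (hi + 2) \<and> (\<forall>z\<in>?I. sw x (st z) (cellof k d z) (f z) (st (z + 1)))) \<longleftrightarrow>
        (\<forall>z\<in>?I. f z = (cellof k d z)[i := (fst (d i) z, ?st z)])" (is "?L \<longleftrightarrow> ?R")
    proof
      assume ?L
      then obtain st where st: "\<not> st (hi + 2)" "\<And>z. z \<in> ?I \<Longrightarrow> f z = (cellof k d z)[i := (fst (d i) z, st (z + 1))]"
          "\<And>z. z \<in> ?I \<Longrightarrow> st z = (snd (d i) = z)" unfolding s by blast
      have "st (z + 1) = ?st z" if "z \<in> ?I" for z
        using st(3)[of "z + 1"] st(1) vi[OF i] that by (cases "z = hi + 1") (auto simp: add.commute)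
      then show ?R using st(2) by auto
    next
      assume ?R
      then show ?L unfolding s using vi[OF i] by (intro exI[of _ "\<lambda>z. snd (d i) = z"]) (auto simp: algebra_simps)
    qed
    then show ?thesis using i by (simp add: Ml upd)
  next
    case (Cp j a b)
    then have i: "j < k" "a < k" "b < k" using t by auto
    have s: "sw x s (cellof k d z) (f z) s' \<longleftrightarrow> \<not> s \<and> \<not> s' \<and>
        f z = cellof k (d(j := (fst (d a), snd (d b)))) z" for s s' z
      using i by (auto simp: Cp upd)
    show ?thesis unfolding s unfolding Cp using le by (auto intro!: exI[of _ "\<lambda>_. False"])
  qed
qed

definition ov :: "(int \<Rightarrow> cell) \<Rightarrow> (int \<Rightarrow> nat) \<Rightarrow> int \<Rightarrow> int \<Rightarrow> int \<Rightarrow> nat" where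
  "ov f c a b = (\<lambda>z. if a \<le> z \<and> z \<le> b then code (f z) else c z)"

lemma ov_upd: "x \<le> b \<Longrightarrow> ov f (c(x := code (f x))) (x + 1) b = ov f c x b"
  by (auto simp: ov_def)

lemma code_Sym [simp]: "code u \<in> Sym \<longleftrightarrow> u \<in> Cells"
  by (auto simp: Sym_def)

lemma Sym_small [simp]: "0 \<in> Sym" "Suc 0 \<in> Sym" "2 \<in> Sym"
  by (auto simp: Sym_def)

lemma St_simps [simp]: "Ac \<in> St" "I0 \<in> St" "I1 \<in> St" "Bk K \<in> St \<longleftrightarrow> K \<in> KK"
  "Sw x K s \<in> St \<longleftrightarrow> x \<in> ops p \<and> K \<in> KK"
  by (auto simp: St_def image_iff)

lemma blank_Cells [simp]: "blank k \<in> Cells"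
  by (auto simp: blank_def Cells_def)

lemma sweep_fwd:
  assumes "x + int n = hi + 1" "\<And>z. x \<le> z \<Longrightarrow> z \<le> hi \<Longrightarrow> c z = code (g z)" "c (hi + 1) = 0"
    "g (hi + 1) = blank k" "\<And>z. z \<in> {x..hi+1} \<Longrightarrow> sw a (st z) (g z) (f z) (st (z + 1))"
    "\<not> st (hi + 2)" "\<And>z. g z \<in> Cells" "\<And>z. z \<in> {x..hi+1} \<Longrightarrow> f z \<in> Cells" "a \<in> ops p" "K \<in> KK"
  shows "tst\<^sup>*\<^sup>* (Sw a K (st x), c, x) (Bk K, ov f c x (hi + 1), hi)"
  using assms
proof (induction n arbitrary: x c)
  case 0
  have "x = hi + 1" using 0(1) by simp
  then have "tr k p (Sw a K (st x)) (c x) (Bk K) (code (f x)) (-1)"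
    using 0(3,4,6) 0(5)[of x] by (auto intro!: tr.intros(9) simp: add.commute)
  then have "tst (Sw a K (st x), c, x) (Bk K, c(x := code (f x)), x - 1)"
    unfolding tst_def using 0 \<open>x = hi + 1\<close>
    by (auto intro!: exI[of _ "code (f x)"] exI[of _ "- 1 :: int"])
  moreover have "c(x := code (f x)) = ov f c x (hi + 1)" using \<open>x = hi + 1\<close> by (auto simp: ov_def fun_eq_iff)
  ultimately show ?case using \<open>x = hi + 1\<close> by auto
next
  case (Suc n)
  have xle: "x \<le> hi" using Suc.prems(1) by simp
  have "tr k p (Sw a K (st x)) (code (g x)) (Sw a K (st (x + 1))) (code (f x)) 1"
    using xle Suc.prems(5)[of x] by (auto intro!: tr.intros(8))
  then have "tst (Sw a K (st x), c, x) (Sw a K (st (x + 1)), c(x := code (f x)), x + 1)"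
    unfolding tst_def using Suc.prems(2)[of x] Suc.prems(7-10) xle by auto
  moreover have "tst\<^sup>*\<^sup>* (Sw a K (st (x + 1)), c(x := code (f x)), x + 1)
     (Bk K, ov f (c(x := code (f x))) (x + 1) (hi + 1), hi)"
    by (rule Suc.IH) (use Suc.prems in auto)
  ultimately show ?case using ov_upd[of x "hi + 1"] xle
    by (auto intro: converse_rtranclp_into_rtranclp)
qed

text \<open>Needed for time as well as for correctness. A run cut off inside the sweep has made at
  most \<open>n\<close> steps and cannot be in \<open>Ac\<close>; a longer one has completed the
  sweep, and the cells it wrote and the states it used can be read off.\<close>

lemma sweep_bwd:
  assumes "x + int n = hi + 1" "\<And>z. x \<le> z \<Longrightarrow> z \<le> hi \<Longrightarrow> c z = code (g z)" "c (hi + 1) = 0"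
    "g (hi + 1) = blank k" "(tst ^^ m) (Sw a K s, c, x) y"
  shows "(m \<le> n \<and> fst y \<noteq> Ac) \<or>
    (\<exists>st f. st x = s \<and> \<not> st (hi + 2) \<and> (\<forall>z\<in>{x..hi+1}. sw a (st z) (g z) (f z) (st (z + 1))) \<and>
      Suc n \<le> m \<and> (tst ^^ (m - Suc n)) (Bk K, ov f c x (hi + 1), hi) y)"
  using assms
proof (induction n arbitrary: x c m s)
  case 0
  have x: "x = hi + 1" using 0(1) by simp
  show ?case
  proof (cases m)
    case (Suc m')
    with 0(5) obtain w where w: "tst (Sw a K s, c, x) w" "(tst ^^ m') w y" by (metis relpowp_Suc_D2)
    have "c x = 0" using 0(3) x by simp
    then obtain v where v: "sw a s (blank k) v False" "w = (Bk K, c(x := code v), x - 1)"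
      using w(1) unfolding tst_def by (auto elim!: tr.cases)
    have "c(x := code v) = ov (\<lambda>_. v) c x (hi + 1)" using x by (auto simp: ov_def)
    then show ?thesis using v w(2) x Suc 0(4)
      by (intro disjI2 exI[of _ "(\<lambda>_. False)(x := s)"] exI[of _ "\<lambda>_. v"]) auto
  qed (use 0 in auto)
next
  case (Suc n)
  have xle: "x \<le> hi" using Suc.prems(1) by simp
  show ?case
  proof (cases m)
    case (Suc m')
    with Suc.prems(5) obtain w where w: "tst (Sw a K s, c, x) w" "(tst ^^ m') w y"
      by (metis relpowp_Suc_D2)
    have "c x = code (g x)" using Suc.prems(2) xle by simp
    then obtain v s' where v: "sw a s (g x) v s'" "w = (Sw a K s', c(x := code v), x + 1)"
      using w(1) unfolding tst_def by (auto elim!: tr.cases)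
    have "m' \<le> n \<and> fst y \<noteq> Ac \<or>
      (\<exists>st f. st (x + 1) = s' \<and> \<not> st (hi + 2) \<and> (\<forall>z\<in>{x+1..hi+1}. sw a (st z) (g z) (f z) (st (z + 1))) \<and>
      Suc n \<le> m' \<and> (tst ^^ (m' - Suc n)) (Bk K, ov f (c(x := code v)) (x + 1) (hi + 1), hi) y)"
    proof (rule Suc.IH)
      show "(tst ^^ m') (Sw a K s', c(x := code v), x + 1) y" using w v by simp
    qed (use Suc.prems in auto)
    then show ?thesis
    proof
      assume "m' \<le> n \<and> fst y \<noteq> Ac"
      then show ?thesis using Suc by simp
    next
      assume "\<exists>st f. st (x + 1) = s' \<and> \<not> st (hi + 2) \<and> (\<forall>z\<in>{x+1..hi+1}. sw a (st z) (g z) (f z) (st (z + 1))) \<and>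
        Suc n \<le> m' \<and> (tst ^^ (m' - Suc n)) (Bk K, ov f (c(x := code v)) (x + 1) (hi + 1), hi) y"
      then obtain st f where sf: "st (x + 1) = s'" "\<not> st (hi + 2)"
        "\<And>z. z\<in>{x+1..hi+1} \<Longrightarrow> sw a (st z) (g z) (f z) (st (z + 1))"
        "Suc n \<le> m'" "(tst ^^ (m' - Suc n)) (Bk K, ov f (c(x := code v)) (x + 1) (hi + 1), hi) y"
        by blast
      have "ov f (c(x := code v)) (x + 1) (hi + 1) = ov (f(x := v)) c x (hi + 1)"
        using xle by (auto simp: ov_def)
      then have "(tst ^^ (m - Suc (Suc n))) (Bk K, ov (f(x := v)) c x (hi + 1), hi) y"
        using sf Suc by simp
      moreover have "\<forall>z\<in>{x..hi+1}. sw a ((st(x := s)) z) (g z) ((f(x := v)) z) ((st(x := s)) (z + 1))"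
        using sf v by auto
      moreover have "(st(x := s)) x = s" "\<not> (st(x := s)) (hi + 2)" "Suc (Suc n) \<le> m"
        using sf xle Suc by auto
      ultimately show ?thesis by blast
    qed
  qed (use Suc.prems in auto)
qed

lemma back_fwd:
  assumes "valid lo hi d" "K \<in> KK" "x + 1 = lo + int n" "x \<le> hi"
  shows "tst\<^sup>*\<^sup>* (Bk K, tape lo hi d, x) (Bk K, tape lo hi d, lo - 1)"
  using assms(3,4)
proof (induction n arbitrary: x)
  case (Suc n)
  then have "tape lo hi d x = code (cellof k d x)" by (auto simp: tape_def)
  then have "tst (Bk K, tape lo hi d, x) (Bk K, tape lo hi d, x - 1)"
    unfolding tst_def using assms(1,2) tr.intros(4)[of k p K "cellof k d x"]
    by (auto simp: valid_def intro!: exI[of _ "code (cellof k d x)"] exI[of _ "- 1 :: int"])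
  moreover have "tst\<^sup>*\<^sup>* (Bk K, tape lo hi d, x - 1) (Bk K, tape lo hi d, lo - 1)"
    by (rule Suc.IH) (use Suc.prems in auto)
  ultimately show ?case by (rule converse_rtranclp_into_rtranclp)
qed (simp add: eq_diff_eq[symmetric])

lemma back_bwd:
  assumes "x + 1 = lo + int n" "x \<le> hi" "(tst ^^ m) (Bk K, tape lo hi d, x) y"
  shows "(m \<le> n \<and> fst y \<noteq> Ac) \<or> (n \<le> m \<and> (tst ^^ (m - n)) (Bk K, tape lo hi d, lo - 1) y)"
  using assms
proof (induction n arbitrary: x m)
  case 0
  then have "x = lo - 1" by simp
  with 0 show ?case by simp
next
  case (Suc n)
  show ?case
  proof (cases m)
    case (Suc m')
    with Suc.prems(3) obtain w where w: "tst (Bk K, tape lo hi d, x) w" "(tst ^^ m') w y"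
      by (metis relpowp_Suc_D2)
    have c: "tape lo hi d x = code (cellof k d x)" using Suc.prems by (auto simp: tape_def)
    then have "w = (Bk K, tape lo hi d, x - 1)"
      using w(1) unfolding tst_def by (auto elim!: tr.cases)
    then show ?thesis using Suc.IH[of "x - 1" m'] Suc.prems(1,2) w(2) Suc by auto
  qed (use Suc in auto)
qed

section \<open>Simulation of whole runs\<close>

lemma KK_kstep: "K \<in> KK \<Longrightarrow> kstep K x K' \<Longrightarrow> K' \<in> KK"
  unfolding KK_def using conts_kstep[of K p "[]" x K'] by (auto elim: kstep.cases)

lemma KK_ops: "K \<in> KK \<Longrightarrow> kstep K (Some x) K' \<Longrightarrow> x \<in> ops p"
  unfolding KK_def using conts_ops[of K p "[]" x K'] by (auto elim: kstep.cases)

lemma ov_tape: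
  assumes "\<And>z. z \<in> {lo-1..hi+1} \<Longrightarrow> f z = cellof k d' z" "lo \<le> hi"
  shows "ov f ((tape lo hi d)(lo - 1 := code (f (lo - 1)))) lo (hi + 1) = tape (lo - 1) (hi + 1) d'"
  using assms by (auto simp: ov_def tape_def fun_eq_iff)

lemma main_fwd1:
  assumes "cstep (K, d) (K', d')" "valid lo hi d" "K \<in> KK"
  shows "\<exists>lo' hi'. valid lo' hi' d' \<and>
    tst\<^sup>*\<^sup>* (Bk K, tape lo hi d, lo - 1) (Bk K', tape lo' hi' d', lo' - 1)"
proof -
  have z: "tape lo hi d (lo - 1) = 0" by (simp add: tape_def)
  consider "kstep K None K'" "d' = d" | x where "kstep K (Some x) K'" "opsem x d d'"
    using assms(1) unfolding cstep_iff_kstep by blast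
  then show ?thesis
  proof cases
    case 1
    have "tst (Bk K, tape lo hi d, lo - 1) (Bk K', tape lo hi d, lo - 1)"
      unfolding tst_def using z tr.intros(6)[OF 1(1), of k p] KK_kstep[OF assms(3) 1(1)] assms(3)
      by (auto intro!: exI[of _ 0] simp: fun_eq_iff)
    then show ?thesis using assms(2) 1 by blast
  next
    case (2 x)
    have x: "x \<in> ops p" using KK_ops[OF assms(3) 2(1)] .
    have K': "K' \<in> KK" using KK_kstep[OF assms(3) 2(1)] .
    have v': "valid (lo - 1) (hi + 1) d'"
      using opsem_valid[OF 2(2) assms(2) k(2)[OF x] S(2)[OF x]] .
    have le: "lo \<le> hi" using assms(2) by (simp add: valid_def)
    have "\<exists>e. opsem x d e \<and> (\<forall>z\<in>{lo-1..hi+1}. cellof k d' z = cellof k e z)" using 2 by auto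
    then obtain st where st: "\<not> st (lo - 1)" "\<not> st (hi + 2)"
      "\<And>z. z\<in>{lo-1..hi+1} \<Longrightarrow> sw x (st z) (cellof k d z) (cellof k d' z) (st (z + 1))"
      using sweep_iff[OF assms(2) k(2)[OF x], of "cellof k d'"] by blast
    have bl: "cellof k d (lo - 1) = blank k" "cellof k d (hi + 1) = blank k"
      using assms(2) by (auto simp: valid_def)
    have C: "cellof k d z \<in> Cells" "cellof k d' z \<in> Cells" for z
      using assms(2) v' by (auto simp: valid_def)
    let ?c = "(tape lo hi d)(lo - 1 := code (cellof k d' (lo - 1)))"
    have "sw x False (blank k) (cellof k d' (lo - 1)) (st lo)"
      using st(1) st(3)[of "lo - 1"] bl le by auto
    from tr.intros(7)[OF 2(1) this, of p]
    have r1: "tst (Bk K, tape lo hi d, lo - 1) (Sw x K' (st lo), ?c, lo)"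
      unfolding tst_def using z assms(3) x K' C
      by (auto intro!: exI[of _ "code (cellof k d' (lo - 1))"] exI[of _ "1 :: int"])
    have r2: "tst\<^sup>*\<^sup>* (Sw x K' (st lo), ?c, lo) (Bk K', ov (cellof k d') ?c lo (hi + 1), hi)"
    proof (rule sweep_fwd[of lo "nat (hi + 1 - lo)" hi _ "cellof k d" x st])
      show "sw x (st z) (cellof k d z) (cellof k d' z) (st (z + 1))" if "z \<in> {lo..hi+1}" for z
        using st(3)[of z] that by simp
    qed (use le st bl C x K' in \<open>auto simp: tape_def\<close>)
    have r3: "ov (cellof k d') ?c lo (hi + 1) = tape (lo - 1) (hi + 1) d'"
      using le by (intro ov_tape) auto
    have r4: "tst\<^sup>*\<^sup>* (Bk K', tape (lo - 1) (hi + 1) d', hi) (Bk K', tape (lo - 1) (hi + 1) d', lo - 1 - 1)"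
      using le by (intro back_fwd[OF v' K', of _ "nat (hi + 2 - lo)"]) auto
    have "tst\<^sup>*\<^sup>* (Bk K, tape lo hi d, lo - 1) (Bk K', tape (lo - 1) (hi + 1) d', lo - 1 - 1)"
      by (rule converse_rtranclp_into_rtranclp[OF r1 rtranclp_trans[OF r2[unfolded r3] r4]])
    then show ?thesis using v' by blast
  qed
qed

lemma main_fwd:
  assumes "cstep\<^sup>*\<^sup>* (K, d) ([], e)" "valid lo hi d" "K \<in> KK"
  shows "\<exists>c x. tst\<^sup>*\<^sup>* (Bk K, tape lo hi d, lo - 1) (Ac, c, x)"
proof -
  have "\<lbrakk>cstep\<^sup>*\<^sup>* X Y; Y = ([], e); valid lo hi (snd X); fst X \<in> KK\<rbrakk> \<Longrightarrow>
     \<exists>c x. tst\<^sup>*\<^sup>* (Bk (fst X), tape lo hi (snd X), lo - 1) (Ac, c, x)" for X Y lo hi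
  proof (induction arbitrary: lo hi rule: converse_rtranclp_induct)
    case base
    have "tst (Bk [], tape lo hi e, lo - 1) (Ac, tape lo hi e, lo - 1)"
      unfolding tst_def using tr.intros(5)[of k p]
      by (auto intro!: exI[of _ 0] simp: fun_eq_iff tape_def KK_def)
    then show ?case using base by auto
  next
    case (step X Z)
    obtain K d K' d' where X: "X = (K, d)" "Z = (K', d')" by (cases X, cases Z)
    obtain lo' hi' where *: "valid lo' hi' d'"
      "tst\<^sup>*\<^sup>* (Bk K, tape lo hi d, lo - 1) (Bk K', tape lo' hi' d', lo' - 1)"
      using main_fwd1[of K d K' d' lo hi] step.hyps(1) step.prems X by auto
    have "K' \<in> KK" using step.hyps(1) step.prems X KK_kstep unfolding X cstep_iff_kstep by auto
    then obtain c x where "tst\<^sup>*\<^sup>* (Bk K', tape lo' hi' d', lo' - 1) (Ac, c, x)"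
      using step.IH[of lo' hi'] step.prems(1) * X by auto
    then show ?case using *(2) X by (auto intro: rtranclp_trans)
  qed
  from this[OF assms(1) refl] show ?thesis using assms by auto
qed

text \<open>The visited interval grows by two per step, whence the quadratic bound.\<close>

lemma main_bwd:
  assumes "bnd t (K, d)" "K \<in> KK" "valid lo hi d" "(tst ^^ m) (Bk K, tape lo hi d, lo - 1) y"
  shows "m \<le> (t + 1) * (2 * nat (hi - lo) + 4 * t + 10) \<and>
     (fst y = Ac \<longrightarrow> (\<exists>e. cstep\<^sup>*\<^sup>* (K, d) ([], e)))"
  using assms
proof (induction t arbitrary: K d lo hi m rule: less_induct)
  case (less t)
  let ?c = "tape lo hi d"
  let ?W = "nat (hi - lo)"
  have z: "?c (lo - 1) = 0" by (simp add: tape_def)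
  have le: "lo \<le> hi" using less.prems by (simp add: valid_def)
  show ?case
  proof (cases m)
    case 0
    then show ?thesis using less.prems by auto
  next
    case (Suc m')
    with less.prems(4) obtain w where w: "tst (Bk K, ?c, lo - 1) w" "(tst ^^ m') w y"
      by (metis relpowp_Suc_D2)
    then obtain s' b mv where tr: "tr k p (Bk K) 0 s' b mv" "w = (s', ?c(lo - 1 := b), lo - 1 + mv)"
      unfolding tst_def by (auto simp: z)
    from tr(1) show ?thesis
    proof (cases rule: tr.cases)
      case 5
      have "m' = 0"
        using w(2) unfolding tr(2) 5
        by (cases m') (auto dest!: relpowp_Suc_D2 simp: tst_def simp del: relpowp.simps)
      then show ?thesis using Suc 5 by auto
    next
      case (6 K')
      have c: "cstep (K, d) (K', d)" using 6 by (simp add: cstep_iff_kstep)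
      then obtain t' where t: "t = Suc t'" "bnd t' (K', d)" using bnd_step less.prems(1) by blast
      have "?c(lo - 1 := 0) = ?c" using z by auto
      then have "m' \<le> (t' + 1) * (2 * ?W + 4 * t' + 10) \<and>
          (fst y = Ac \<longrightarrow> (\<exists>e. cstep\<^sup>*\<^sup>* (K', d) ([], e)))"
        using less.IH[of t' K' d lo hi m'] t w(2) tr(2) 6 KK_kstep less.prems by auto
      moreover have "(t' + 1) * (2 * ?W + 4 * t' + 10) + 1 \<le> (t + 1) * (2 * ?W + 4 * t + 10)"
        unfolding t by (simp add: algebra_simps)
      ultimately show ?thesis using Suc c by (auto intro: converse_rtranclp_into_rtranclp)
    next
      case (7 x K' v s)
      have x: "x \<in> ops p" using KK_ops[OF less.prems(2) 7(4)] .
      have K': "K' \<in> KK" using KK_kstep[OF less.prems(2) 7(4)] .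
      have bl: "cellof k d (lo - 1) = blank k" "cellof k d (hi + 1) = blank k"
        using less.prems(3) by (auto simp: valid_def)
      let ?c1 = "?c(lo - 1 := code v)"
      have "(m' \<le> nat (hi + 1 - lo) \<and> fst y \<noteq> Ac) \<or>
        (\<exists>st f. st lo = s \<and> \<not> st (hi + 2) \<and>
          (\<forall>z\<in>{lo..hi+1}. sw x (st z) (cellof k d z) (f z) (st (z + 1))) \<and>
          Suc (nat (hi + 1 - lo)) \<le> m' \<and>
          (tst ^^ (m' - Suc (nat (hi + 1 - lo)))) (Bk K', ov f ?c1 lo (hi + 1), hi) y)"
        by (rule sweep_bwd) (use le bl w(2) tr(2) 7 in \<open>auto simp: tape_def\<close>)
      then show ?thesis
      proof (elim disjE exE conjE)
        assume "m' \<le> nat (hi + 1 - lo)" "fst y \<noteq> Ac"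
        then have "m \<le> 1 * (2 * ?W + 4 * t + 10)" using Suc le by simp
        also have "\<dots> \<le> (t + 1) * (2 * ?W + 4 * t + 10)" by (intro mult_le_mono) auto
        finally show ?thesis using \<open>fst y \<noteq> Ac\<close> by simp
      next
        fix st f
        assume st: "st lo = s" "\<not> st (hi + 2)"
          "\<forall>z\<in>{lo..hi+1}. sw x (st z) (cellof k d z) (f z) (st (z + 1))"
          and m': "Suc (nat (hi + 1 - lo)) \<le> m'"
          "(tst ^^ (m' - Suc (nat (hi + 1 - lo)))) (Bk K', ov f ?c1 lo (hi + 1), hi) y"
        let ?f = "f(lo - 1 := v)" and ?st = "st(lo - 1 := False)"
        have "\<not> ?st (lo - 1) \<and> \<not> ?st (hi + 2) \<and>
            (\<forall>z\<in>{lo-1..hi+1}. sw x (?st z) (cellof k d z) (?f z) (?st (z + 1)))"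
          using st 7 bl le by auto
        then obtain d' where d': "opsem x d d'" "\<And>z. z\<in>{lo-1..hi+1} \<Longrightarrow> ?f z = cellof k d' z"
          using sweep_iff[OF less.prems(3) k(2)[OF x], of ?f] by blast
        have v': "valid (lo - 1) (hi + 1) d'"
          using opsem_valid[OF d'(1) less.prems(3) k(2)[OF x] S(2)[OF x]] .
        have "ov f ?c1 lo (hi + 1) = ov ?f (?c(lo - 1 := code (?f (lo - 1)))) lo (hi + 1)"
          by (auto simp: ov_def)
        also have "\<dots> = tape (lo - 1) (hi + 1) d'" using d'(2) le by (rule ov_tape)
        finally have ov: "ov f ?c1 lo (hi + 1) = tape (lo - 1) (hi + 1) d'" .
        have c: "cstep (K, d) (K', d')" using 7 d' by (auto simp: cstep_iff_kstep)
        then obtain t' where t: "t = Suc t'" "bnd t' (K', d')" using bnd_step less.prems(1) by blast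
        define m2 where "m2 = m' - Suc (nat (hi + 1 - lo))"
        \<comment> \<open>Widening the interval by 2 adds 4 to \<open>2 * ?W\<close>, exactly what
          the decrease of \<open>t\<close> by one takes from \<open>4 * t\<close>. So the second
          factor stays the same and each step is charged one copy of it.\<close>
        have arith: "(t + 1) * (2 * ?W + 4 * t + 10) =
           (t' + 1) * (2 * nat ((hi + 1) - (lo - 1)) + 4 * t' + 10) + (2 * ?W + 4 * t + 10)"
        proof -
          have "nat ((hi + 1) - (lo - 1)) = ?W + 2" using le by simp
          then show ?thesis unfolding t by (simp add: algebra_simps)
        qed
        have "(m2 \<le> nat (hi + 2 - lo) \<and> fst y \<noteq> Ac) \<or> (nat (hi + 2 - lo) \<le> m2 \<and>
            (tst ^^ (m2 - nat (hi + 2 - lo))) (Bk K', tape (lo - 1) (hi + 1) d', lo - 1 - 1) y)"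
          by (rule back_bwd) (use le m'(2) ov m2_def in auto)
        then show ?thesis
        proof
          assume "m2 \<le> nat (hi + 2 - lo) \<and> fst y \<noteq> Ac"
          moreover have "nat (hi + 1 - lo) = ?W + 1" "nat (hi + 2 - lo) = ?W + 2" using le by auto
          ultimately have "m \<le> 2 * ?W + 4 * t + 10" using Suc m2_def m'(1) by linarith
          also have "\<dots> \<le> (t + 1) * (2 * ?W + 4 * t + 10)" unfolding arith by (rule le_add2)
          finally show ?thesis using \<open>_ \<and> fst y \<noteq> Ac\<close> by simp
        next
          assume *: "nat (hi + 2 - lo) \<le> m2 \<and>
            (tst ^^ (m2 - nat (hi + 2 - lo))) (Bk K', tape (lo - 1) (hi + 1) d', lo - 1 - 1) y"
          then have "m2 - nat (hi + 2 - lo) \<le> (t' + 1) * (2 * nat ((hi + 1) - (lo - 1)) + 4 * t' + 10) \<and>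
             (fst y = Ac \<longrightarrow> (\<exists>e. cstep\<^sup>*\<^sup>* (K', d') ([], e)))"
            by (intro less.IH) (use t K' v' in auto)
          moreover have "nat (hi + 1 - lo) = ?W + 1" "nat (hi + 2 - lo) = ?W + 2" using le by auto
          ultimately have "m \<le> (t + 1) * (2 * ?W + 4 * t + 10)"
            unfolding arith using Suc m2_def m'(1) * by linarith
          then show ?thesis using \<open>_ \<and> (fst y = Ac \<longrightarrow> _)\<close> c
            by (auto intro: converse_rtranclp_into_rtranclp)
        qed
      qed
    qed auto
  qed
qed

section \<open>Recoding the input\<close>

definition mid :: "bool list \<Rightarrow> int \<Rightarrow> int \<Rightarrow> nat" where
  "mid w x = (\<lambda>z. if 0 \<le> z \<and> z < x then code (cellof k (d0 w) z) else enc w z)"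

lemma enc_cases: "enc w z \<in> {0, 1, 2}"
  by (auto simp: enc_def)

lemma cellof_d0: "cellof k (d0 w) z = (enc w z, z = 0) # replicate (k - 1) (0, z = 0)"
  by (rule sym, subst cellof_eq_iff) (use k(1) in \<open>auto simp: d0_def nth_Cons split: nat.splits\<close>)

lemma valid_d0:
  assumes "0 \<le> h" "int (length w) \<le> h + 1"
  shows "valid 0 h (d0 w)"
  unfolding valid_iff using assms S(1) by (auto simp: enc_def d0_def)

lemma mid_upd: "0 \<le> x \<Longrightarrow> (mid w x)(x := code (cellof k (d0 w) x)) = mid w (x + 1)"
  by (auto simp: mid_def fun_eq_iff)

lemma mid_tape:
  assumes "1 \<le> x" "int (length w) \<le> x"
  shows "mid w x = tape 0 (x - 1) (d0 w)"
  using assms by (auto simp: mid_def tape_def fun_eq_iff enc_def)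

lemma d0_Cells [simp]: "cellof k (d0 w) z \<in> Cells"
  using valid_d0[of "int (length w)" w] by (auto simp: valid_def)

lemma KK_p [simp]: "[p] \<in> KK"
  by (simp add: KK_def conts_refl)

text \<open>The \<open>max 1\<close> reflects that \<open>I0\<close> recodes cell 0 even if the
  input is empty. The second claim includes runs that are cut off during the recoding; these have
  not accepted.\<close>

lemma I1_run:
  assumes "1 \<le> x" "x + int n = max 1 (int (length w))"
  shows "tst\<^sup>*\<^sup>* (I1, mid w x, x) (Bk [p], tape 0 (x + int n - 1) (d0 w), x + int n - 1)"
    and "(tst ^^ m) (I1, mid w x, x) y \<Longrightarrow> (m \<le> Suc n \<and> (m = Suc n \<longrightarrow> fst y \<noteq> Ac) \<and> fst y \<noteq> Ac) \<or>
      (Suc n \<le> m \<and> (tst ^^ (m - Suc n)) (Bk [p], tape 0 (x + int n - 1) (d0 w), x + int n - 1) y)"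
  using assms
proof (induction n arbitrary: x m)
  case 0
  {
    case 1
    then have c: "mid w x x = 0" by (auto simp: mid_def enc_def)
    have t: "mid w x = tape 0 (x - 1) (d0 w)" using 1 by (intro mid_tape) auto
    have "tst (I1, mid w x, x) (Bk [p], mid w x, x - 1)"
      unfolding tst_def using c tr.intros(3)[of k p]
      by (auto intro!: exI[of _ 0] exI[of _ "- 1 :: int"] simp: fun_eq_iff)
    then show ?case using t by auto
  next
    case 2
    then have c: "mid w x x = 0" by (auto simp: mid_def enc_def)
    have t: "mid w x = tape 0 (x - 1) (d0 w)" using 2 by (intro mid_tape) auto
    show ?case
    proof (cases m)
      case (Suc m')
      then obtain v where v: "tst (I1, mid w x, x) v" "(tst ^^ m') v y"
        using 2(1) by (metis relpowp_Suc_D2)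
      have "v = (Bk [p], mid w x, x - 1)"
      proof -
        obtain s' b mv where "tr k p I1 0 s' b mv" "v = (s', (mid w x)(x := b), x + mv)"
          using v(1) unfolding tst_def by (auto simp: c)
        then show ?thesis
          using fun_upd_idem[of "mid w x" x 0, OF c] by (cases rule: tr.cases) simp_all
      qed
      then show ?thesis using v(2) Suc t by auto
    qed (use 2 in auto)
  }
next
  case (Suc n)
  {
    case 1
    then have "x < int (length w)" by (auto simp: max_def split: if_splits)
    then have e: "mid w x x \<in> {1, 2}" "mid w x x = enc w x" using 1 by (auto simp: mid_def enc_def)
    have "tst (I1, mid w x, x) (I1, mid w (x + 1), x + 1)"
      unfolding tst_def using e 1 tr.intros(2)[of "enc w x" k p] mid_upd[of x w]
      using d0_Cells[of w x]
      by (auto intro!: exI[of _ "code (cellof k (d0 w) x)"] exI[of _ "1 :: int"] simp: cellof_d0)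
    moreover have "tst\<^sup>*\<^sup>* (I1, mid w (x + 1), x + 1)
        (Bk [p], tape 0 (x + 1 + int n - 1) (d0 w), x + 1 + int n - 1)"
      by (rule Suc.IH(1)) (use 1 in auto)
    ultimately show ?case by (auto intro: converse_rtranclp_into_rtranclp simp: algebra_simps)
  next
    case 2
    then have "x < int (length w)" by (auto simp: max_def split: if_splits)
    then have e: "mid w x x \<in> {1, 2}" "mid w x x = enc w x" using 2 by (auto simp: mid_def enc_def)
    show ?case
    proof (cases m)
      case (Suc m')
      then obtain v where v: "tst (I1, mid w x, x) v" "(tst ^^ m') v y"
        using 2(1) by (metis relpowp_Suc_D2)
      have "v = (I1, (mid w x)(x := code (cellof k (d0 w) x)), x + 1)"
        using v(1) e 2 unfolding tst_def by (auto elim!: tr.cases simp: cellof_d0)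
      then have "v = (I1, mid w (x + 1), x + 1)" using mid_upd 2 by simp
      then show ?thesis using Suc.IH(2)[of m' "x + 1"] v(2) Suc 2 by (auto simp: algebra_simps)
    qed (use 2 in auto)
  }
qed

lemma init_conc: "init M w = conc (I0, mid w 0, 0)"
  by (auto simp: init_def conc_def mid_def enc_def M_def)

lemma I0_step:
  "tst (I0, mid w 0, 0) v \<longleftrightarrow> v = (I1, mid w 1, 1)"
proof -
  have e: "mid w 0 0 \<in> {0, 1, 2}" "mid w 0 0 = enc w 0" using enc_cases by (auto simp: mid_def)
  have u: "(mid w 0)(0 := code (cellof k (d0 w) 0)) = mid w 1" using mid_upd[of 0 w] by simp
  have "tr k p I0 (enc w 0) I1 (code (cellof k (d0 w) 0)) 1"
    unfolding cellof_d0 using tr.intros(1)[OF enc_cases, of k p w 0] by simp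
  then have "tst (I0, mid w 0, 0) (I1, mid w 1, 1)"
    unfolding tst_def using e u
    by (auto intro!: exI[of _ "code (cellof k (d0 w) 0)"] exI[of _ "1 :: int"])
  moreover have "v = (I1, mid w 1, 1)" if "tst (I0, mid w 0, 0) v"
    using that e(2) u[symmetric] unfolding tst_def by (auto elim!: tr.cases simp: cellof_d0)
  ultimately show ?thesis by blast
qed

lemma accepts_iff:
  "(\<exists>n c. (step M ^^ n) (init M w) c \<and> cstate c = acc M) \<longleftrightarrow>
   (\<exists>c x. tst\<^sup>*\<^sup>* (I0, mid w 0, 0) (Ac, c, x))"
  unfolding init_conc steps_conc rtranclp_power
  by (force simp: conc_def M_def)

text \<open>The term \<open>2 * n + 10\<close> pays for recoding the input and going back to its
  left end. The product is the bound of \<open>main_bwd\<close> for an initial interval of width at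
  most \<open>n\<close>.\<close>

lemma M_decides:
  assumes T: "\<And>w. bnd (T (length w)) ([p], d0 w)"
  shows "decides_in (step M) M {w. \<exists>e. (d0 w, e) \<in> sem p}
     (\<lambda>n. 2 * n + 10 + (T n + 1) * (2 * n + 4 * T n + 10))"
proof -
  {
    fix w :: "bool list" and m y
    let ?l = "length w" and ?h = "max 1 (int (length w)) - 1"
    let ?B = "\<lambda>n. 2 * n + 10 + (T n + 1) * (2 * n + 4 * T n + 10)"
    assume run: "(tst ^^ m) (I0, mid w 0, 0) y"
    have v: "valid 0 ?h (d0 w)" by (rule valid_d0) auto
    define n where "n = nat ?h"
    have n: "1 + int n = max 1 (int ?l)" "n \<le> ?l" by (auto simp: n_def)
    have "m \<le> ?B ?l \<and> (fst y = Ac \<longrightarrow> (\<exists>e. (d0 w, e) \<in> sem p))"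
    proof (cases m)
      case 0
      then show ?thesis using run by auto
    next
      case (Suc m1)
      then have r1: "(tst ^^ m1) (I1, mid w 1, 1) y"
        using run I0_step by (metis relpowp_Suc_D2)
      from I1_run(2)[OF order.refl n(1) r1] show ?thesis
      proof
        assume "m1 \<le> Suc n \<and> (m1 = Suc n \<longrightarrow> fst y \<noteq> Ac) \<and> fst y \<noteq> Ac"
        then show ?thesis using Suc n by auto
      next
        assume *: "Suc n \<le> m1 \<and> (tst ^^ (m1 - Suc n)) (Bk [p], tape 0 (1 + int n - 1) (d0 w), 1 + int n - 1) y"
        define m2 where "m2 = m1 - Suc n"
        have "(m2 \<le> Suc n \<and> fst y \<noteq> Ac) \<or>
            (Suc n \<le> m2 \<and> (tst ^^ (m2 - Suc n)) (Bk [p], tape 0 ?h (d0 w), 0 - 1) y)"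
          by (rule back_bwd[of ?h 0]) (use * m2_def n in auto)
        then show ?thesis
        proof
          assume "m2 \<le> Suc n \<and> fst y \<noteq> Ac"
          then show ?thesis using Suc n m2_def * by auto
        next
          assume **: "Suc n \<le> m2 \<and> (tst ^^ (m2 - Suc n)) (Bk [p], tape 0 ?h (d0 w), 0 - 1) y"
          have b: "m2 - Suc n \<le> (T ?l + 1) * (2 * nat (?h - 0) + 4 * T ?l + 10) \<and>
            (fst y = Ac \<longrightarrow> (\<exists>e. cstep\<^sup>*\<^sup>* ([p], d0 w) ([], e)))"
            by (rule main_bwd[OF T _ v]) (use ** in auto)
          have "(T ?l + 1) * (2 * nat (?h - 0) + 4 * T ?l + 10) \<le> (T ?l + 1) * (2 * ?l + 4 * T ?l + 10)"
            by (intro mult_le_mono) auto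
          then have "m \<le> ?B ?l" using b n Suc m2_def * ** by linarith
          then show ?thesis using b csteps_iff_seml[of "[p]"] by auto
        qed
      qed
    qed
  }
  note bound = this
  have "(\<exists>c x. tst\<^sup>*\<^sup>* (I0, mid w 0, 0) (Ac, c, x)) \<longleftrightarrow> (\<exists>e. (d0 w, e) \<in> sem p)" (is "?L \<longleftrightarrow> ?R") for w
  proof
    assume ?L
    then obtain n c x where "(tst ^^ n) (I0, mid w 0, 0) (Ac, c, x)" unfolding rtranclp_power by blast
    from bound[OF this] show ?R by simp
  next
    assume ?R
    then obtain e where "cstep\<^sup>*\<^sup>* ([p], d0 w) ([], e)" using csteps_iff_seml[of "[p]"] by auto
    define h where "h = max 1 (int (length w)) - 1"
    have v: "valid 0 h (d0 w)" unfolding h_def by (rule valid_d0) auto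
    define n where "n = nat h"
    have n: "1 + int n = max 1 (int (length w))" "1 + int n - 1 = h" by (auto simp: n_def h_def)
    have r1: "tst\<^sup>*\<^sup>* (I1, mid w 1, 1) (Bk [p], tape 0 h (d0 w), h)"
      using I1_run(1)[OF _ n(1)] n(2) by simp
    have r2: "tst\<^sup>*\<^sup>* (Bk [p], tape 0 h (d0 w), h) (Bk [p], tape 0 h (d0 w), 0 - 1)"
      by (rule back_fwd[OF v, of _ _ "Suc n"]) (use n in auto)
    obtain c x where r3: "tst\<^sup>*\<^sup>* (Bk [p], tape 0 h (d0 w), 0 - 1) (Ac, c, x)"
      using main_fwd[OF \<open>cstep\<^sup>*\<^sup>* ([p], d0 w) ([], e)\<close> v] by auto
    have "tst (I0, mid w 0, 0) (I1, mid w 1, 1)" using I0_step by simp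
    then have "tst\<^sup>*\<^sup>* (I0, mid w 0, 0) (Ac, c, x)"
      using rtranclp_trans[OF r1 rtranclp_trans[OF r2 r3]] by (rule converse_rtranclp_into_rtranclp)
    then show ?L by blast
  qed
  then show ?thesis
    unfolding decides_in_def accepts_iff
    using bound unfolding init_conc steps_conc by fast
qed

end

section \<open>Polynomial and exponential bounds\<close>

definition polyb :: "(nat \<Rightarrow> nat) \<Rightarrow> bool" where
  "polyb f \<longleftrightarrow> (\<exists>k. \<forall>n. f n \<le> n ^ k + k)"

definition expb :: "(nat \<Rightarrow> nat) \<Rightarrow> bool" where
  "expb f \<longleftrightarrow> (\<exists>k. \<forall>n. f n \<le> 2 ^ (n ^ k + k))"

lemma pk_mono: "k \<le> k' \<Longrightarrow> (n::nat) ^ k + k \<le> n ^ k' + k'"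
proof -
  assume le: "k \<le> k'"
  consider "n = 0" | "n \<ge> 1" by linarith
  then show ?thesis
  proof cases
    case 1
    then show ?thesis using le by (cases k; cases k') auto
  next
    case 2
    then show ?thesis using le by (intro add_mono power_increasing) auto
  qed
qed

lemma polyb_obtain2:
  assumes "polyb f" "polyb g"
  obtains k where "\<And>n. f n \<le> n ^ k + k" "\<And>n. g n \<le> n ^ k + k"
proof -
  obtain a b where "\<And>n. f n \<le> n ^ a + a" "\<And>n. g n \<le> n ^ b + b"
    using assms by (auto simp: polyb_def)
  then show thesis
    using that[of "max a b"] pk_mono[of a "max a b"] pk_mono[of b "max a b"]
    by (meson le_trans max.cobounded1 max.cobounded2)
qed

lemma polyb_le: "polyb g \<Longrightarrow> (\<And>n. f n \<le> g n) \<Longrightarrow> polyb f"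
  unfolding polyb_def by (meson le_trans)

lemma polyb_const [simp]: "polyb (\<lambda>_. c)"
  unfolding polyb_def by (rule exI[of _ c]) auto

lemma polyb_id [simp]: "polyb (\<lambda>n. n)"
  unfolding polyb_def by (rule exI[of _ 1]) auto

text \<open>For \<open>n \<ge> 2\<close> the constant is absorbed by
  \<open>k < 2 ^ k \<le> n ^ k\<close>, and the exponent \<open>2 * k + 2\<close> would do. For
  \<open>n \<le> 1\<close> powers do not grow, so the additive part has to dominate the square of
  \<open>k + 1\<close>; the exponent is chosen large enough for both.\<close>

lemma sq_poly: "(n ^ k + k) * (n ^ k + k) \<le> n ^ (3 * k * k + 3 * k + 2) + (3 * k * k + 3 * k + 2)" (is "_ \<le> n ^ ?e + ?e")
  for n k :: nat
proof -
  consider "n = 0" | "n = 1" | "n \<ge> 2" by linarith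
  then show ?thesis
  proof cases
    case 1
    have "(0 ^ k + k) * (0 ^ k + k) \<le> (1 + k) * (1 + k)" by (intro mult_le_mono) (auto simp: power_0_left)
    also have "\<dots> \<le> ?e" by (simp add: algebra_simps)
    finally show ?thesis using 1 by simp
  next
    case 2
    then show ?thesis by (simp add: algebra_simps)
  next
    case 3
    have k: "k < 2 ^ k" by (rule less_exp)
    also have "(2::nat) ^ k \<le> n ^ k" using 3 by (intro power_mono) auto
    finally have "n ^ k + k \<le> 2 * n ^ k" by simp
    also have "\<dots> \<le> n * n ^ k" using 3 by simp
    finally have "(n ^ k + k) * (n ^ k + k) \<le> n ^ Suc k * n ^ Suc k" by (intro mult_le_mono) auto
    also have "\<dots> = n ^ (2 * k + 2)" by (simp flip: power_add add: mult_2)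
    also have "\<dots> \<le> n ^ ?e" using 3 by (intro power_increasing) auto
    finally show ?thesis by simp
  qed
qed

lemma polyb_mult [intro]:
  assumes "polyb f" "polyb g"
  shows "polyb (\<lambda>n. f n * g n)"
proof -
  obtain k where "\<And>n. f n \<le> n ^ k + k" "\<And>n. g n \<le> n ^ k + k"
    using polyb_obtain2[OF assms] by blast
  then have "f n * g n \<le> (n ^ k + k) * (n ^ k + k)" for n by (intro mult_le_mono)
  then show ?thesis using sq_poly le_trans unfolding polyb_def by blast
qed

lemma polyb_add [intro]:
  assumes "polyb f" "polyb g"
  shows "polyb (\<lambda>n. f n + g n)"
proof -
  obtain k where "\<And>n. f n \<le> n ^ k + k" "\<And>n. g n \<le> n ^ k + k"
    using polyb_obtain2[OF assms] by blast
  then have le: "f n + g n \<le> 2 * (n ^ k + k)" for n by (metis add_mono mult_2)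
  have "polyb (\<lambda>n. n ^ k + k)" unfolding polyb_def by auto
  then show ?thesis by (rule polyb_le[OF polyb_mult[OF polyb_const] le])
qed

lemma polyb_power [intro]: "polyb f \<Longrightarrow> polyb (\<lambda>n. f n ^ k)"
  by (induction k) auto

lemma expb_exp [intro]: "polyb f \<Longrightarrow> expb (\<lambda>n. 2 ^ f n)"
  unfolding polyb_def expb_def by (metis one_le_numeral power_increasing)

lemma expb_le: "expb g \<Longrightarrow> (\<And>n. f n \<le> g n) \<Longrightarrow> expb f"
  unfolding expb_def by (meson le_trans)

lemma expb_poly [intro]: "polyb f \<Longrightarrow> expb f"
  by (rule expb_le[OF expb_exp]) (auto intro: less_imp_le less_exp)

lemma expb_obtain:
  assumes "expb f" obtains h where "polyb h" "\<And>n. f n \<le> 2 ^ h n"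
proof -
  obtain k where "\<And>n. f n \<le> 2 ^ (n ^ k + k)" using assms by (auto simp: expb_def)
  moreover have "polyb (\<lambda>n. n ^ k + k)" unfolding polyb_def by auto
  ultimately show thesis using that by blast
qed

lemma expb_mult [intro]:
  assumes "expb f" "expb g"
  shows "expb (\<lambda>n. f n * g n)"
proof -
  obtain h h' where h: "polyb h" "\<And>n. f n \<le> 2 ^ h n" "polyb h'" "\<And>n. g n \<le> 2 ^ h' n"
    using expb_obtain[OF assms(1)] expb_obtain[OF assms(2)] by metis
  then have le: "f n * g n \<le> 2 ^ (h n + h' n)" for n by (simp add: power_add mult_le_mono)
  show ?thesis by (rule expb_le[OF expb_exp[OF polyb_add[OF h(1,3)]] le])
qed

lemma expb_add [intro]:
  assumes "expb f" "expb g"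
  shows "expb (\<lambda>n. f n + g n)"
proof (rule expb_le)
  \<comment> \<open>This product dominates the sum, and for products exponents simply add
    up.\<close>
  show "expb (\<lambda>n. (f n + 1) * (g n + 1))"
  proof -
    have "expb (\<lambda>n. h n + 1)" if e: "expb h" for h
    proof -
      obtain l where l: "polyb l" "\<And>n. h n \<le> 2 ^ l n" using expb_obtain[OF e] by blast
      have le: "h n + 1 \<le> 2 ^ l n * 2" for n using l(2)[of n] one_le_power[of "2::nat" "l n"] by linarith
      show ?thesis by (rule expb_le[OF expb_mult[OF expb_exp[OF l(1)] expb_poly[OF polyb_const[of 2]]] le])
    qed
    then show ?thesis using assms by (intro expb_mult)
  qed
qed simp

lemma expb_comp:
  assumes "expb T" "polyb f"
  shows "expb (\<lambda>n. T (f n))"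
proof -
  obtain k where "\<And>n. T n \<le> 2 ^ (n ^ k + k)" using assms(1) by (auto simp: expb_def)
  moreover have "expb (\<lambda>n. 2 ^ (f n ^ k + k))"
    using assms(2) by (intro expb_exp polyb_add polyb_power polyb_const)
  ultimately show ?thesis by (rule expb_le[rotated])
qed

lemma polyb_pk [simp]: "polyb (\<lambda>n. n ^ k + k)"
  unfolding polyb_def by auto

text \<open>The passage from programs to \<open>NEXP\<close>. Tracks and alphabet are read off the
  finitely many operations of \<open>p\<close>; the compilation costs about a square, which an
  exponential bound absorbs.\<close>

lemma NEXP_prog:
  assumes T: "\<And>w. tb p (d0 w) (T (length w))" and "expb T"
  shows "{w. \<exists>e. (d0 w, e) \<in> sem p} \<in> NEXP"
proof -
  define k where "k = Suc (Max (insert 0 (\<Union>x\<in>ops p. tapes x)))"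
  define S where "S = Max (insert 2 (symb ` ops p))"
  have ft: "finite (\<Union>x\<in>ops p. tapes x)"
  proof -
    have "finite (tapes x)" for x by (cases x) auto
    then show ?thesis using finite_ops by blast
  qed
  interpret comp p k S
  proof
    show "0 < k" by (simp add: k_def)
    show "tapes x \<subseteq> {..<k}" if "x \<in> ops p" for x
    proof
      fix i assume "i \<in> tapes x"
      then have "i \<le> Max (insert 0 (\<Union>x\<in>ops p. tapes x))" using that ft by (intro Max_ge) auto
      then show "i \<in> {..<k}" by (simp add: k_def)
    qed
    show "2 \<le> S" "\<And>x. x \<in> ops p \<Longrightarrow> symb x \<le> S"
      unfolding S_def using finite_ops by (auto intro!: Max_ge)
  qed
  have "expb (\<lambda>n. 2 * n + 10 + (T n + 1) * (2 * n + 4 * T n + 10))"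
    using \<open>expb T\<close> by (intro expb_add expb_mult expb_poly[OF polyb_const] expb_poly[OF polyb_id])
  then obtain K where K: "\<And>n. 2 * n + 10 + (T n + 1) * (2 * n + 4 * T n + 10) \<le> 2 ^ (n ^ K + K)"
    by (auto simp: expb_def)
  have "decides_in (step M) M {w. \<exists>e. (d0 w, e) \<in> sem p}
     (\<lambda>n. 2 * n + 10 + (T n + 1) * (2 * n + 4 * T n + 10))"
    by (rule M_decides) (use T in \<open>simp add: tb_def\<close>)
  then have "decides_in (step M) M {w. \<exists>e. (d0 w, e) \<in> sem p} (\<lambda>n. 2 ^ (n ^ K + K))"
    unfolding decides_in_def using K by (meson le_trans)
  then show ?thesis unfolding NEXP_def using wf_M by blast
qed

section \<open>Deciders as subroutines\<close>

type_synonym trans = "nat \<times> nat \<times> nat \<times> nat \<times> nat \<times> nat \<times> int \<times> int"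

fun dirs :: "trans \<Rightarrow> bool" where
  "dirs (q, a, b, q', a', b', m1, m2) \<longleftrightarrow> m1 \<in> {-1, 0, 1} \<and> m2 \<in> {-1, 0, 1}"

fun applies :: "trans \<Rightarrow> conf \<Rightarrow> bool" where
  "applies (q, a, b, q', a', b', m1, m2) c \<longleftrightarrow>
     cstate c = q \<and> tp1 c (hd1 c) = a \<and> tp2 c (hd2 c) = b"

fun app :: "trans \<Rightarrow> conf \<Rightarrow> conf" where
  "app (q, a, b, q', a', b', m1, m2) c =
     \<lparr>cstate = q', tp1 = (tp1 c)(hd1 c := a'), hd1 = hd1 c + m1,
      tp2 = (tp2 c)(hd2 c := b'), hd2 = hd2 c + m2, nq = nq c\<rparr>"

lemma step_iff: "step M c c' \<longleftrightarrow> (\<exists>\<tau>\<in>delta M. applies \<tau> c \<and> c' = app \<tau> c)"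
proof
  assume "step M c c'"
  then obtain q' a' b' m1 m2 where
    "(cstate c, tp1 c (hd1 c), tp2 c (hd2 c), q', a', b', m1, m2) \<in> delta M"
    "c' = app (cstate c, tp1 c (hd1 c), tp2 c (hd2 c), q', a', b', m1, m2) c"
    unfolding step_def by auto
  moreover have "applies (cstate c, tp1 c (hd1 c), tp2 c (hd2 c), q', a', b', m1, m2) c" by simp
  ultimately show "\<exists>\<tau>\<in>delta M. applies \<tau> c \<and> c' = app \<tau> c" by blast
next
  assume "\<exists>\<tau>\<in>delta M. applies \<tau> c \<and> c' = app \<tau> c"
  then obtain \<tau> where t: "\<tau> \<in> delta M" "applies \<tau> c" "c' = app \<tau> c" by blast
  then show "step M c c'" by (cases \<tau> rule: dirs.cases) (auto simp: step_def)
qed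

lemma nq_app [simp]: "nq (app \<tau> c) = nq c"
  by (cases \<tau> rule: dirs.cases) simp

text \<open>Tapes 2 and 3 hold the tapes of the simulated machine; the cells under the heads of tapes 4 and 7
hold its state and its query counter. Tape 0 keeps the input, and tape 1 stays blank with its head at
0 (\<open>home\<close> below), so that copying from it resets a tape. Tape 5 stores a path or scratch data, tape 6
a query, and tapes from 8 on are loop counters.\<close>

definition conf_of :: "data \<Rightarrow> conf" where
  "conf_of d = \<lparr>cstate = rd d 4, tp1 = fst (d 2), hd1 = snd (d 2), tp2 = fst (d 3), hd2 = snd (d 3),
     nq = rd d 7\<rparr>"

definition put :: "conf \<Rightarrow> data \<Rightarrow> data" where
  "put c d = (wr (wr d 4 (cstate c)) 7 (nq c))(2 := (tp1 c, hd1 c), 3 := (tp2 c, hd2 c))"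

lemma conf_of_put [simp]: "conf_of (put c d) = c"
  by (simp add: conf_of_def put_def rd_def wr_def)

lemma put_put [simp]: "put c (put c' d) = put c d"
  by (auto simp: put_def wr_def fun_eq_iff)

lemma put_conf_of [simp]: "put (conf_of d) d = d"
  by (auto simp: put_def wr_def fun_eq_iff conf_of_def rd_def)

lemma put_other [simp]: "i \<notin> {2, 3, 4, 7} \<Longrightarrow> put c d i = d i"
  by (auto simp: put_def wr_def)

definition mvp :: "nat \<Rightarrow> int \<Rightarrow> prog" where
  "mvp i m = (if m = 1 then Op (Mr i) else if m = -1 then Op (Ml i) else Skip)"

lemma sem_mvp: "m \<in> {-1, 0, 1} \<Longrightarrow> (d, e) \<in> sem (mvp i m) \<longleftrightarrow> e = d(i := (fst (d i), snd (d i) + m))"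
  by (auto simp: mvp_def)

fun stepP :: "trans \<Rightarrow> prog" where
  "stepP (q, a, b, q', a', b', m1, m2) =
     seqs [Op (Wr 4 q q'), Op (Wr 2 a a'), mvp 2 m1, Op (Wr 3 b b'), mvp 3 m2]"

lemma sem_stepP:
  assumes "dirs \<tau>"
  shows "(d, e) \<in> sem (stepP \<tau>) \<longleftrightarrow> applies \<tau> (conf_of d) \<and> e = put (app \<tau> (conf_of d)) d"
proof -
  obtain q a b q' a' b' m1 m2 where t: "\<tau> = (q, a, b, q', a', b', m1, m2)" by (cases \<tau> rule: dirs.cases) auto
  then have m: "m1 \<in> {-1, 0, 1}" "m2 \<in> {-1, 0, 1}" using assms by auto
  let ?d1 = "(wr (wr d 4 q') 2 a')"
  let ?d2 = "?d1(2 := (fst (?d1 2), snd (?d1 2) + m1))"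
  let ?d3 = "wr ?d2 3 b'"
  let ?d4 = "?d3(3 := (fst (?d3 3), snd (?d3 3) + m2))"
  have "rd (wr d 4 q') 2 = rd d 2" "rd ?d2 3 = rd d 3" by (simp_all add: rd_def wr_def)
  then have "(d, e) \<in> sem (stepP \<tau>) \<longleftrightarrow> rd d 4 = q \<and> rd d 2 = a \<and> rd d 3 = b \<and> e = ?d4"
    unfolding t stepP.simps sem_seqs_Cons sem_mvp[OF m(1)] sem_mvp[OF m(2)] by auto
  moreover have "applies \<tau> (conf_of d) \<longleftrightarrow> rd d 4 = q \<and> rd d 2 = a \<and> rd d 3 = b"
    by (simp add: t conf_of_def rd_def)
  moreover have "?d4 = put (app \<tau> (conf_of d)) d"
    by (rule ext) (simp add: t conf_of_def put_def wr_def rd_def)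
  ultimately show ?thesis by auto
qed

text \<open>The tests of \<open>stepP\<close> negated, so that a step that does not apply can be
  recognised instead of killing the run.\<close>

fun misP :: "trans \<Rightarrow> prog" where
  "misP (q, a, b, q', a', b', m1, m2) = chos [Op (Ne 4 q), Op (Ne 2 a), Op (Ne 3 b)]"

lemma sem_misP: "(d, e) \<in> sem (misP \<tau>) \<longleftrightarrow> \<not> applies \<tau> (conf_of d) \<and> e = d"
  by (cases \<tau> rule: dirs.cases) (auto simp: conf_of_def rd_def)

lemma loopfree_stepP [simp]: "loopfree (stepP \<tau>)" "loopfree (misP \<tau>)"
  by (cases \<tau> rule: dirs.cases; simp add: mvp_def)+

text \<open>An arbitrary but fixed order, so that a path can name a transition by its place.\<close>

definition trs :: "ntm \<Rightarrow> trans list" where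
  "trs M = (SOME xs. set xs = delta M)"

lemma set_trs: "wf_ntm M \<Longrightarrow> set (trs M) = delta M"
  unfolding trs_def by (rule someI_ex) (simp add: wf_ntm_def finite_list)

lemma wf_dirs: "wf_ntm M \<Longrightarrow> \<tau> \<in> delta M \<Longrightarrow> dirs \<tau>"
  unfolding wf_ntm_def by (cases \<tau> rule: dirs.cases) fastforce

definition oneP :: "ntm \<Rightarrow> prog" where
  "oneP M = chos (map stepP (trs M))"

lemma sem_oneP:
  assumes "wf_ntm M"
  shows "(d, e) \<in> sem (oneP M) \<longleftrightarrow> (\<exists>c. step M (conf_of d) c \<and> e = put c d)"
  using assms wf_dirs sem_stepP unfolding oneP_def by (auto simp: set_trs step_iff)

lemma sem_Star_oneP:
  assumes "wf_ntm M"
  shows "(d, e) \<in> sem (Star (oneP M)) \<longleftrightarrow> (\<exists>c. (step M)\<^sup>*\<^sup>* (conf_of d) c \<and> e = put c d)"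
proof
  assume "(d, e) \<in> sem (Star (oneP M))"
  then have "(d, e) \<in> (sem (oneP M))\<^sup>*" by simp
  then show "\<exists>c. (step M)\<^sup>*\<^sup>* (conf_of d) c \<and> e = put c d"
  proof induction
    case base
    have "(step M)\<^sup>*\<^sup>* (conf_of d) (conf_of d) \<and> d = put (conf_of d) d" by simp
    then show ?case by blast
  next
    case (step f e)
    then obtain c c' where "(step M)\<^sup>*\<^sup>* (conf_of d) c" "f = put c d" "step M c c'" "e = put c' d"
      by (auto simp: sem_oneP[OF assms])
    then show ?case using rtranclp.rtrancl_into_rtrancl by metis
  qed
next
  assume "\<exists>c. (step M)\<^sup>*\<^sup>* (conf_of d) c \<and> e = put c d"
  then obtain c where c: "(step M)\<^sup>*\<^sup>* (conf_of d) c" "e = put c d" by blast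
  from c(1) have "(d, put c d) \<in> (sem (oneP M))\<^sup>*"
  proof induction
    case (step f c)
    then have "(put f d, put c d) \<in> sem (oneP M)" by (auto simp: sem_oneP[OF assms])
    then show ?case using step.IH by (simp add: rtrancl.rtrancl_into_rtrancl)
  qed simp
  then show "(d, e) \<in> sem (Star (oneP M))" using c by simp
qed

definition loadP :: "ntm \<Rightarrow> nat \<Rightarrow> prog" where
  "loadP M src = seqs [Op (Cp 2 src 1), Op (Cp 3 1 1), Op (Cp 4 1 1), Op (Cp 7 1 1), Op (Wr 4 0 (start M))]"

definition runP :: "ntm \<Rightarrow> nat \<Rightarrow> prog" where
  "runP M src = seqs [loadP M src, Star (oneP M), Op (Wr 4 (acc M) (acc M))]"

lemma init_enc: "init M w =
  \<lparr>cstate = start M, tp1 = enc w, hd1 = 0, tp2 = (\<lambda>_. 0), hd2 = 0, nq = 0\<rparr>"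
  by (simp add: init_def enc_def)

definition agree :: "nat set \<Rightarrow> data \<Rightarrow> data \<Rightarrow> bool" where
  "agree X d e \<longleftrightarrow> (\<forall>i. i \<notin> X \<longrightarrow> e i = d i)"

definition home :: "data \<Rightarrow> bool" where
  "home d \<longleftrightarrow> d 1 = ((\<lambda>_. 0), 0)"

lemma sem_loadP:
  assumes "home d" "fst (d src) = enc q" "src \<noteq> 1"
  obtains f where "conf_of f = init M q" "agree {2, 3, 4, 7} d f" "\<And>e. (d, e) \<in> sem (loadP M src) \<longleftrightarrow> e = f"
proof
  let ?f = "wr (d(2 := (enc q, 0), 3 := ((\<lambda>_. 0), 0), 4 := ((\<lambda>_. 0), 0), 7 := ((\<lambda>_. 0), 0))) 4 (start M)"
  show "conf_of ?f = init M q"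
    by (simp add: conf_of_def init_enc rd_def wr_def)
  show "agree {2, 3, 4, 7} d ?f"
    by (simp add: agree_def wr_def)
  show "(d, e) \<in> sem (loadP M src) \<longleftrightarrow> e = ?f" for e
    unfolding loadP_def sem_seqs_Cons using assms by (auto simp: home_def rd_def)
qed

lemma loopfree_loadP [simp]: "loopfree (loadP M src)" and cost_loadP [simp]: "cost (loadP M src) = 11"
  by (simp_all add: loadP_def)

lemma runP_sem:
  assumes "home d" "fst (d src) = enc q" "src \<noteq> 1" "wf_ntm M" "decides_in (step M) M A t"
  shows "(\<exists>e. (d, e) \<in> sem (runP M src)) \<longleftrightarrow> q \<in> A"
    and "(d, e) \<in> sem (runP M src) \<Longrightarrow> agree {2, 3, 4, 7} d e"
proof -
  obtain f where f: "conf_of f = init M q" "agree {2, 3, 4, 7} d f" "\<And>e. (d, e) \<in> sem (loadP M src) \<longleftrightarrow> e = f"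
    by (rule sem_loadP[OF assms(1-3)]) (rule that)
  have *: "(d, e) \<in> sem (runP M src) \<longleftrightarrow> (\<exists>c. (step M)\<^sup>*\<^sup>* (init M q) c \<and> cstate c = acc M \<and> e = put c f)" for e
  proof -
    have id: "wr (put c f) 4 (acc M) = put c f" if "cstate c = acc M" for c
      using that by (auto simp: wr_def put_def fun_eq_iff)
    have r: "rd (put c f) 4 = cstate c" for c by (simp add: rd_def put_def wr_def)
    show ?thesis
      unfolding runP_def sem_seqs_Cons sem_Star_oneP[OF assms(4)] f(3) by (auto simp: f(1) r id)
  qed
  show "(\<exists>e. (d, e) \<in> sem (runP M src)) \<longleftrightarrow> q \<in> A"
    using assms(5) unfolding * decides_in_def rtranclp_power by blast
  show "agree {2, 3, 4, 7} d e" if "(d, e) \<in> sem (runP M src)"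
    using that f(2) unfolding * agree_def by auto
qed

text \<open>The variant of the loop is a bound on the length of all machine runs from the current
  configuration. \<open>decides_in\<close> provides it at the start, and every round uses up one
  step.\<close>

lemma runP_tb:
  assumes "home d" "fst (d src) = enc q" "src \<noteq> 1" "wf_ntm M" "decides_in (step M) M A t"
  shows "tb (runP M src) d ((cost (oneP M) + 20) * (t (length q) + 1))"
proof -
  obtain f where f: "conf_of f = init M q" "agree {2, 3, 4, 7} d f" "\<And>e. (d, e) \<in> sem (loadP M src) \<longleftrightarrow> e = f"
    by (rule sem_loadP[OF assms(1-3)]) (rule that)
  let ?I = "\<lambda>m e. \<forall>n c. (step M ^^ n) (conf_of e) c \<longrightarrow> n \<le> m"
  let ?c = "cost (oneP M)"
  have star: "tb (Star (oneP M)) f ((t (length q) + 1) * (?c + 1))"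
  proof (rule tb_Star[of ?I])
    show "?I (t (length q)) f" using assms(5) f(1) by (simp add: decides_in_def)
    show "tb (oneP M) e ?c" for e by (rule tb_loopfree) (simp add: oneP_def)
    fix m e e' assume I: "?I m e" and s: "(e, e') \<in> sem (oneP M)"
    from s obtain c where c: "step M (conf_of e) c" "e' = put c e" by (auto simp: sem_oneP[OF assms(4)])
    have b: "Suc n \<le> m" if "(step M ^^ n) c c'" for n c'
      using I relpowp_Suc_I2[of "step M", OF c(1) that] by blast
    have "m \<noteq> 0" using b[of 0 c] by simp
    moreover have "?I (m - 1) e'" using b c(2) by fastforce
    ultimately show "\<exists>m'<m. ?I m' e'" by (intro exI[of _ "m - 1"]) simp
  qed
  have "tb (runP M src) d (Suc (cost (loadP M src) + Suc ((t (length q) + 1) * (?c + 1) + Suc (1 + 1))))"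
    unfolding runP_def
  proof (intro tb_seqs_Cons)
    show "tb (loadP M src) d (cost (loadP M src))" by (rule tb_loopfree) simp
    show "tb (Star (oneP M)) e ((t (length q) + 1) * (?c + 1))" if "(d, e) \<in> sem (loadP M src)" for e
      using star that f(3) by simp
  qed auto
  then show ?thesis by (rule tb_mono) (simp add: algebra_simps)
qed

text \<open>The contract of a subroutine: membership is reported by finishing, and nothing is
  reported otherwise. Only the tapes 2, 3, 4, 7 may change, so callers can keep their data
  elsewhere. Monotonicity of \<open>T\<close> allows a bound on the length of a query to stand in
  for the length itself.\<close>

definition decider :: "bool list set \<Rightarrow> (nat \<Rightarrow> prog) \<Rightarrow> (nat \<Rightarrow> nat) \<Rightarrow> bool" where
  "decider A P T \<longleftrightarrow> mono T \<and> expb T \<and>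
     (\<forall>d src q. home d \<longrightarrow> fst (d src) = enc q \<longrightarrow> src \<noteq> 1 \<longrightarrow>
       ((\<exists>e. (d, e) \<in> sem (P src)) \<longleftrightarrow> q \<in> A) \<and> (\<forall>e. (d, e) \<in> sem (P src) \<longrightarrow> agree {2, 3, 4, 7} d e) \<and>
       tb (P src) d (T (length q)))"

lemma deciderD:
  assumes "decider A P T"
  shows "mono T" "expb T"
    and "home d \<Longrightarrow> fst (d src) = enc q \<Longrightarrow> src \<noteq> 1 \<Longrightarrow> (\<exists>e. (d, e) \<in> sem (P src)) \<longleftrightarrow> q \<in> A"
    and "home d \<Longrightarrow> fst (d src) = enc q \<Longrightarrow> src \<noteq> 1 \<Longrightarrow> (d, e) \<in> sem (P src) \<Longrightarrow> agree {2, 3, 4, 7} d e"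
    and "home d \<Longrightarrow> fst (d src) = enc q \<Longrightarrow> src \<noteq> 1 \<Longrightarrow> tb (P src) d (T (length q))"
  using assms unfolding decider_def by blast+

lemma NEXP_decider:
  assumes "A \<in> NEXP"
  obtains P T where "decider A P T"
proof -
  obtain M k where M: "wf_ntm M" "decides_in (step M) M A (\<lambda>n. 2 ^ (n ^ k + k))"
    using assms unfolding NEXP_def by blast
  let ?T = "\<lambda>n. (cost (oneP M) + 20) * (2 ^ (n ^ k + k) + 1)"
  have "mono ?T" by (intro monoI mult_le_mono add_mono power_increasing power_mono) auto
  moreover have "expb ?T" by (intro expb_add expb_mult expb_exp polyb_pk expb_poly polyb_const)
  ultimately have "decider A (runP M) ?T"
    unfolding decider_def using runP_sem[OF _ _ _ M] runP_tb[OF _ _ _ M] by blast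
  then show thesis by (rule that)
qed

lemma home_d0 [simp]: "home (d0 w)" and d0_0 [simp]: "fst (d0 w 0) = enc w"
  by (auto simp: home_def d0_def)

section \<open>Closure of \<open>NEXP\<close> under union and intersection\<close>

lemma NEXP_Un:
  assumes "A \<in> NEXP" "B \<in> NEXP"
  shows "A \<union> B \<in> NEXP"
proof -
  obtain P S where P: "decider A P S" using NEXP_decider[OF assms(1)] .
  obtain Q T where Q: "decider B Q T" using NEXP_decider[OF assms(2)] .
  have "{w. \<exists>e. (d0 w, e) \<in> sem (Cho (P 0) (Q 0))} \<in> NEXP"
  proof (rule NEXP_prog)
    show "tb (Cho (P 0) (Q 0)) (d0 w) (Suc (S (length w) + T (length w)))" for w
      by (intro tb_Cho' deciderD(5)[OF P] deciderD(5)[OF Q]) auto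
    have "expb (\<lambda>n. S n + T n + 1)"
      using deciderD(2)[OF P] deciderD(2)[OF Q] by (intro expb_add expb_poly[OF polyb_const])
    then show "expb (\<lambda>n. Suc (S n + T n))" by simp
  qed
  moreover have "(\<exists>e. (d0 w, e) \<in> sem (Cho (P 0) (Q 0))) \<longleftrightarrow> w \<in> A \<union> B" for w
    using deciderD(3)[OF P, of "d0 w" 0 w] deciderD(3)[OF Q, of "d0 w" 0 w] by auto
  ultimately show ?thesis by (simp only: Collect_mem_eq)
qed

lemma NEXP_Int:
  assumes "A \<in> NEXP" "B \<in> NEXP"
  shows "A \<inter> B \<in> NEXP"
proof -
  obtain P S where P: "decider A P S" using NEXP_decider[OF assms(1)] .
  obtain Q T where Q: "decider B Q T" using NEXP_decider[OF assms(2)] .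
  have keep: "home e" "fst (e 0) = enc w" if "(d0 w, e) \<in> sem (P 0)" for w e
    using deciderD(4)[OF P _ _ _ that, of w] home_d0[of w] d0_0[of w] by (auto simp: agree_def home_def)
  have "{w. \<exists>e. (d0 w, e) \<in> sem (Seq (P 0) (Q 0))} \<in> NEXP"
  proof (rule NEXP_prog)
    show "tb (Seq (P 0) (Q 0)) (d0 w) (Suc (S (length w) + T (length w)))" for w
      by (intro tb_Seq deciderD(5)[OF P] deciderD(5)[OF Q]) (auto intro: keep)
    have "expb (\<lambda>n. S n + T n + 1)"
      using deciderD(2)[OF P] deciderD(2)[OF Q] by (intro expb_add expb_poly[OF polyb_const])
    then show "expb (\<lambda>n. Suc (S n + T n))" by simp
  qed
  moreover have "(\<exists>e. (d0 w, e) \<in> sem (Seq (P 0) (Q 0))) \<longleftrightarrow> w \<in> A \<inter> B" for w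
    using deciderD(3)[OF P, of "d0 w" 0 w] deciderD(3)[OF Q, of _ 0 w] keep[of w] by auto blast+
  ultimately show ?thesis by (simp only: Collect_mem_eq)
qed

lemma NEXP_empty: "{} \<in> NEXP"
proof -
  have "{w. \<exists>e. (d0 w, e) \<in> sem Fail} \<in> NEXP"
    by (rule NEXP_prog[of _ "\<lambda>_. 0"]) auto
  then show ?thesis by simp
qed

section \<open>Marked unions and path generation\<close>

lemma wr_rd [simp]: "wr d i (rd d i) = d"
  by (auto simp: wr_def rd_def fun_eq_iff)

lemma wr_rd' : "rd d i = a \<Longrightarrow> wr d i a = d"
  by auto

lemma sem_seqs_Nil: "(d, e) \<in> sem (seqs []) \<longleftrightarrow> e = d"
  by auto

lemma sem_Op: "(d, e) \<in> sem (Op x) \<longleftrightarrow> opsem x d e"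
  by simp

lemma sem_Cho: "(d, e) \<in> sem (Cho p q) \<longleftrightarrow> (d, e) \<in> sem p \<or> (d, e) \<in> sem q"
  by simp

lemmas sem_iffs = sem_seqs_Cons sem_seqs_Nil sem_Op sem_Cho opsem.simps

text \<open>The mark stands at the end, where a machine that has just copied its input to the query
  tape can append it.\<close>

definition join :: "bool list set \<Rightarrow> bool list set \<Rightarrow> bool list set" where
  "join A B = {w @ [True] | w. w \<in> A} \<union> {w @ [False] | w. w \<in> B}"

lemma join_snoc [simp]: "w @ [b] \<in> join A B \<longleftrightarrow> (if b then w \<in> A else w \<in> B)" "[] \<notin> join A B"
  by (auto simp: join_def)

definition scanP :: prog where
  "scanP = seqs [Op (Ne 5 0), Op (Mr 5)]"

lemma enc_nat: "enc w (int j) = (if j < length w then (if w ! j then 2 else 1) else 0)"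
  by (auto simp: enc_def)

lemma enc_snoc: "(enc (u @ [b]))(int (length u) := 0) = enc u"
  by (auto simp: enc_def fun_eq_iff nth_append)

lemma enc_take_Suc: "i < length q \<Longrightarrow> enc (take (Suc i) q) = (enc (take i q))(int i := (if q ! i then 2 else 1))"
  by (auto simp: enc_def fun_eq_iff)

lemma sem_scanP: "(d, e) \<in> sem scanP \<longleftrightarrow> rd d 5 \<noteq> 0 \<and> e = d(5 := (fst (d 5), snd (d 5) + 1))"
  by (auto simp: scanP_def)

lemma scan_Star:
  assumes "d 5 = (enc w, 0)"
  shows "(d, e) \<in> sem (Star scanP) \<and> rd e 5 = 0 \<longleftrightarrow> e = d(5 := (enc w, int (length w)))"
    and "tb (Star scanP) d ((length w + 1) * (cost scanP + 1))"
proof -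
  let ?f = "\<lambda>i. d(5 := (enc w, int i))"
  have r: "rd (?f i) 5 = 0 \<longleftrightarrow> length w \<le> i" for i by (simp add: rd_def enc_nat)
  have st: "(?f i, e) \<in> sem scanP \<longleftrightarrow> i < length w \<and> True \<and> e = ?f (Suc i)" for i e
    unfolding sem_scanP r by (simp add: add.commute not_le)
  have f0: "?f 0 = d" using assms by (simp add: fun_upd_idem)
  show "(d, e) \<in> sem (Star scanP) \<and> rd e 5 = 0 \<longleftrightarrow> e = ?f (length w)"
  proof -
    have "(d, e) \<in> sem (Star scanP) \<longleftrightarrow> (\<exists>i\<le>length w. e = ?f i)"
      using Star_chain(1)[of "length w" ?f, OF st, of e] unfolding f0 by simp
    then show ?thesis using r by (metis order.refl le_antisym)
  qed
  show "tb (Star scanP) d ((length w + 1) * (cost scanP + 1))"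
    using Star_chain(2)[of "length w" ?f, OF st tb_loopfree] unfolding f0 by (simp add: scanP_def)
qed

lemma NEXP_join:
  assumes "A \<in> NEXP" "B \<in> NEXP"
  shows "join A B \<in> NEXP"
proof -
  obtain P S where P: "decider A P S" using NEXP_decider[OF assms(1)] .
  obtain Q T where Q: "decider B Q T" using NEXP_decider[OF assms(2)] .
  \<comment> \<open>The head is on the last symbol, the mark. For the empty word it is at -1 and
    reads a blank, so both branches fail, in agreement with
    \<open>[] \<notin> join A B\<close>.\<close>
  let ?d = "\<lambda>w. (d0 w)(5 := (enc w, int (length w) - 1))"
  let ?br = "Cho (seqs [Op (Wr 5 2 0), P 5]) (seqs [Op (Wr 5 1 0), Q 5])"
  let ?p = "seqs [Op (Cp 5 0 0), Star scanP, Op (Wr 5 0 0), Op (Ml 5), ?br]"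
  let ?g = "\<lambda>u b. (d0 (u @ [b]))(5 := (enc u, int (length u)))"
  have pre: "(d0 w, e) \<in> sem ?p \<longleftrightarrow> (?d w, e) \<in> sem ?br" for w e
  proof -
    let ?d1 = "(d0 w)(5 := (enc w, 0))"
    have 1: "(\<exists>f. (?d1, f) \<in> sem (Star scanP) \<and> (\<exists>g. opsem (Wr 5 0 0) f g \<and> R g)) \<longleftrightarrow>
        R (?d1(5 := (enc w, int (length w))))" for R
    proof -
      have "(\<exists>f. (?d1, f) \<in> sem (Star scanP) \<and> (\<exists>g. opsem (Wr 5 0 0) f g \<and> R g)) \<longleftrightarrow>
         (\<exists>f. ((?d1, f) \<in> sem (Star scanP) \<and> rd f 5 = 0) \<and> R f)"
        by (auto simp: wr_rd' simp del: sem.simps(6))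
      also have "\<dots> \<longleftrightarrow> R (?d1(5 := (enc w, int (length w))))"
        unfolding scan_Star(1)[of ?d1 w, OF fun_upd_same] by simp
      finally show ?thesis .
    qed
    have 0: "d0 w 0 = (enc w, 0)" by (simp add: d0_def)
    show ?thesis
      unfolding sem_seqs_Cons[of _ _ "Op (Cp _ _ _)"] sem_seqs_Cons[of _ _ "Star _"]
        sem_seqs_Cons[of _ _ "Op (Wr 5 0 0)"] sem_seqs_Cons[of _ _ "Op (Ml _)"] sem_seqs_Cons[of _ _ "Cho _ _"]
      using 1[of "\<lambda>g. \<exists>h. (g, h) \<in> sem (Op (Ml 5)) \<and> (\<exists>i. (h, i) \<in> sem ?br \<and> (i, e) \<in> sem (seqs []))"] 0
      by (simp del: sem.simps(4,5,6) seqs.simps(2))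
  qed
  have hg: "home (?g u b)" "fst (?g u b 5) = enc u" for u b
    by (auto simp: home_def d0_def)
  have r: "rd (?d (u @ [b])) 5 = (if b then 2 else 1)" and w: "wr (?d (u @ [b])) 5 0 = ?g u b" for u b
    using enc_nat[of "u @ [b]" "length u"] enc_snoc[of u b] by (simp_all add: rd_def wr_def)
  have r0: "rd (?d []) 5 = 0" by (simp add: rd_def enc_def)
  have br: "(?d (u @ [b]), e) \<in> sem ?br \<longleftrightarrow> (?g u b, e) \<in> sem (if b then P 5 else Q 5)" for u b e
    using r[of u b] w[of u b] by (cases b) (simp_all add: sem_iffs del: seqs.simps sem.simps)
  have br0: "(?d [], e) \<notin> sem ?br" for e
    using r0 by auto
  have mono: "S m \<le> S n" "T m \<le> T n" if "m \<le> n" for m n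
    using monoD[OF deciderD(1)[OF P] that] monoD[OF deciderD(1)[OF Q] that] .
  have "{w. \<exists>e. (d0 w, e) \<in> sem ?p} \<in> NEXP"
  proof (rule NEXP_prog)
    fix w :: "bool list"
    let ?n = "length w"
    have "tb (P 5) e (S ?n)" if "(?d w, e) \<in> sem (Op (Wr 5 2 0))" for e
    proof (cases w rule: rev_cases)
      case (snoc u b)
      have "e = ?g u b" using that w[of u b] unfolding snoc by simp
      then have "tb (P 5) e (S (length u))" using deciderD(5)[OF P hg(1), of u b 5 u] hg(2) by simp
      then show ?thesis by (rule tb_mono) (use mono snoc in simp)
    qed (use that r0 in simp)
    moreover have "tb (Q 5) e (T ?n)" if "(?d w, e) \<in> sem (Op (Wr 5 1 0))" for e
    proof (cases w rule: rev_cases)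
      case (snoc u b)
      have "e = ?g u b" using that w[of u b] unfolding snoc by simp
      then have "tb (Q 5) e (T (length u))" using deciderD(5)[OF Q hg(1), of u b 5 u] hg(2) by simp
      then show ?thesis by (rule tb_mono) (use mono snoc in simp)
    qed (use that r0 in simp)
    ultimately have brt: "tb ?br (?d w) (Suc (Suc (1 + Suc (S ?n + 1)) + Suc (1 + Suc (T ?n + 1))))"
      by (intro tb_Cho' tb_seqs_Cons) auto
    let ?d1 = "(d0 w)(5 := (enc w, 0))"
    have "tb ?p (d0 w) (Suc (1 + Suc ((?n + 1) * (cost scanP + 1) + Suc (1 + Suc (1 +
        Suc (Suc (Suc (1 + Suc (S ?n + 1)) + Suc (1 + Suc (T ?n + 1))) + 1))))))"
    proof (intro tb_seqs_Cons[of "Op (Cp 5 0 0)"] tb_seqs_Cons[of "Star scanP"] tb_seqs_Cons[of "Op (Wr 5 0 0)"]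
        tb_seqs_Cons[of "Op (Ml 5)"] tb_seqs_Cons[of ?br])
      fix e assume e: "(d0 w, e) \<in> sem (Op (Cp 5 0 0))"
      then have e: "e = ?d1" by (auto simp: d0_def)
      show "tb (Star scanP) e ((?n + 1) * (cost scanP + 1))"
        unfolding e by (rule scan_Star(2)) simp
      fix f assume f: "(e, f) \<in> sem (Star scanP)"
      fix g assume g: "(f, g) \<in> sem (Op (Wr 5 0 0))"
      then have "rd f 5 = 0" "g = f" by (auto simp: wr_rd')
      then have "g = ?d1(5 := (enc w, int ?n))" using f scan_Star(1)[of ?d1 w f] unfolding e by simp
      moreover fix h assume "(g, h) \<in> sem (Op (Ml 5))"
      ultimately have "h = ?d w" by auto
      then show "tb ?br h (Suc (Suc (1 + Suc (S ?n + 1)) + Suc (1 + Suc (T ?n + 1))))" using brt by simp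
    qed auto
    then show "tb ?p (d0 w) ((?n + 1) * (cost scanP + 1) + S ?n + T ?n + 50)" by (rule tb_mono) simp
  next
    show "expb (\<lambda>n. (n + 1) * (cost scanP + 1) + S n + T n + 50)"
      using deciderD(2)[OF P] deciderD(2)[OF Q]
      by (intro expb_add expb_mult expb_poly[OF polyb_const] expb_poly[OF polyb_id])
  qed
  moreover have "(\<exists>e. (d0 w, e) \<in> sem ?p) \<longleftrightarrow> w \<in> join A B" for w
  proof (cases w rule: rev_cases)
    case Nil
    then show ?thesis unfolding pre using br0 by auto
  next
    case (snoc u b)
    then show ?thesis unfolding pre unfolding snoc br
      using deciderD(3)[OF P, of "?g u b" 5 u, OF hg] deciderD(3)[OF Q, of "?g u b" 5 u, OF hg] by (cases b) simp_all
  qed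
  ultimately show ?thesis by (simp only: Collect_mem_eq)
qed

section \<open>Paths of polynomial length\<close>

definition encl :: "nat list \<Rightarrow> int \<Rightarrow> nat" where
  "encl p = (\<lambda>i. if 0 \<le> i \<and> i < int (length p) then p ! nat i else 0)"

lemma encl_nat: "encl p (int j) = (if j < length p then p ! j else 0)"
  by (simp add: encl_def)

lemma encl_snoc: "(encl p)(int (length p) := x) = encl (p @ [x])"
  by (auto simp: encl_def fun_eq_iff nth_append)

text \<open>Appends \<open>(n + 2) ^ j\<close> symbols to tape 5, where \<open>n\<close> is the input length; the counter of each loop is
a head moving over a copy of the input.\<close>

fun fuelP :: "nat list \<Rightarrow> nat \<Rightarrow> prog" where
  "fuelP X 0 = seqs [chos (map (\<lambda>x. Op (Wr 5 0 x)) X), Op (Mr 5)]"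
| "fuelP X (Suc j) = seqs [Op (Cp (8 + j) 0 0), Star (seqs [Op (Ne (8 + j) 0), Op (Mr (8 + j)), fuelP X j]),
     Op (Wr (8 + j) 0 0), fuelP X j, fuelP X j]"

definition FS :: "bool list \<Rightarrow> nat list \<Rightarrow> data \<Rightarrow> bool" where
  "FS w p d \<longleftrightarrow> d 0 = (enc w, 0) \<and> home d \<and> d 5 = (encl p, int (length p))"

lemma FS_d0: "FS w [] (d0 w)"
  by (auto simp: FS_def d0_def encl_def home_def)

lemma FS_upd: "8 \<le> i \<Longrightarrow> FS w p (d(i := z)) \<longleftrightarrow> FS w p d"
  by (auto simp: FS_def home_def)

fun ft :: "nat \<Rightarrow> nat \<Rightarrow> nat \<Rightarrow> nat" where
  "ft c n 0 = c"
| "ft c n (Suc j) = (n + 1) * (ft c n j + 10) + 2 * ft c n j + 20"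

lemma polyb_ft: "polyb (\<lambda>n. ft c n j)"
proof (induction j)
  case (Suc j)
  show ?case unfolding ft.simps by (intro polyb_add polyb_mult polyb_const polyb_id Suc)
qed simp

text \<open>The loop contributes \<open>n\<close> blocks of length \<open>(n + 2) ^ j\<close> and
  the two calls behind it one block each, which gives the factor \<open>n + 2\<close>. Level
  \<open>j\<close> uses only the counters on tapes below \<open>8 + j\<close>; that the tapes from
  there on are untouched protects the counters of the enclosing loops. Time and effect are proved
  together because later calls are bounded only under the invariant \<open>FS\<close>.\<close>

lemma fuel_step:
  "FS w p d \<Longrightarrow> tb (fuelP X j) d (ft (cost (fuelP X 0)) (length w) j) \<and>
   (\<forall>e. (d, e) \<in> sem (fuelP X j) \<longrightarrow>
     (\<exists>p'. set p' \<subseteq> set X \<and> length p' = (length w + 2) ^ j \<and> FS w (p @ p') e) \<and> (\<forall>i\<ge>8+j. e i = d i))"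
proof (induction j arbitrary: p d)
  case 0
  have "tb (fuelP X 0) d (cost (fuelP X 0))" by (rule tb_loopfree) auto
  moreover have "(\<exists>p'. set p' \<subseteq> set X \<and> length p' = 1 \<and> FS w (p @ p') e) \<and> (\<forall>i\<ge>8. e i = d i)"
    if e: "(d, e) \<in> sem (fuelP X 0)" for e
  proof -
    from e obtain x where "x \<in> set X" "e = d(5 := ((fst (d 5))(snd (d 5) := x), snd (d 5) + 1))"
      by (auto simp: sem_seqs_Cons wr_def)
    then show ?thesis using 0 by (intro conjI exI[of _ "[x]"]) (auto simp: FS_def home_def encl_snoc)
  qed
  ultimately show ?case by (simp del: fuelP.simps)
next
  case (Suc j)
  let ?i = "8 + j" and ?n = "length w" and ?t = "ft (cost (fuelP X 0)) (length w) j" and ?F = "(length w + 2) ^ j"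
  let ?body = "seqs [Op (Ne (8 + j) 0), Op (Mr (8 + j)), fuelP X j]"
  let ?T = "Suc (1 + Suc (1 + Suc (?t + 1)))"
  let ?J = "\<lambda>l e. l \<le> ?n \<and> (\<exists>q. set q \<subseteq> set X \<and> length q = l * ?F \<and> FS w (p @ q) e) \<and> e ?i = (enc w, int l) \<and>
    (\<forall>i\<ge>8+Suc j. e i = d i)"
  define d1 where "d1 = d(8 + j := (enc w, 0))"
  have J0: "?J 0 d1" using Suc.prems by (auto simp: d1_def FS_upd intro!: exI[of _ "[]"])
  have st: "l < ?n \<and> ?J (Suc l) f" if J: "?J l e" and f: "(e, f) \<in> sem ?body" for l e f
  proof -
    from J obtain q where q: "set q \<subseteq> set X" "length q = l * ?F" "FS w (p @ q) e" by blast
    let ?e = "e(?i := (enc w, int (Suc l)))"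
    have s: "rd e ?i \<noteq> 0" "(?e, f) \<in> sem (fuelP X j)" using f J by (auto simp: sem_seqs_Cons add.commute)
    have l: "l < ?n" using s(1) J by (auto simp: rd_def enc_nat split: if_splits)
    have "FS w (p @ q) ?e" using q(3) by (simp add: FS_upd)
    with Suc.IH s(2) obtain q' where "set q' \<subseteq> set X" "length q' = ?F" "FS w ((p @ q) @ q') f"
      "\<forall>i\<ge>8+j. f i = ?e i" by blast
    then show ?thesis using l q J by (auto intro!: exI[of _ "q @ q'"])
  qed
  have body: "tb ?body e ?T" if J: "?J l e" for l e
  proof (intro tb_seqs_Cons)
    fix f g assume "(e, f) \<in> sem (Op (Ne (8 + j) 0))" "(f, g) \<in> sem (Op (Mr (8 + j)))"
    then have "g = e(?i := (fst (e ?i), snd (e ?i) + 1))" by auto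
    then have "\<exists>q. FS w q g" using J by (auto simp: FS_upd)
    then show "tb (fuelP X j) g ?t" using Suc.IH by blast
  qed auto
  have star: "tb (Star ?body) d1 ((?n + 1) * (?T + 1))"
    using Star_count(2)[where J = ?J and p = ?body and n = ?n, OF J0] st body by blast
  have loop: "?J ?n e" if L: "(d1, e) \<in> sem (Star ?body)" "rd e ?i = 0" for e
  proof -
    obtain l where "?J l e" using Star_count(1)[where J = ?J and p = ?body and n = ?n, OF J0 _ L(1)] st by blast
    moreover from this have "l = ?n" using L(2) by (auto simp: rd_def enc_nat split: if_splits)
    ultimately show ?thesis by simp
  qed
  have cp: "opsem (Cp (8 + j) 0 0) d e \<longleftrightarrow> e = d1" for e using Suc.prems by (simp add: d1_def FS_def)
  have tail: "(\<exists>q. FS w q g) \<and> rd f ?i = 0 \<and> g = f" if "(d1, f) \<in> sem (Star ?body)" "(f, g) \<in> sem (Op (Wr (8 + j) 0 0))" for f g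
  proof -
    have "rd f ?i = 0" "g = f" using that(2) by (auto simp: wr_rd')
    then show ?thesis using loop that(1) by blast
  qed
  have "tb (fuelP X (Suc j)) d (Suc (1 + Suc ((?n + 1) * (?T + 1) + Suc (1 + Suc (?t + Suc (?t + 1))))))"
    unfolding fuelP.simps(2)
  proof (intro tb_seqs_Cons[of "Op (Cp _ _ _)"] tb_seqs_Cons[of "Star _"] tb_seqs_Cons[of "Op (Wr _ _ _)"] tb_seqs_Cons[of "fuelP _ _"])
    fix e f g h assume e: "(d, e) \<in> sem (Op (Cp (8 + j) 0 0))"
    then show "tb (Star ?body) e ((?n + 1) * (?T + 1))" using star cp by simp
    assume f: "(e, f) \<in> sem (Star ?body)" and g: "(f, g) \<in> sem (Op (Wr (8 + j) 0 0))"
    have "e = d1" using e cp unfolding sem_Op by blast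
    then obtain q where q: "FS w q g" using tail f g by blast
    then show "tb (fuelP X j) g ?t" using Suc.IH by blast
    assume "(g, h) \<in> sem (fuelP X j)"
    then show "tb (fuelP X j) h ?t" using Suc.IH q by blast
  qed auto
  moreover have "(\<exists>p'. set p' \<subseteq> set X \<and> length p' = (?n + 2) ^ Suc j \<and> FS w (p @ p') e) \<and> (\<forall>i\<ge>8 + Suc j. e i = d i)"
    if e: "(d, e) \<in> sem (fuelP X (Suc j))" for e
  proof -
    from e obtain f g h where f: "(d1, f) \<in> sem (Star ?body)" "(f, g) \<in> sem (Op (Wr (8 + j) 0 0))"
      "(g, h) \<in> sem (fuelP X j)" "(h, e) \<in> sem (fuelP X j)"
      unfolding fuelP.simps(2) sem_seqs_Cons[of _ _ "Op (Cp _ _ _)"] sem_seqs_Cons[of _ _ "Op (Wr _ _ _)"]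
        sem_seqs_Cons[of _ _ "Star _"] sem_seqs_Cons[of _ _ "fuelP _ _"] sem_seqs_Nil
        sem_Op[of _ _ "Cp _ _ _"] cp by blast
    have J: "?J ?n g" using loop tail f(1,2) by blast
    then obtain q where q: "set q \<subseteq> set X" "length q = ?n * ?F" "FS w (p @ q) g" by blast
    obtain q1 where q1: "set q1 \<subseteq> set X" "length q1 = ?F" "FS w ((p @ q) @ q1) h" "\<forall>i\<ge>8+j. h i = g i"
      using Suc.IH[OF q(3)] f(3) by blast
    obtain q2 where q2: "set q2 \<subseteq> set X" "length q2 = ?F" "FS w (((p @ q) @ q1) @ q2) e" "\<forall>i\<ge>8+j. e i = h i"
      using Suc.IH[OF q1(3)] f(4) by blast
    show ?thesis using J q q1 q2
      by (intro conjI exI[of _ "q @ q1 @ q2"]) (auto simp: algebra_simps)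
  qed
  ultimately show ?case by (auto intro: tb_mono simp: algebra_simps simp del: fuelP.simps)
qed

lemma fuel_tb: "FS w p d \<Longrightarrow> tb (fuelP X j) d (ft (cost (fuelP X 0)) (length w) j)"
  using fuel_step by blast

lemma fuel_sound:
  "FS w p d \<Longrightarrow> (d, e) \<in> sem (fuelP X j) \<Longrightarrow>
   (\<exists>p'. set p' \<subseteq> set X \<and> length p' = (length w + 2) ^ j \<and> FS w (p @ p') e) \<and> (\<forall>i\<ge>8+j. e i = d i)"
  using fuel_step by blast

text \<open>Any prescribed list can be produced: cut it into \<open>n + 2\<close> blocks of length
  \<open>(n + 2) ^ j\<close>, give the first \<open>n\<close> to the rounds of the loop and the
  other two to the calls behind it.\<close>

lemma fuel_complete:
  "FS w p d \<Longrightarrow> set p' \<subseteq> set X \<Longrightarrow> length p' = (length w + 2) ^ j \<Longrightarrow>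
   \<exists>e. (d, e) \<in> sem (fuelP X j) \<and> FS w (p @ p') e"
proof (induction j arbitrary: p d p')
  case 0
  then obtain x where x: "p' = [x]" "x \<in> set X" by (auto simp: length_Suc_conv)
  let ?e = "d(5 := ((fst (d 5))(snd (d 5) := x), snd (d 5) + 1))"
  have "rd d 5 = 0" using 0(1) by (auto simp: FS_def rd_def encl_nat)
  then have "(d, wr d 5 x) \<in> sem (chos (map (\<lambda>x. Op (Wr 5 0 x)) X))"
    "(wr d 5 x, ?e) \<in> sem (Op (Mr 5))" using x by (auto simp: wr_def)
  then have "(d, ?e) \<in> sem (fuelP X 0)"
    unfolding fuelP.simps sem_seqs_Cons by (metis IdI seqs.simps(1) sem.simps(2))
  moreover have "FS w (p @ p') ?e" using 0(1) x by (auto simp: FS_def home_def encl_snoc)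
  ultimately show ?case by blast
next
  case (Suc j)
  let ?i = "8 + j" and ?n = "length w" and ?F = "(length w + 2) ^ j"
  let ?body = "seqs [Op (Ne (8 + j) 0), Op (Mr (8 + j)), fuelP X j]"
  define d1 where "d1 = d(8 + j := (enc w, 0))"
  have F1: "FS w p d1" using Suc.prems(1) by (simp add: d1_def FS_upd)
  have d1i: "d1 ?i = (enc w, 0)" "\<forall>i\<ge>8+Suc j. d1 i = d i" by (auto simp: d1_def)
  have it: "\<exists>e. (d1, e) \<in> (sem ?body)\<^sup>* \<and> FS w (p @ q) e \<and> e ?i = (enc w, int m)"
    if "m \<le> ?n" "set q \<subseteq> set X" "length q = m * ?F" for m q
    using that
  proof (induction m arbitrary: q)
    case 0
    then show ?case using F1 d1i by (intro exI[of _ d1]) auto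
  next
    case (Suc m)
    define q1 q2 where "q1 = take (m * ?F) q" and "q2 = drop (m * ?F) q"
    have q: "q = q1 @ q2" "set q1 \<subseteq> set X" "set q2 \<subseteq> set X" "length q1 = m * ?F" "length q2 = ?F"
      using Suc.prems unfolding q1_def q2_def by (auto dest: in_set_takeD in_set_dropD)
    obtain e where e: "(d1, e) \<in> (sem ?body)\<^sup>*" "FS w (p @ q1) e" "e ?i = (enc w, int m)"
      using Suc.IH[of q1] q Suc.prems by auto
    let ?e = "e(?i := (enc w, int (Suc m)))"
    have F: "FS w (p @ q1) ?e" using e(2) by (simp add: FS_upd)
    obtain f where f: "(?e, f) \<in> sem (fuelP X j)" "FS w ((p @ q1) @ q2) f"
      using \<open>\<And>p' p d. FS w p d \<Longrightarrow> set p' \<subseteq> set X \<Longrightarrow> length p' = ?F \<Longrightarrow> \<exists>e. (d, e) \<in> sem (fuelP X j) \<and> FS w (p @ p') e\<close>[OF F q(3,5)] by blast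
    have "rd e ?i \<noteq> 0" using e(3) Suc.prems(1) by (auto simp: rd_def enc_nat)
    then have "(e, f) \<in> sem ?body"
      using f(1) e(3) by (simp add: sem_iffs add.commute del: seqs.simps sem.simps)
    moreover have "f ?i = ?e ?i" using fuel_sound[OF F f(1)] by auto
    ultimately show ?case using e f q(1)
      by (intro exI[of _ f]) (auto intro: rtrancl.rtrancl_into_rtrancl simp del: seqs.simps)
  qed
  define q1 q2 q3 where "q1 = take (?n * ?F) p'" and "q2 = take ?F (drop (?n * ?F) p')"
    and "q3 = drop ?F (drop (?n * ?F) p')"
  have q: "p' = q1 @ q2 @ q3" unfolding q1_def q2_def q3_def by (metis append_take_drop_id)
  have l: "length q1 = ?n * ?F" "length q2 = ?F" "length q3 = ?F"
    using Suc.prems(3) unfolding q1_def q2_def q3_def by (auto simp: algebra_simps)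
  have s: "set q1 \<subseteq> set X" "set q2 \<subseteq> set X" "set q3 \<subseteq> set X" using Suc.prems(2) q by auto
  obtain d2 where d2: "(d1, d2) \<in> (sem ?body)\<^sup>*" "FS w (p @ q1) d2" "d2 ?i = (enc w, int ?n)"
    using it[of ?n q1] s l by auto
  obtain d3 where d3: "(d2, d3) \<in> sem (fuelP X j)" "FS w ((p @ q1) @ q2) d3"
    using Suc.IH[OF d2(2) s(2) l(2)] by blast
  obtain e where e: "(d3, e) \<in> sem (fuelP X j)" "FS w (((p @ q1) @ q2) @ q3) e"
    using Suc.IH[OF d3(2) s(3) l(3)] by blast
  have a: "(d, d1) \<in> sem (Op (Cp (8 + j) 0 0))" using Suc.prems(1) by (auto simp: d1_def FS_def)
  have b: "(d2, d2) \<in> sem (Op (Wr (8 + j) 0 0))"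
  proof -
    have "rd d2 ?i = 0" using d2(3) by (auto simp: rd_def enc_nat)
    then show ?thesis by (simp add: wr_rd')
  qed
  have c: "(d1, d2) \<in> sem (Star ?body)" using d2(1) by simp
  have "(d, e) \<in> sem (fuelP X (Suc j))"
    unfolding fuelP.simps sem_seqs_Cons[of _ _ "Op (Cp _ _ _)"]
        sem_seqs_Cons[of _ _ "Op (Wr _ _ _)"] sem_seqs_Cons[of _ _ "Star _"] sem_seqs_Cons[of _ _ "fuelP _ _"]
    using a b c d3(1) e(1) by (metis IdI seqs.simps(1) sem.simps(2))
  moreover have "FS w (p @ p') e" using e(2) q by simp
  ultimately show ?case by blast
qed

section \<open>Replaying an oracle machine along a path\<close>

definition query_conf :: "ntm \<Rightarrow> bool \<Rightarrow> conf \<Rightarrow> conf" where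
  "query_conf M ans c = \<lparr>cstate = (if ans then qyes M else qno M), tp1 = tp1 c, hd1 = hd1 c,
     tp2 = (\<lambda>_. 0), hd2 = 0, nq = 1\<rparr>"

text \<open>A path is a list of symbols that selects the steps: \<open>x\<close> up to \<open>length (trs M)\<close> is a transition, the
next symbol is the query (answered by \<open>ans\<close>), and the last one does nothing and serves as padding.
Steps that do not apply are skipped, so that every path has exactly one outcome; this makes it sound to
quantify universally over paths. The second component remembers the oracle tape at the query. Only
one query is simulated: the promise on \<open>M\<close> says nothing about runs with wrong answers.\<close>

definition act :: "ntm \<Rightarrow> bool \<Rightarrow> nat \<Rightarrow> conf \<times> (int \<Rightarrow> nat) \<Rightarrow> conf \<times> (int \<Rightarrow> nat)" where
  "act M ans x = (\<lambda>(c, t).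
     if 1 \<le> x \<and> x \<le> length (trs M) then
       (if applies (trs M ! (x - 1)) c then (app (trs M ! (x - 1)) c, t) else (c, t))
     else if x = length (trs M) + 1 \<and> cstate c = qry M \<and> nq c = 0 then
       (query_conf M ans c, tp2 c)
     else (c, t))"

definition nsym :: "ntm \<Rightarrow> nat" where
  "nsym M = length (trs M) + 2"

definition actP :: "ntm \<Rightarrow> bool \<Rightarrow> nat \<Rightarrow> prog" where
  "actP M ans x =
     (if 1 \<le> x \<and> x \<le> length (trs M) then Cho (stepP (trs M ! (x - 1))) (misP (trs M ! (x - 1)))
      else if x = length (trs M) + 1 then
        Cho (seqs [Op (Wr 4 (qry M) (if ans then qyes M else qno M)), Op (Wr 7 0 1), Op (Cp 6 3 1), Op (Cp 3 1 1)])
          (Cho (Op (Ne 4 (qry M))) (Op (Ne 7 0)))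
      else Skip)"

definition view :: "data \<Rightarrow> conf \<times> (int \<Rightarrow> nat)" where
  "view d = (conf_of d, fst (d 6))"

definition putv :: "conf \<times> (int \<Rightarrow> nat) \<Rightarrow> data \<Rightarrow> data" where
  "putv v d = (put (fst v) d)(6 := (snd v, snd (d 6)))"

lemma conf_of_upd [simp]: "i \<notin> {2, 3, 4, 7} \<Longrightarrow> conf_of (d(i := z)) = conf_of d"
  by (auto simp: conf_of_def rd_def)

lemma view_putv [simp]: "view (putv v d) = v"
  by (simp add: view_def putv_def)

lemma putv_putv [simp]: "putv v (putv u d) = putv v d"
  by (auto simp: putv_def put_def wr_def fun_eq_iff)

lemma putv_view [simp]: "putv (view d) d = d"
  by (auto simp: putv_def view_def put_def wr_def conf_of_def rd_def fun_eq_iff)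

lemma putv_other: "i \<notin> {2, 3, 4, 6, 7} \<Longrightarrow> putv v d i = d i"
  by (auto simp: putv_def)

lemma putv_6 [simp]: "snd (putv v d 6) = snd (d 6)"
  by (simp add: putv_def)

lemma putv_5: "putv v (d(5 := z)) = (putv v d)(5 := z)"
  by (rule ext) (simp add: putv_def put_def wr_def)

lemma view_5 [simp]: "view (d(5 := z)) = view d"
  by (simp add: view_def)

lemma home_putv [simp]: "home (putv v d) \<longleftrightarrow> home d"
  by (simp add: home_def putv_other)

lemma home_5 [simp]: "home (d(5 := z)) \<longleftrightarrow> home d"
  by (simp add: home_def)

lemma trs_nth:
  assumes "wf_ntm M" "1 \<le> x" "x \<le> length (trs M)"
  shows "trs M ! (x - 1) \<in> delta M" "dirs (trs M ! (x - 1))"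
proof -
  have "x - 1 < length (trs M)" using assms(2,3) by linarith
  then show "trs M ! (x - 1) \<in> delta M" unfolding set_trs[OF assms(1), symmetric] by (rule nth_mem)
  then show "dirs (trs M ! (x - 1))" by (rule wf_dirs[OF assms(1)])
qed

text \<open>The program has exactly one result, as \<open>act\<close> is a function. The head of
  tape 6 is assumed at 0 because recording a query puts it there, whereas \<open>putv\<close> keeps
  its position.\<close>

lemma sem_actP:
  assumes "wf_ntm M" "home d" "snd (d 6) = 0"
  shows "(d, e) \<in> sem (actP M ans x) \<longleftrightarrow> e = putv (act M ans x (view d)) d"
proof -
  consider "1 \<le> x \<and> x \<le> length (trs M)" | "x = length (trs M) + 1" | "x = 0 \<or> x > length (trs M) + 1"
    by linarith
  then show ?thesis
  proof cases
    case 1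
    define \<tau> where "\<tau> = trs M ! (x - 1)"
    have dirs: "dirs \<tau>" using trs_nth[OF assms(1)] 1 unfolding \<tau>_def by blast
    have A: "actP M ans x = Cho (stepP \<tau>) (misP \<tau>)" using 1 by (simp add: actP_def \<tau>_def)
    have B: "act M ans x (view d) = (if applies \<tau> (conf_of d) then app \<tau> (conf_of d) else conf_of d, fst (d 6))"
      using 1 by (simp add: act_def view_def \<tau>_def)
    have C: "putv (c, fst (d 6)) d = put c d" for c
      by (auto simp: putv_def fun_eq_iff)
    show ?thesis unfolding A B C sem_Cho sem_stepP[OF dirs] sem_misP by simp
  next
    case 2
    define q where "q = (if ans then qyes M else qno M)"
    let ?e = "(wr (wr d 4 q) 7 1)(6 := (fst (d 3), 0), 3 := ((\<lambda>_. 0), 0))"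
    have r: "rd (wr d 4 q) 7 = rd d 7" by (simp add: rd_def wr_def)
    have h: "wr (wr d 4 q) 7 1 1 = ((\<lambda>_. 0), 0)" using assms(2) by (simp add: wr_def home_def)
    have h3: "wr (wr d 4 q) 7 1 3 = d 3" by (simp add: wr_def)
    have A: "actP M ans x = Cho (seqs [Op (Wr 4 (qry M) q), Op (Wr 7 0 1), Op (Cp 6 3 1), Op (Cp 3 1 1)])
          (Cho (Op (Ne 4 (qry M))) (Op (Ne 7 0)))"
      using 2 by (simp add: actP_def q_def)
    have *: "(d, e) \<in> sem (actP M ans x) \<longleftrightarrow>
        (if rd d 4 = qry M \<and> rd d 7 = 0 then e = ?e else e = d)"
      unfolding A by (auto simp: sem_iffs r h h3 simp del: seqs.simps sem.simps One_nat_def)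
    have "putv (query_conf M ans (conf_of d), fst (d 3)) d = ?e"
      by (rule ext) (simp add: putv_def put_def query_conf_def conf_of_def wr_def q_def assms(3))
    moreover have "putv (conf_of d, fst (d 6)) d = d" using putv_view[of d] by (simp add: view_def)
    moreover have "cstate (conf_of d) = rd d 4" "nq (conf_of d) = rd d 7" "tp2 (conf_of d) = fst (d 3)"
      by (simp_all add: conf_of_def)
    moreover have "act M ans x (view d) =
        (if rd d 4 = qry M \<and> rd d 7 = 0 then (query_conf M ans (conf_of d), fst (d 3)) else (conf_of d, fst (d 6)))"
      using 2 calculation(3-5) by (simp add: act_def view_def)
    ultimately show ?thesis unfolding *
      by (cases "rd d 4 = qry M \<and> rd d 7 = 0") (simp_all only: if_True if_False simp_thms)
  next
    case 3
    moreover have "putv (conf_of d, fst (d 6)) d = d" using putv_view[of d] by (simp add: view_def)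
    ultimately show ?thesis by (auto simp: actP_def act_def view_def simp del: putv_view)
  qed
qed

definition moveP :: "ntm \<Rightarrow> bool \<Rightarrow> prog" where
  "moveP M ans = chos (map (\<lambda>x. seqs [Op (Wr 5 x x), Op (Mr 5), actP M ans x]) [1..<nsym M + 1])"

text \<open>Symbols start at 1, since 0 is the blank that marks the end of a path.\<close>

definition symbols :: "ntm \<Rightarrow> nat set" where
  "symbols M = {1..nsym M}"

lemma sem_moveP:
  assumes "wf_ntm M" "home d" "snd (d 6) = 0" "d 5 = (encl p, int j)" "set p \<subseteq> symbols M"
  shows "(d, e) \<in> sem (moveP M ans) \<longleftrightarrow>
    j < length p \<and> e = putv (act M ans (p ! j) (view d)) (d(5 := (encl p, int (Suc j))))"
proof -
  let ?d = "d(5 := (encl p, int (Suc j)))"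
  have r: "rd d 5 = (if j < length p then p ! j else 0)" using assms(4) by (simp add: rd_def encl_nat)
  have "(d, e) \<in> sem (seqs [Op (Wr 5 x x), Op (Mr 5), actP M ans x]) \<longleftrightarrow>
      rd d 5 = x \<and> e = putv (act M ans x (view d)) ?d" for x
  proof -
    have "(d, e) \<in> sem (seqs [Op (Wr 5 x x), Op (Mr 5), actP M ans x]) \<longleftrightarrow>
        rd d 5 = x \<and> (?d, e) \<in> sem (actP M ans x)"
      using assms(4) wr_rd'[of d 5 x] by (simp add: sem_iffs add.commute cong: conj_cong del: seqs.simps sem.simps)
    also have "(?d, e) \<in> sem (actP M ans x) \<longleftrightarrow> e = putv (act M ans x (view ?d)) ?d"
      by (rule sem_actP) (use assms in simp_all)
    finally show ?thesis by simp
  qed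
  note one = this
  have "(d, e) \<in> sem (moveP M ans) \<longleftrightarrow>
      (\<exists>x\<in>{1..nsym M}. (d, e) \<in> sem (seqs [Op (Wr 5 x x), Op (Mr 5), actP M ans x]))"
  proof -
    have upt: "set [1..<nsym M + 1] = {1..nsym M}" by auto
    show ?thesis unfolding moveP_def sem_chos set_map upt by blast
  qed
  then have "(d, e) \<in> sem (moveP M ans) \<longleftrightarrow> rd d 5 \<in> {1..nsym M} \<and> e = putv (act M ans (rd d 5) (view d)) ?d"
    unfolding one by blast
  moreover have "rd d 5 \<in> {1..nsym M} \<longleftrightarrow> j < length p"
  proof (cases "j < length p")
    case True
    then have "p ! j \<in> symbols M" using assms(5) nth_mem by blast
    then show ?thesis using r True by (simp add: symbols_def)
  qed (simp add: r)
  ultimately show ?thesis using r by auto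
qed

lemma Star_moveP:
  assumes "wf_ntm M" "home d" "snd (d 6) = 0" "d 5 = (encl p, 0)" "set p \<subseteq> symbols M"
  shows "(d, e) \<in> sem (Star (moveP M ans)) \<longleftrightarrow>
    (\<exists>i\<le>length p. e = putv (fold (act M ans) (take i p) (view d)) (d(5 := (encl p, int i))))"
    and "tb (Star (moveP M ans)) d ((length p + 1) * (cost (moveP M ans) + 1))"
proof -
  let ?f = "\<lambda>i. putv (fold (act M ans) (take i p) (view d)) (d(5 := (encl p, int i)))"
  have st: "(?f i, e) \<in> sem (moveP M ans) \<longleftrightarrow> i < length p \<and> True \<and> e = ?f (Suc i)" for i e
  proof -
    have "(?f i, e) \<in> sem (moveP M ans) \<longleftrightarrow>
      i < length p \<and> e = putv (act M ans (p ! i) (view (?f i))) ((?f i)(5 := (encl p, int (Suc i))))"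
      by (rule sem_moveP) (use assms in \<open>auto simp: putv_5\<close>)
    moreover have "putv (act M ans (p ! i) (view (?f i))) ((?f i)(5 := (encl p, int (Suc i)))) = ?f (Suc i)"
      if "i < length p"
      using that by (simp add: putv_5 take_Suc_conv_app_nth)
    ultimately show ?thesis by auto
  qed
  have f0: "?f 0 = d" using assms(4) by (simp add: putv_5 fun_upd_idem)
  show "(d, e) \<in> sem (Star (moveP M ans)) \<longleftrightarrow> (\<exists>i\<le>length p. e = ?f i)"
    using Star_chain(1)[of "length p" ?f, OF st, of e] unfolding f0 by simp
  have "loopfree (moveP M ans)" by (auto simp: moveP_def actP_def)
  then show "tb (Star (moveP M ans)) d ((length p + 1) * (cost (moveP M ans) + 1))"
    using Star_chain(2)[of "length p" ?f, OF st tb_loopfree] unfolding f0 by simp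
qed

definition startP :: "ntm \<Rightarrow> prog" where
  "startP M = seqs [loadP M 0, Op (Cp 6 1 1), Op (Cp 5 5 1)]"

definition walkP :: "ntm \<Rightarrow> bool \<Rightarrow> prog" where
  "walkP M ans = seqs [startP M, Star (moveP M ans), Op (Wr 5 0 0)]"

definition outcome :: "ntm \<Rightarrow> bool \<Rightarrow> bool list \<Rightarrow> nat list \<Rightarrow> conf \<times> (int \<Rightarrow> nat)" where
  "outcome M ans w p = fold (act M ans) p (init M w, \<lambda>_. 0)"

definition ready :: "ntm \<Rightarrow> bool list \<Rightarrow> nat list \<Rightarrow> data \<Rightarrow> bool" where
  "ready M w p d \<longleftrightarrow> home d \<and> fst (d 0) = enc w \<and> fst (d 5) = encl p \<and> set p \<subseteq> symbols M"

lemma sem_startP: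
  assumes "ready M w p d"
  obtains g where "view g = (init M w, \<lambda>_. 0)" "agree {2, 3, 4, 5, 6, 7} d g" "home g" "snd (g 6) = 0"
    "g 5 = (encl p, 0)" "\<And>e. (d, e) \<in> sem (startP M) \<longleftrightarrow> e = g"
proof -
  obtain f where f: "conf_of f = init M w" "agree {2, 3, 4, 7} d f" "\<And>e. (d, e) \<in> sem (loadP M 0) \<longleftrightarrow> e = f"
    using sem_loadP[of d 0 w M] assms unfolding ready_def by (metis zero_neq_one)
  define g where "g = f(6 := ((\<lambda>_. 0), 0), 5 := (encl p, 0))"
  have f1: "f 1 = ((\<lambda>_. 0), 0)" "fst (f 5) = encl p"
    using f(2) assms by (auto simp: agree_def ready_def home_def)
  show thesis
  proof (rule that[of g])
    show "view g = (init M w, \<lambda>_. 0)" using f(1) by (simp add: view_def g_def)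
    show "agree {2, 3, 4, 5, 6, 7} d g" using f(2) by (auto simp: agree_def g_def)
    show "home g" using f1 by (simp add: home_def g_def)
    show "snd (g 6) = 0" "g 5 = (encl p, 0)" by (simp_all add: g_def)
    show "(d, e) \<in> sem (startP M) \<longleftrightarrow> e = g" for e
      unfolding startP_def sem_seqs_Cons f(3) using f1 by (simp add: sem_iffs g_def del: seqs.simps sem.simps)
  qed
qed

text \<open>The blank required behind the loop leaves a single exit, the one after the whole path. A
  check made afterwards therefore speaks about the outcome of this path and cannot be evaded by
  stopping early.\<close>

lemma sem_walkP:
  assumes "wf_ntm M" "ready M w p d"
  obtains e where "\<And>e'. (d, e') \<in> sem (walkP M ans) \<longleftrightarrow> e' = e" "view e = outcome M ans w p"
    "agree {2, 3, 4, 5, 6, 7} d e" "fst (e 5) = encl p" "snd (e 6) = 0" "home e"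
proof -
  obtain g where g: "view g = (init M w, \<lambda>_. 0)" "agree {2, 3, 4, 5, 6, 7} d g" "home g" "snd (g 6) = 0"
    "g 5 = (encl p, 0)" "\<And>e. (d, e) \<in> sem (startP M) \<longleftrightarrow> e = g"
    by (rule sem_startP[OF assms(2)]) (rule that)
  have p: "set p \<subseteq> symbols M" using assms(2) by (simp add: ready_def)
  let ?f = "\<lambda>i. putv (fold (act M ans) (take i p) (view g)) (g(5 := (encl p, int i)))"
  have r: "rd (?f i) 5 = 0 \<longleftrightarrow> length p \<le> i" for i
  proof -
    have *: "rd (?f i) 5 = (if i < length p then p ! i else 0)" by (simp add: putv_5 rd_def encl_nat)
    show ?thesis
    proof (cases "i < length p")
      case True
      then have "p ! i \<in> symbols M" using p nth_mem by blast
      then show ?thesis unfolding * using True by (simp add: symbols_def)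
    qed (unfold *, simp)
  qed
  define e where "e = ?f (length p)"
  have "(d, e') \<in> sem (walkP M ans) \<longleftrightarrow> e' = e" for e'
  proof -
    have "(d, e') \<in> sem (walkP M ans) \<longleftrightarrow> (\<exists>i\<le>length p. rd (?f i) 5 = 0 \<and> e' = ?f i)"
      unfolding walkP_def sem_seqs_Cons g(6)
      by (simp only: simp_thms Star_moveP(1)[OF assms(1) g(3,4,5) p])
        (auto simp: sem_iffs wr_rd' simp del: seqs.simps sem.simps)
    then show ?thesis unfolding r e_def by auto
  qed
  moreover have "view e = outcome M ans w p" unfolding e_def by (simp add: g(1) outcome_def)
  moreover have "agree {2, 3, 4, 5, 6, 7} d e"
    using g(2) by (auto simp: agree_def e_def putv_5 putv_other)
  moreover have "fst (e 5) = encl p" "snd (e 6) = 0" "home e"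
    using g by (simp_all add: e_def putv_5)
  ultimately show thesis using that by blast
qed

lemma walk_tb:
  assumes "wf_ntm M" "ready M w p d"
  shows "tb (walkP M ans) d ((cost (moveP M ans) + 30) * (length p + 1))"
proof -
  obtain g where g: "home g" "snd (g 6) = 0" "g 5 = (encl p, 0)" "\<And>e. (d, e) \<in> sem (startP M) \<longleftrightarrow> e = g"
    by (rule sem_startP[OF assms(2)]) (rule that)
  have p: "set p \<subseteq> symbols M" using assms(2) by (simp add: ready_def)
  let ?c = "cost (moveP M ans)"
  have star: "tb (Star (moveP M ans)) g ((length p + 1) * (?c + 1))"
    using Star_moveP(2)[OF assms(1) g(1-3) p] .
  have "tb (walkP M ans) d (Suc (cost (startP M) + Suc ((length p + 1) * (?c + 1) + Suc (1 + 1))))"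
    unfolding walkP_def
  proof (intro tb_seqs_Cons)
    show "tb (startP M) d (cost (startP M))" by (rule tb_loopfree) (simp add: startP_def)
    show "tb (Star (moveP M ans)) e ((length p + 1) * (?c + 1))" if "(d, e) \<in> sem (startP M)" for e
      using star that g(4) by simp
  qed auto
  then show ?thesis by (rule tb_mono) (simp add: algebra_simps startP_def)
qed

section \<open>Verifying the recorded query\<close>

definition copyP :: prog where
  "copyP = seqs [chos [seqs [Op (Wr 6 1 1), Op (Wr 2 0 1)], seqs [Op (Wr 6 2 2), Op (Wr 2 0 2)]], Op (Mr 6), Op (Mr 2)]"

text \<open>A decider expects its argument alone on the source tape, while the recorded oracle tape
  may carry other symbols around the query. So the query is first copied to a clean tape.\<close>

definition verP :: "(nat \<Rightarrow> prog) \<Rightarrow> prog" where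
  "verP P = seqs [Op (Cp 2 1 1), Star copyP, Op (Ne 6 1), Op (Ne 6 2), P 2]"

text \<open>A blank at some position \<open>F\<close> guarantees that the \<open>LEAST\<close> in
  \<open>query_word\<close> is attained, and bounds it.\<close>

lemma query_word_props:
  assumes "t (int F) = 0"
  shows "length (query_word t) \<le> F"
    and "i < length (query_word t) \<Longrightarrow> t (int i) = (if query_word t ! i then 2 else 1)"
    and "t (int (length (query_word t))) \<notin> {1, 2}"
proof -
  let ?P = "\<lambda>k. t (int k) \<notin> {1, 2}"
  have P: "?P F" using assms by simp
  have l: "length (query_word t) = (LEAST k. ?P k)" by (simp add: query_word_def)
  show "length (query_word t) \<le> F" unfolding l using P by (rule Least_le)
  show "t (int (length (query_word t))) \<notin> {1, 2}" unfolding l using P by (rule LeastI)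
  show "t (int i) = (if query_word t ! i then 2 else 1)" if "i < length (query_word t)"
    using that not_less_Least[of i ?P] unfolding l by (auto simp: query_word_def)
qed

lemma sem_copyP:
  assumes "rd d 2 = 0"
  shows "(d, e) \<in> sem copyP \<longleftrightarrow> rd d 6 \<in> {1, 2} \<and>
    e = d(2 := ((fst (d 2))(snd (d 2) := rd d 6), snd (d 2) + 1), 6 := (fst (d 6), snd (d 6) + 1))"
proof -
  have "(d, e) \<in> sem (seqs [Op (Wr 6 x x), Op (Wr 2 0 x)]) \<longleftrightarrow> rd d 6 = x \<and> e = wr d 2 x" for e x
    using assms by (auto simp: sem_iffs wr_rd' simp del: seqs.simps sem.simps)
  note one = this
  have two: "(d, f) \<in> sem (chos [seqs [Op (Wr 6 1 1), Op (Wr 2 0 1)], seqs [Op (Wr 6 2 2), Op (Wr 2 0 2)]]) \<longleftrightarrow>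
      rd d 6 \<in> {1, 2} \<and> f = wr d 2 (rd d 6)" for f
    unfolding sem_chos using one[of f 1] one[of f 2] by (auto simp del: seqs.simps sem.simps)
  have eq: "(wr d 2 x)(6 := (fst (wr d 2 x 6), snd (wr d 2 x 6) + 1),
        2 := (fst (((wr d 2 x)(6 := (fst (wr d 2 x 6), snd (wr d 2 x 6) + 1))) 2),
          snd (((wr d 2 x)(6 := (fst (wr d 2 x 6), snd (wr d 2 x 6) + 1))) 2) + 1)) =
      d(2 := ((fst (d 2))(snd (d 2) := x), snd (d 2) + 1), 6 := (fst (d 6), snd (d 6) + 1))" for x
    by (rule ext) (simp add: wr_def)
  show ?thesis
    unfolding copyP_def sem_seqs_Cons[of _ _ "chos _"] two
    by (simp only: sem_iffs) (use eq in auto)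
qed

lemma copy_star:
  assumes "d 2 = ((\<lambda>_. 0), 0)" "d 6 = (t, 0)" "t (int F) = 0"
  shows "(d, e) \<in> sem (Star copyP) \<longleftrightarrow> (\<exists>i\<le>length (query_word t).
    e = d(2 := (enc (take i (query_word t)), int i), 6 := (t, int i)))"
    and "tb (Star copyP) d ((length (query_word t) + 1) * (cost copyP + 1))"
proof -
  let ?q = "query_word t"
  let ?f = "\<lambda>i. d(2 := (enc (take i ?q), int i), 6 := (t, int i))"
  have st: "(?f i, e) \<in> sem copyP \<longleftrightarrow> i < length ?q \<and> True \<and> e = ?f (Suc i)" if i: "i \<le> length ?q" for i e
  proof -
    have r2: "rd (?f i) 2 = 0" using i by (simp add: rd_def enc_nat)
    have r6: "rd (?f i) 6 = t (int i)" by (simp add: rd_def)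
    have c: "t (int i) \<in> {1, 2} \<longleftrightarrow> i < length ?q"
      using query_word_props(2,3)[of t F, OF assms(3)] i by (metis insertI1 insertI2 le_neq_implies_less singletonI)
    have u: "(enc (take i ?q))(int i := t (int i)) = enc (take (Suc i) ?q)" if "i < length ?q"
      using enc_take_Suc[OF that] query_word_props(2)[of t F i, OF assms(3) that] by simp
    show ?thesis unfolding sem_copyP[OF r2] r6 c using u
      by (auto simp: fun_eq_iff)
  qed
  have f0: "?f 0 = d" using assms(1,2) by (auto simp: enc_def fun_eq_iff)
  show "(d, e) \<in> sem (Star copyP) \<longleftrightarrow> (\<exists>i\<le>length ?q. e = ?f i)"
    using Star_chain(1)[of "length ?q" ?f, OF st, of e] unfolding f0 by simp
  have "loopfree copyP" by (simp add: copyP_def)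
  then show "tb (Star copyP) d ((length ?q + 1) * (cost copyP + 1))"
    using Star_chain(2)[of "length ?q" ?f, OF st tb_loopfree] unfolding f0 by simp
qed

text \<open>The two tests behind the loop fail on 1 and 2 and so force the copy to be complete. The
  arbitrary continuation \<open>ps\<close> makes the fact usable both for the meaning of
  \<open>verP\<close> and for its running time.\<close>

lemma ver_pre:
  assumes "home d" "d 6 = (t, 0)" "t (int F) = 0"
  shows "(d, e) \<in> sem (seqs (Op (Cp 2 1 1) # Star copyP # Op (Ne 6 1) # Op (Ne 6 2) # ps)) \<longleftrightarrow>
    (d(2 := (enc (query_word t), int (length (query_word t))), 6 := (t, int (length (query_word t)))), e)
       \<in> sem (seqs ps)"
proof -
  let ?q = "query_word t"
  let ?d = "d(2 := ((\<lambda>_. 0), 0))"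
  let ?f = "\<lambda>i. ?d(2 := (enc (take i ?q), int i), 6 := (t, int i))"
  have d6: "?d 6 = (t, 0)" using assms(2) by simp
  have "(d, e) \<in> sem (seqs (Op (Cp 2 1 1) # Star copyP # Op (Ne 6 1) # Op (Ne 6 2) # ps)) \<longleftrightarrow>
    (\<exists>f. (?d, f) \<in> sem (Star copyP) \<and> rd f 6 \<notin> {1, 2} \<and> (f, e) \<in> sem (seqs ps))"
    using assms(1) by (auto simp: sem_iffs home_def simp del: seqs.simps sem.simps)
  also have "\<dots> \<longleftrightarrow> (\<exists>i\<le>length ?q. rd (?f i) 6 \<notin> {1, 2} \<and> (?f i, e) \<in> sem (seqs ps))"
    unfolding copy_star(1)[of ?d t F, OF fun_upd_same d6 assms(3)] by blast
  also have "\<dots> \<longleftrightarrow> (?f (length ?q), e) \<in> sem (seqs ps)"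
  proof -
    have r: "rd (?f i) 6 = t (int i)" for i by (simp add: rd_def)
    have c: "t (int i) \<notin> {1, 2} \<longleftrightarrow> i = length ?q" if "i \<le> length ?q" for i
      using query_word_props(2,3)[of t F, OF assms(3)] that by (metis insertI1 insertI2 le_neq_implies_less singletonI)
    show ?thesis unfolding r using c by (metis order.refl)
  qed
  finally show ?thesis by simp
qed

lemma verP_props:
  assumes d: "home d" "d 6 = (t, 0)" "t (int F) = 0" and P: "decider A P T"
  shows "(\<exists>e. (d, e) \<in> sem (verP P)) \<longleftrightarrow> query_word t \<in> A"
    and "(d, e) \<in> sem (verP P) \<Longrightarrow> agree {2, 3, 4, 6, 7} d e"
    and "tb (verP P) d ((cost copyP + 20) * (F + T F + 1))"
proof -
  let ?q = "query_word t"
  let ?l = "length ?q"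
  let ?d1 = "d(2 := ((\<lambda>_. 0), 0))"
  let ?d = "d(2 := (enc ?q, int ?l), 6 := (t, int ?l))"
  have *: "(d, e) \<in> sem (verP P) \<longleftrightarrow> (?d, e) \<in> sem (P 2)" for e
    unfolding verP_def ver_pre[OF d] by (simp only: sem_seqs_Cons sem_seqs_Nil) blast
  have h: "home ?d" "fst (?d 2) = enc ?q" using d(1) by (simp_all add: home_def)
  show "(\<exists>e. (d, e) \<in> sem (verP P)) \<longleftrightarrow> ?q \<in> A"
    unfolding * by (rule deciderD(3)[OF P h]) simp
  show "agree {2, 3, 4, 6, 7} d e" if "(d, e) \<in> sem (verP P)"
    using deciderD(4)[OF P, of ?d 2 ?q e, OF h] that unfolding * by (auto simp: agree_def)
  have cs: "tb (Star copyP) ?d1 ((?l + 1) * (cost copyP + 1))"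
    by (rule copy_star(2)[of ?d1 t F]) (use d in auto)
  have "tb (verP P) d (Suc (1 + Suc ((?l + 1) * (cost copyP + 1) + Suc (1 + Suc (1 + Suc (T ?l + 1))))))"
    unfolding verP_def
  proof (intro tb_seqs_Cons)
    fix e1 e2 e3 e4
    assume 1: "(d, e1) \<in> sem (Op (Cp 2 1 1))"
    then show "tb (Star copyP) e1 ((?l + 1) * (cost copyP + 1))" using cs d(1) by (auto simp: home_def)
    assume "(e1, e2) \<in> sem (Star copyP)" "(e2, e3) \<in> sem (Op (Ne 6 1))" "(e3, e4) \<in> sem (Op (Ne 6 2))"
    with 1 have "(d, e4) \<in> sem (seqs [Op (Cp 2 1 1), Star copyP, Op (Ne 6 1), Op (Ne 6 2)])"
      unfolding sem_seqs_Cons sem_seqs_Nil by blast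
    then have e4: "e4 = ?d" unfolding ver_pre[OF d] sem_seqs_Nil .
    show "tb (P 2) e4 (T ?l)"
      unfolding e4 by (rule deciderD(5)[OF P h]) simp
  qed auto
  then have "tb (verP P) d ((cost copyP + 20) * (?l + T ?l + 1))"
    by (rule tb_mono) (simp add: algebra_simps)
  moreover have "?l \<le> F" using query_word_props(1)[of t F, OF d(3)] .
  then have "?l + T ?l + 1 \<le> F + T F + 1" using monoD[OF deciderD(1)[OF P]] by (simp add: add_mono)
  ultimately show "tb (verP P) d ((cost copyP + 20) * (F + T F + 1))"
    by (elim tb_mono) (rule mult_le_mono2)
qed

text \<open>The oracle head moves at most one cell per symbol of the path. Hence a recorded query is
  no longer than the path, whichever answer is assumed, and the decider is called on words of
  polynomial length.\<close>

lemma fold_act_bound: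
  assumes "wf_ntm M" "fold (act M ans) p (init M w, \<lambda>_. 0) = (c, t)"
  shows "hd2 c \<le> int (length p) \<and> (\<forall>i\<ge>int (length p). tp2 c i = 0 \<and> t i = 0) \<and> nq c \<le> 1"
  using assms(2)
proof (induction p arbitrary: c t rule: rev_induct)
  case Nil
  then show ?case by (auto simp: init_def)
next
  case (snoc x p)
  obtain c' t' where ct: "fold (act M ans) p (init M w, \<lambda>_. 0) = (c', t')" by fastforce
  have IH: "hd2 c' \<le> int (length p)" "\<forall>i\<ge>int (length p). tp2 c' i = 0 \<and> t' i = 0" "nq c' \<le> 1"
    using snoc.IH[OF ct] by auto
  have st: "act M ans x (c', t') = (c, t)" using snoc.prems ct by simp
  consider \<tau> where "dirs \<tau>" "c = app \<tau> c'" "t = t'" | "c = query_conf M ans c'" "t = tp2 c'" | "c = c'" "t = t'"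
  proof -
    have "dirs (trs M ! (x - 1))" if "1 \<le> x" "x \<le> length (trs M)"
      using trs_nth[OF assms(1)] that by blast
    then show thesis using st that unfolding act_def by (auto split: if_splits)
  qed
  then show ?case
  proof cases
    case 1
    then show ?thesis using IH by (cases \<tau> rule: dirs.cases) auto
  qed (use IH in \<open>auto simp: query_conf_def\<close>)
qed

section \<open>Quantification over paths\<close>

text \<open>Paths are enumerated as the numbers with digits \<open>1..E\<close>, least significant digit first.\<close>

definition carryP :: "nat \<Rightarrow> prog" where
  "carryP E = seqs [Op (Wr 5 E 1), Op (Mr 5)]"

definition incP :: "nat \<Rightarrow> prog" where
  "incP E = seqs [Op (Cp 5 5 1), Star (carryP E), chos (map (\<lambda>x. Op (Wr 5 x (Suc x))) [1..<E])]"

definition overP :: "nat \<Rightarrow> prog" where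
  "overP E = seqs [Op (Cp 5 5 1), Star (carryP E), Op (Wr 5 0 0)]"

text \<open>The odometer step: the leading digits \<open>E\<close> wrap around to 1 and the digit
  behind them goes up. It is impossible exactly when all digits are \<open>E\<close>.\<close>

definition nxt :: "nat \<Rightarrow> nat list \<Rightarrow> nat list \<Rightarrow> bool" where
  "nxt E p p' \<longleftrightarrow> (\<exists>i<length p. take i p = replicate i E \<and> p ! i \<in> {1..<E} \<and>
     p' = replicate i 1 @ Suc (p ! i) # drop (Suc i) p)"

lemma encl_upd:
  assumes "i < length p"
  shows "(encl (replicate i 1 @ drop i p))(int i := x) = encl (replicate i 1 @ x # drop (Suc i) p)"
proof
  fix z
  show "((encl (replicate i 1 @ drop i p))(int i := x)) z = encl (replicate i 1 @ x # drop (Suc i) p) z"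
  proof (cases "z = int i")
    case True
    then show ?thesis using assms by (simp add: encl_def nth_append)
  next
    case False
    then show ?thesis using assms
      by (auto simp: encl_def nth_append nth_Cons nat_less_iff split: nat.splits)
         (auto simp: Suc_diff_le[symmetric] le_nat_iff intro!: arg_cong[where f = "(!) p"])
  qed
qed

lemma carry_star:
  assumes "fst (d 5) = encl p" "0 < E"
  shows "(d(5 := (encl p, 0)), e) \<in> sem (Star (carryP E)) \<longleftrightarrow>
    (\<exists>i\<le>length p. take i p = replicate i E \<and> e = d(5 := (encl (replicate i 1 @ drop i p), int i)))"
    and "tb (Star (carryP E)) (d(5 := (encl p, 0))) ((length p + 1) * (cost (carryP E) + 1))"
proof -
  let ?f = "\<lambda>i. d(5 := (encl (replicate i 1 @ drop i p), int i))"
  have rd: "rd (?f i) 5 = (if i < length p then p ! i else 0)" if "i \<le> length p" for i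
    using that by (auto simp: rd_def encl_nat nth_append)
  have st: "(?f i, e) \<in> sem (carryP E) \<longleftrightarrow> i < length p \<and> p ! i = E \<and> e = ?f (Suc i)" if i: "i \<le> length p" for i e
  proof -
    have "(?f i, e) \<in> sem (carryP E) \<longleftrightarrow> rd (?f i) 5 = E \<and> e = d(5 := ((encl (replicate i 1 @ drop i p))(int i := 1), int i + 1))"
      by (simp add: carryP_def sem_iffs wr_def del: seqs.simps sem.simps)
    moreover have "(encl (replicate i 1 @ drop i p))(int i := 1) = encl (replicate (Suc i) 1 @ drop (Suc i) p)" if "i < length p"
      using encl_upd[OF that, of 1] by (simp add: replicate_append_same[symmetric] del: replicate.simps) (simp add: replicate_app_Cons_same)
    ultimately show ?thesis using rd[OF i] assms(2) by (auto simp: add.commute)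
  qed
  have t: "take i p = replicate i E \<longleftrightarrow> (\<forall>j<i. p ! j = E)" if "i \<le> length p" for i
    using that by (auto simp: list_eq_iff_nth_eq)
  have f0: "?f 0 = d(5 := (encl p, 0))" by simp
  show "(d(5 := (encl p, 0)), e) \<in> sem (Star (carryP E)) \<longleftrightarrow>
    (\<exists>i\<le>length p. take i p = replicate i E \<and> e = ?f i)"
    using Star_chain(1)[of "length p" ?f, OF st, of e] t unfolding f0 by blast
  have "loopfree (carryP E)" by (simp add: carryP_def)
  then show "tb (Star (carryP E)) (d(5 := (encl p, 0))) ((length p + 1) * (cost (carryP E) + 1))"
    using Star_chain(2)[of "length p" ?f, OF st tb_loopfree] unfolding f0 by simp
qed

text \<open>The carry loop may stop early, but then it stands on a digit \<open>E\<close>, which the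
  tests behind it refuse; only the complete carry survives. In \<open>overP\<close> the required 0
  is found only behind the last digit, because no digit is 0.\<close>

lemma inc_sem:
  assumes "home d" "fst (d 5) = encl p" "0 < E" "0 \<notin> set p"
  shows "(d, e) \<in> sem (incP E) \<Longrightarrow> \<exists>p'. nxt E p p' \<and> fst (e 5) = encl p' \<and> agree {5} d e"
    and "nxt E p p' \<Longrightarrow> \<exists>e. (d, e) \<in> sem (incP E) \<and> fst (e 5) = encl p' \<and> agree {5} d e"
    and "(\<exists>e. (d, e) \<in> sem (overP E)) \<longleftrightarrow> p = replicate (length p) E"
proof -
  let ?f = "\<lambda>i. d(5 := (encl (replicate i 1 @ drop i p), int i))"
  have rd: "rd (?f i) 5 = (if i < length p then p ! i else 0)" if "i \<le> length p" for i
    using that by (auto simp: rd_def encl_nat nth_append)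
  have d5: "d(5 := (fst (d 5), snd (d 1))) = d(5 := (encl p, 0))" using assms by (simp add: home_def)
  have w: "wr (?f i) 5 x = d(5 := (encl (replicate i 1 @ x # drop (Suc i) p), int i))" if "i < length p" for i x
    using encl_upd[OF that, of x] by (simp add: wr_def)
  have ch: "(f, e) \<in> sem (chos (map (\<lambda>x. Op (Wr 5 x (Suc x))) [1..<E])) \<longleftrightarrow> rd f 5 \<in> {1..<E} \<and> e = wr f 5 (Suc (rd f 5))" for f e
    by auto
  have inc: "(d, e) \<in> sem (incP E) \<longleftrightarrow> (\<exists>i\<le>length p. take i p = replicate i E \<and>
      rd (?f i) 5 \<in> {1..<E} \<and> e = wr (?f i) 5 (Suc (rd (?f i) 5)))" for e
    unfolding incP_def sem_seqs_Cons sem_seqs_Nil sem_Op opsem.simps ch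
    by (simp only: d5 simp_thms carry_star(1)[of d p E, OF assms(2,3)] ex_simps) blast
  have over: "(d, e) \<in> sem (overP E) \<longleftrightarrow> (\<exists>i\<le>length p. take i p = replicate i E \<and>
      rd (?f i) 5 = 0 \<and> e = wr (?f i) 5 0)" for e
    unfolding overP_def sem_seqs_Cons sem_seqs_Nil sem_Op opsem.simps
    by (simp only: d5 simp_thms carry_star(1)[of d p E, OF assms(2,3)] ex_simps) blast
  {
    assume "(d, e) \<in> sem (incP E)"
    then obtain i where i: "i \<le> length p" "take i p = replicate i E" "rd (?f i) 5 \<in> {1..<E}"
      "e = wr (?f i) 5 (Suc (rd (?f i) 5))" unfolding inc by blast
    have l: "i < length p" using i rd[of i] by (auto split: if_splits)
    have "e = d(5 := (encl (replicate i 1 @ Suc (p ! i) # drop (Suc i) p), int i))"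
      using i(4) w[OF l] rd[of i] l by simp
    moreover have "p ! i \<in> {1..<E}" using i(3) rd[of i] l by simp
    ultimately show "\<exists>p'. nxt E p p' \<and> fst (e 5) = encl p' \<and> agree {5} d e"
      using i l unfolding nxt_def agree_def by auto
  }
  {
    assume "nxt E p p'"
    then obtain i where i: "i < length p" "take i p = replicate i E" "p ! i \<in> {1..<E}"
      "p' = replicate i 1 @ Suc (p ! i) # drop (Suc i) p" unfolding nxt_def by blast
    let ?e = "d(5 := (encl p', int i))"
    have "rd (?f i) 5 = p ! i" using rd[of i] i by simp
    then have "(d, ?e) \<in> sem (incP E)" unfolding inc using i w[OF i(1)] by (intro exI[of _ i]) simp
    then show "\<exists>e. (d, e) \<in> sem (incP E) \<and> fst (e 5) = encl p' \<and> agree {5} d e"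
      by (intro exI[of _ ?e]) (simp add: agree_def)
  }
  show "(\<exists>e. (d, e) \<in> sem (overP E)) \<longleftrightarrow> p = replicate (length p) E"
  proof
    assume "\<exists>e. (d, e) \<in> sem (overP E)"
    then obtain i where i: "i \<le> length p" "take i p = replicate i E" "rd (?f i) 5 = 0" unfolding over by blast
    have "i = length p"
    proof (rule ccontr)
      assume "i \<noteq> length p"
      then have l: "i < length p" using i by simp
      then have "p ! i = 0" using i rd[of i] by simp
      then show False using nth_mem[OF l] assms(4) by simp
    qed
    then show "p = replicate (length p) E" using i by simp
  next
    assume "p = replicate (length p) E"
    then show "\<exists>e. (d, e) \<in> sem (overP E)" unfolding over using rd[of "length p"]
      by (intro exI[of _ "wr (?f (length p)) 5 0"] exI[of _ "length p"]) simp
  qed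
qed

lemma counter_tb:
  assumes "home d" "fst (d 5) = encl p" "0 < E"
  shows "tb (incP E) d ((cost (incP E) + cost (carryP E) + 10) * (length p + 1))"
    and "tb (overP E) d ((cost (incP E) + cost (carryP E) + 10) * (length p + 1))"
proof -
  let ?c = "chos (map (\<lambda>x. Op (Wr 5 x (Suc x))) [1..<E])"
  let ?s = "(length p + 1) * (cost (carryP E) + 1)"
  have e: "tb (Star (carryP E)) e ?s" if "(d, e) \<in> sem (Op (Cp 5 5 1))" for e
  proof -
    have "e = d(5 := (encl p, 0))" using that assms by (simp add: home_def)
    then show ?thesis using carry_star(2)[of d p E, OF assms(2,3)] by simp
  qed
  have "tb (incP E) d (Suc (1 + Suc (?s + Suc (cost ?c + 1))))"
    unfolding incP_def
  proof (intro tb_seqs_Cons e)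
    show "tb ?c f (cost ?c)" for f by (rule tb_loopfree) auto
  qed auto
  moreover have "cost (incP E) = Suc (1 + Suc (1 + Suc (cost ?c + 1)))" by (simp add: incP_def)
  ultimately show "tb (incP E) d ((cost (incP E) + cost (carryP E) + 10) * (length p + 1))"
    by (elim tb_mono) (simp add: algebra_simps)
  have "tb (overP E) d (Suc (1 + Suc (?s + Suc (1 + 1))))"
    unfolding overP_def by (intro tb_seqs_Cons e) auto
  then show "tb (overP E) d ((cost (incP E) + cost (carryP E) + 10) * (length p + 1))"
    by (rule tb_mono) (simp add: algebra_simps)
qed

text \<open>The place of a path in the enumeration, counted from 0: base \<open>E\<close> with the
  digits shifted down by one.\<close>

fun val :: "nat \<Rightarrow> nat list \<Rightarrow> nat" where
  "val E [] = 0"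
| "val E (x # xs) = (x - 1) + E * val E xs"

lemma val_carry: "0 < E \<Longrightarrow> 0 < x \<Longrightarrow> val E (replicate i 1 @ Suc x # ys) = Suc (val E (replicate i E @ x # ys))"
  by (induction i) (auto simp: algebra_simps)

lemma nxt_props:
  assumes "nxt E p p'" "set p \<subseteq> {1..E}" "0 < E"
  shows "val E p' = Suc (val E p)" "length p' = length p" "set p' \<subseteq> {1..E}"
proof -
  obtain i where i: "i < length p" "take i p = replicate i E" "p ! i \<in> {1..<E}"
    "p' = replicate i 1 @ Suc (p ! i) # drop (Suc i) p" using assms(1) unfolding nxt_def by blast
  have "p = replicate i E @ p ! i # drop (Suc i) p" using id_take_nth_drop[OF i(1)] i(2) by simp
  then show "val E p' = Suc (val E p)" using val_carry[of E "p ! i" i "drop (Suc i) p"] i assms(3) by simp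
  show "length p' = length p" using i by simp
  show "set p' \<subseteq> {1..E}" using i assms(2,3) by (auto dest: in_set_dropD)
qed

lemma nxt_exists:
  assumes "set p \<subseteq> {1..E}" "p \<noteq> replicate (length p) E"
  shows "\<exists>p'. nxt E p p'"
proof -
  define i where "i = length (takeWhile ((=) E) p)"
  have t: "take i p = takeWhile ((=) E) p" unfolding i_def by (simp add: takeWhile_eq_take[symmetric])
  have "\<forall>x\<in>set (take i p). x = E" unfolding t using set_takeWhileD by fastforce
  moreover have li: "i \<le> length p" unfolding i_def by (rule length_takeWhile_le)
  ultimately have r: "take i p = replicate i E" using replicate_length_same[of "take i p" E] by simp
  have l: "i < length p"
  proof (rule ccontr)
    assume "\<not> i < length p"
    then have "i = length p" using li by simp
    then show False using r assms(2) by simp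
  qed
  have "p ! i \<noteq> E" using nth_length_takeWhile[of "(=) E" p] l unfolding i_def by metis
  moreover have "p ! i \<in> {1..E}" using assms(1) nth_mem[OF l] by blast
  ultimately show ?thesis using l r unfolding nxt_def by auto
qed

lemma val_replicate: "0 < E \<Longrightarrow> Suc (val E (replicate n E)) = E ^ n"
proof (induction n)
  case (Suc n)
  have "Suc (val E (replicate (Suc n) E)) = E + E * val E (replicate n E)" using Suc.prems by simp
  also have "\<dots> = E * Suc (val E (replicate n E))" by simp
  finally show ?case using Suc by simp
qed simp

lemma val_less: "set p \<subseteq> {1..E} \<Longrightarrow> 0 < E \<Longrightarrow> val E p < E ^ length p"
proof (induction p)
  case (Cons x p)
  have "val E (x # p) < E + E * val E p" using Cons.prems by auto
  also have "\<dots> = E * Suc (val E p)" by simp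
  also have "\<dots> \<le> E * E ^ length p" using Cons by (intro mult_le_mono) auto
  finally show ?case by simp
qed simp

text \<open>Reduction modulo \<open>E\<close> recovers the first digit, and cancelling
  \<open>E\<close> leaves the values of the tails.\<close>

lemma val_inj:
  "set p \<subseteq> {1..E} \<Longrightarrow> set q \<subseteq> {1..E} \<Longrightarrow> length p = length q \<Longrightarrow> val E p = val E q \<Longrightarrow> p = q"
proof (induction p arbitrary: q)
  case (Cons x p)
  then obtain y q' where q: "q = y # q'" by (cases q) auto
  have x: "x - 1 < E" "y - 1 < E" "1 \<le> x" "1 \<le> y" using Cons.prems q by auto
  have e: "(x - 1) + E * val E p = (y - 1) + E * val E q'" using Cons.prems(4) q by simp
  have m: "((x - 1) + E * val E p) mod E = x - 1" "((y - 1) + E * val E q') mod E = y - 1"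
    using mod_less[OF x(1)] mod_less[OF x(2)] by (simp_all only: mod_mult_self2)
  have xy: "x - 1 = y - 1" by (rule trans[OF m(1)[unfolded e, symmetric] m(2)])
  have "E * val E p = E * val E q'" using e[unfolded xy] by (simp only: add_left_cancel)
  then have "val E p = val E q'" using x(1) by simp
  then show ?case using Cons xy x q by auto
qed simp

text \<open>\<open>accept_ok\<close> has to hold for some path and certifies acceptance without query or with answer yes;
a path violating \<open>reject_ok\<close> certifies acceptance with answer no. Both ask only for membership of
the query in \<open>A\<close>, never for non-membership.\<close>

definition paths :: "ntm \<Rightarrow> nat \<Rightarrow> nat list set" where
  "paths M n = {p. set p \<subseteq> symbols M \<and> length p = n}"

definition reject_ok :: "ntm \<Rightarrow> bool list set \<Rightarrow> bool list \<Rightarrow> nat list \<Rightarrow> bool" where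
  "reject_ok M A w p \<longleftrightarrow> (case outcome M False w p of (c, t) \<Rightarrow>
     cstate c = acc M \<and> nq c = 1 \<longrightarrow> query_word t \<in> A)"

definition accept_ok :: "ntm \<Rightarrow> bool list set \<Rightarrow> bool list \<Rightarrow> nat list \<Rightarrow> bool" where
  "accept_ok M A w p \<longleftrightarrow> (case outcome M True w p of (c, t) \<Rightarrow>
     cstate c = acc M \<and> (nq c = 0 \<or> nq c = 1 \<and> query_word t \<in> A))"

text \<open>The implication in \<open>reject_ok\<close> written as a choice. The alternatives may
  overlap; this is harmless, as each of them preserves the input and the path.\<close>

definition bodyP :: "ntm \<Rightarrow> (nat \<Rightarrow> prog) \<Rightarrow> prog" where
  "bodyP M P = Seq (walkP M False) (Cho (Op (Ne 4 (acc M))) (Cho (Op (Ne 7 1)) (verP P)))"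

definition roundP :: "ntm \<Rightarrow> (nat \<Rightarrow> prog) \<Rightarrow> prog" where
  "roundP M P = Seq (bodyP M P) (incP (nsym M))"

text \<open>With the single symbol 1, \<open>fuelP\<close> has no choice and writes the first path
  of the enumeration. The last path is checked outside the loop because it has no successor;
  \<open>overP\<close> makes sure that it really is the last.\<close>

definition forallP :: "ntm \<Rightarrow> (nat \<Rightarrow> prog) \<Rightarrow> nat \<Rightarrow> prog" where
  "forallP M P k = seqs [fuelP [1] k, Star (roundP M P), bodyP M P, overP (nsym M)]"

definition existsP :: "ntm \<Rightarrow> (nat \<Rightarrow> prog) \<Rightarrow> nat \<Rightarrow> prog" where
  "existsP M P k = seqs [fuelP [1..<nsym M + 1] k, walkP M True, Op (Wr 4 (acc M) (acc M)),
     Cho (Op (Wr 7 0 0)) (seqs [Op (Wr 7 1 1), verP P])]"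

section \<open>Both path quantifiers in nondeterministic exponential time\<close>

locale simulation =
  fixes M :: ntm and A :: "bool list set" and P :: "nat \<Rightarrow> prog" and T :: "nat \<Rightarrow> nat" and k :: nat
  assumes M: "wf_ntm M" and P: "decider A P T"
begin

lemma walk_end:
  assumes "ready M w p d"
  obtains e c t where "\<And>e'. (d, e') \<in> sem (walkP M ans) \<longleftrightarrow> e' = e" "outcome M ans w p = (c, t)"
    "rd e 4 = cstate c" "rd e 7 = nq c" "e 6 = (t, 0)" "home e" "agree {2, 3, 4, 6, 7} d (e(5 := d 5))"
    "fst (e 5) = encl p" "t (int (length p)) = 0" "nq c \<le> 1"
proof -
  obtain e where e: "\<And>e'. (d, e') \<in> sem (walkP M ans) \<longleftrightarrow> e' = e" "view e = outcome M ans w p"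
    "agree {2, 3, 4, 5, 6, 7} d e" "fst (e 5) = encl p" "snd (e 6) = 0" "home e"
    by (rule sem_walkP[OF M assms]) (rule that)
  obtain c t where ct: "outcome M ans w p = (c, t)" by fastforce
  have b: "t (int (length p)) = 0" "nq c \<le> 1"
    using fold_act_bound[OF M ct[unfolded outcome_def]] by auto
  have v: "conf_of e = c" "fst (e 6) = t" using e(2) ct by (auto simp: view_def)
  show thesis
  proof (rule that[of e c t])
    show "rd e 4 = cstate c" "rd e 7 = nq c" using v(1) by (auto simp: conf_of_def)
    show "e 6 = (t, 0)" using v(2) e(5) by (simp add: prod_eq_iff)
    show "agree {2, 3, 4, 6, 7} d (e(5 := d 5))" using e(3) by (auto simp: agree_def)
  qed (use e ct b in auto)
qed

lemma agree_ready:
  assumes "ready M w p d" "agree {2, 3, 4, 6, 7} e f" "home e" "fst (e 0) = fst (d 0)" "fst (e 5) = encl p"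
  shows "ready M w p f"
  using assms by (auto simp: ready_def agree_def home_def)

lemma body_sem:
  assumes "ready M w p d"
  shows "(\<exists>e. (d, e) \<in> sem (bodyP M P)) \<longleftrightarrow> reject_ok M A w p"
    and "(d, e) \<in> sem (bodyP M P) \<Longrightarrow> ready M w p e"
proof -
  obtain e0 c t where e0: "\<And>e'. (d, e') \<in> sem (walkP M False) \<longleftrightarrow> e' = e0" "outcome M False w p = (c, t)"
    "rd e0 4 = cstate c" "rd e0 7 = nq c" "e0 6 = (t, 0)" "home e0" "agree {2, 3, 4, 6, 7} d (e0(5 := d 5))"
    "fst (e0 5) = encl p" "t (int (length p)) = 0" "nq c \<le> 1"
    by (rule walk_end[OF assms]) (rule that)
  have *: "(d, e) \<in> sem (bodyP M P) \<longleftrightarrow> (cstate c \<noteq> acc M \<and> e = e0) \<or> (nq c \<noteq> 1 \<and> e = e0) \<or> (e0, e) \<in> sem (verP P)" for e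
  proof -
    have "(d, e) \<in> sem (bodyP M P) \<longleftrightarrow> (e0, e) \<in> sem (Cho (Op (Ne 4 (acc M))) (Cho (Op (Ne 7 1)) (verP P)))"
      unfolding bodyP_def sem.simps(4) using e0(1) by (auto simp del: sem.simps)
    then show ?thesis unfolding sem_Cho sem_Op opsem.simps e0(3,4) by blast
  qed
  have v: "(\<exists>e. (e0, e) \<in> sem (verP P)) \<longleftrightarrow> query_word t \<in> A"
    by (rule verP_props(1)[OF e0(6,5,9) P])
  show "(\<exists>e. (d, e) \<in> sem (bodyP M P)) \<longleftrightarrow> reject_ok M A w p"
    unfolding * reject_ok_def e0(2) using v by auto
  have 0: "fst (e0 0) = fst (d 0)" using e0(7) by (auto simp: agree_def dest: spec[of _ 0])
  have "agree {2, 3, 4, 6, 7} e0 e" if "(d, e) \<in> sem (bodyP M P)"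
    using that verP_props(2)[OF e0(6,5,9) P] unfolding * by (auto simp: agree_def)
  then show "ready M w p e" if "(d, e) \<in> sem (bodyP M P)"
    using agree_ready[OF assms _ e0(6) 0 e0(8)] that by blast
qed

lemma E: "0 < nsym M" "symbols M = {1..nsym M}"
  by (auto simp: nsym_def symbols_def)

lemma ready_inc:
  assumes "ready M w p d" "agree {5} d e" "fst (e 5) = encl p'" "set p' \<subseteq> symbols M"
  shows "ready M w p' e"
  using assms by (auto simp: ready_def agree_def home_def)

lemma ready_no0: "ready M w p d \<Longrightarrow> 0 \<notin> set p"
  by (auto simp: ready_def symbols_def)

lemma ready_home: "ready M w p d \<Longrightarrow> home d \<and> fst (d 5) = encl p \<and> set p \<subseteq> {1..nsym M}"
  by (auto simp: ready_def symbols_def)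

lemma round:
  assumes "ready M w p d" "(d, f) \<in> sem (roundP M P)"
  shows "reject_ok M A w p \<and> (\<exists>p'. nxt (nsym M) p p' \<and> ready M w p' f)"
proof -
  obtain e where e: "(d, e) \<in> sem (bodyP M P)" "(e, f) \<in> sem (incP (nsym M))"
    using assms(2) by (auto simp: roundP_def)
  have r: "ready M w p e" using body_sem(2)[OF assms(1) e(1)] .
  obtain p' where p': "nxt (nsym M) p p'" "fst (f 5) = encl p'" "agree {5} e f"
    using inc_sem(1)[OF _ _ E(1) ready_no0[OF r] e(2)] ready_home[OF r] by blast
  have "set p' \<subseteq> symbols M" using nxt_props(3)[OF p'(1) _ E(1)] ready_home[OF r] unfolding E(2) by blast
  then have "ready M w p' f" using ready_inc[OF r p'(3,2)] by blast
  then show ?thesis using p'(1) body_sem(1)[OF assms(1)] e(1) by blast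
qed

text \<open>Generalised to all paths from the current one onwards. None is skipped because
  \<open>nxt\<close> raises \<open>val\<close> by exactly one, and the loop cannot be left early
  because \<open>overP\<close> succeeds only on the path of largest value.\<close>

lemma loop_sound:
  assumes "(d, e) \<in> (sem (roundP M P))\<^sup>*" "ready M w p d"
    "(e, f) \<in> sem (bodyP M P)" "(f, g) \<in> sem (overP (nsym M))"
    "p' \<in> paths M (length p)" "val (nsym M) p \<le> val (nsym M) p'"
  shows "reject_ok M A w p'"
  using assms(1,2,5,6)
proof (induction arbitrary: p rule: converse_rtrancl_induct)
  case base
  have r: "ready M w p f" using body_sem(2)[OF base(1) assms(3)] .
  have p: "p = replicate (length p) (nsym M)"
    using inc_sem(3)[OF _ _ E(1) ready_no0[OF r]] ready_home[OF r] assms(4) by blast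
  have p': "set p' \<subseteq> {1..nsym M}" "length p' = length p" using base(2) by (auto simp: paths_def symbols_def)
  have "val (nsym M) p' < Suc (val (nsym M) p)"
    using val_less[OF p'(1) E(1)] val_replicate[OF E(1), of "length p"] p p'(2) by metis
  then have "val (nsym M) p' = val (nsym M) p" using base(3) by simp
  then have "p' = p" using val_inj p' ready_home[OF r] by blast
  then show ?case using body_sem(1)[OF base(1)] assms(3) by blast
next
  case (step d h)
  from round[OF step.prems(1) step.hyps(1)] obtain p1 where
    p1: "reject_ok M A w p" "nxt (nsym M) p p1" "ready M w p1 h" by blast
  have s: "set p \<subseteq> {1..nsym M}" using ready_home[OF step.prems(1)] by blast
  note np = nxt_props[OF p1(2) s E(1)]
  show ?case
  proof (cases "val (nsym M) p' = val (nsym M) p")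
    case True
    have "set p' \<subseteq> {1..nsym M}" "length p' = length p" using step.prems(2) by (auto simp: paths_def symbols_def)
    then have "p' = p" using val_inj[OF _ s _ True] by blast
    then show ?thesis using p1 by simp
  next
    case False
    then show ?thesis using step.IH[OF p1(3)] step.prems(2,3) np by simp
  qed
qed

text \<open>Induction on the number of paths still ahead: the body can be passed on every path, and
  each path other than the last has a successor.\<close>

lemma loop_complete:
  assumes "ready M w p d" "\<And>p'. p' \<in> paths M (length p) \<Longrightarrow> reject_ok M A w p'"
  shows "\<exists>e f g. (d, e) \<in> (sem (roundP M P))\<^sup>* \<and>
    (e, f) \<in> sem (bodyP M P) \<and> (f, g) \<in> sem (overP (nsym M))"
  using assms
proof (induction "nsym M ^ length p - val (nsym M) p" arbitrary: p d rule: less_induct)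
  case less
  have s: "set p \<subseteq> {1..nsym M}" using ready_home[OF less.prems(1)] by blast
  have "p \<in> paths M (length p)" using s by (simp add: paths_def symbols_def)
  then obtain f where f: "(d, f) \<in> sem (bodyP M P)" using body_sem(1)[OF less.prems(1)] less.prems(2) by blast
  have r: "ready M w p f" using body_sem(2)[OF less.prems(1) f] .
  note h = ready_home[OF r]
  show ?case
  proof (cases "p = replicate (length p) (nsym M)")
    case True
    then have "\<exists>g. (f, g) \<in> sem (overP (nsym M))" using inc_sem(3)[OF _ _ E(1) ready_no0[OF r]] h by blast
    then show ?thesis using f by blast
  next
    case False
    then obtain p1 where p1: "nxt (nsym M) p p1" using nxt_exists[OF s] by blast
    obtain g where g: "(f, g) \<in> sem (incP (nsym M))" "fst (g 5) = encl p1" "agree {5} f g"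
      using inc_sem(2)[OF _ _ E(1) ready_no0[OF r] p1] h by blast
    note np = nxt_props[OF p1 s E(1)]
    have r1: "ready M w p1 g" using ready_inc[OF r g(3,2)] np(3) unfolding E(2) by blast
    have "val (nsym M) p1 < nsym M ^ length p1" using val_less[OF np(3) E(1)] .
    then have "nsym M ^ length p1 - val (nsym M) p1 < nsym M ^ length p - val (nsym M) p"
      using np by simp
    from less.hyps[OF this r1] less.prems(2) np(2) obtain e' f' g' where
      *: "(g, e') \<in> (sem (roundP M P))\<^sup>*" "(e', f') \<in> sem (bodyP M P)"
      "(f', g') \<in> sem (overP (nsym M))" by metis
    have "(d, g) \<in> sem (roundP M P)" using f g(1) by (auto simp: roundP_def)
    then show ?thesis using * by (meson converse_rtrancl_into_rtrancl)
  qed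
qed

lemma FS_ready: "FS w p d \<Longrightarrow> set p \<subseteq> symbols M \<Longrightarrow> ready M w p d"
  by (auto simp: FS_def ready_def)

lemma val_ones: "set p \<subseteq> {1} \<Longrightarrow> val E p = 0"
  by (induction p) auto

lemma forall_sem:
  "(\<exists>e. (d0 w, e) \<in> sem (forallP M P k)) \<longleftrightarrow> (\<forall>p\<in>paths M ((length w + 2) ^ k). reject_ok M A w p)"
proof
  assume "\<exists>e. (d0 w, e) \<in> sem (forallP M P k)"
  then obtain d e f g where *: "(d0 w, d) \<in> sem (fuelP [1] k)"
    "(d, e) \<in> (sem (roundP M P))\<^sup>*" "(e, f) \<in> sem (bodyP M P)" "(f, g) \<in> sem (overP (nsym M))"
    unfolding forallP_def sem_seqs_Cons sem.simps(6) by blast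
  obtain p where p: "set p \<subseteq> {1}" "length p = (length w + 2) ^ k" "FS w p d"
    using fuel_sound[OF FS_d0 *(1)] by auto
  have s: "set p \<subseteq> symbols M" using p(1) by (auto simp: symbols_def nsym_def)
  show "\<forall>p\<in>paths M ((length w + 2) ^ k). reject_ok M A w p"
    using loop_sound[OF *(2) FS_ready[OF p(3) s] *(3,4)] p(2) val_ones[OF p(1)] by simp
next
  assume a: "\<forall>p\<in>paths M ((length w + 2) ^ k). reject_ok M A w p"
  let ?p = "replicate ((length w + 2) ^ k) (1::nat)"
  obtain d where d: "(d0 w, d) \<in> sem (fuelP [1] k)" "FS w ([] @ ?p) d"
    using fuel_complete[OF FS_d0, of ?p "[1]" w k] by auto
  have s: "set ?p \<subseteq> symbols M" by (auto simp: symbols_def nsym_def)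
  have "ready M w ?p d" using FS_ready[OF _ s] d(2) by simp
  from loop_complete[OF this] a obtain e f g where
    "(d, e) \<in> (sem (roundP M P))\<^sup>*" "(e, f) \<in> sem (bodyP M P)" "(f, g) \<in> sem (overP (nsym M))"
    by auto
  then show "\<exists>e. (d0 w, e) \<in> sem (forallP M P k)"
    unfolding forallP_def sem_seqs_Cons sem_seqs_Nil sem.simps(6) using d(1) by blast
qed

lemma exists_sem:
  "(\<exists>e. (d0 w, e) \<in> sem (existsP M P k)) \<longleftrightarrow> (\<exists>p\<in>paths M ((length w + 2) ^ k). accept_ok M A w p)"
proof -
  let ?X = "[1..<nsym M + 1]"
  let ?rest = "[Op (Wr 4 (acc M) (acc M)), Cho (Op (Wr 7 0 0)) (seqs [Op (Wr 7 1 1), verP P])]"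
  have X: "set ?X = symbols M" by (auto simp: symbols_def)
  have main: "(\<exists>e. (d, e) \<in> sem (seqs (walkP M True # ?rest))) \<longleftrightarrow> accept_ok M A w p"
    if r: "ready M w p d" for d p
  proof -
    obtain e0 c t where e0: "\<And>e'. (d, e') \<in> sem (walkP M True) \<longleftrightarrow> e' = e0" "outcome M True w p = (c, t)"
      "rd e0 4 = cstate c" "rd e0 7 = nq c" "e0 6 = (t, 0)" "home e0" "agree {2, 3, 4, 6, 7} d (e0(5 := d 5))"
      "fst (e0 5) = encl p" "t (int (length p)) = 0" "nq c \<le> 1"
      by (rule walk_end[OF r]) (rule that)
    have w4: "opsem (Wr 4 (acc M) (acc M)) e0 f \<longleftrightarrow> cstate c = acc M \<and> f = e0" for f
      using wr_rd'[of e0 4 "acc M"] e0(3) by auto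
    have w7: "opsem (Wr 7 x x) e0 f \<longleftrightarrow> nq c = x \<and> f = e0" for f x
      using wr_rd'[of e0 7 x] e0(4) by auto
    have "(d, e) \<in> sem (seqs (walkP M True # ?rest)) \<longleftrightarrow>
        cstate c = acc M \<and> ((nq c = 0 \<and> e = e0) \<or> (nq c = 1 \<and> (e0, e) \<in> sem (verP P)))" for e
    proof -
      have "(d, e) \<in> sem (seqs (walkP M True # ?rest)) \<longleftrightarrow> cstate c = acc M \<and>
          (e0, e) \<in> sem (Cho (Op (Wr 7 0 0)) (seqs [Op (Wr 7 1 1), verP P]))"
        unfolding sem_seqs_Cons[of _ _ "walkP _ _"] sem_seqs_Cons[of _ _ "Op (Wr 4 _ _)"]
          sem_seqs_Cons[of _ _ "Cho _ _"] sem_seqs_Nil e0(1) sem_Op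
        by (auto simp: w4 simp del: sem.simps opsem.simps seqs.simps)
      moreover have "(e0, e) \<in> sem (Cho (Op (Wr 7 0 0)) (seqs [Op (Wr 7 1 1), verP P])) \<longleftrightarrow>
          (nq c = 0 \<and> e = e0) \<or> (nq c = 1 \<and> (e0, e) \<in> sem (verP P))"
        unfolding sem_Cho sem_seqs_Cons sem_seqs_Nil sem_Op w7 by blast
      ultimately show ?thesis by simp
    qed
    then show ?thesis
      unfolding accept_ok_def e0(2) using verP_props(1)[OF e0(6,5,9) P] by auto
  qed
  show ?thesis
  proof
    assume "\<exists>e. (d0 w, e) \<in> sem (existsP M P k)"
    then obtain d where d: "(d0 w, d) \<in> sem (fuelP ?X k)" "\<exists>e. (d, e) \<in> sem (seqs (walkP M True # ?rest))"
      unfolding existsP_def sem_seqs_Cons[of _ _ "fuelP _ _"] by blast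
    obtain p where p: "set p \<subseteq> symbols M" "length p = (length w + 2) ^ k" "FS w p d"
      using fuel_sound[OF FS_d0 d(1)] unfolding X by auto
    then show "\<exists>p\<in>paths M ((length w + 2) ^ k). accept_ok M A w p"
      using main[OF FS_ready[OF p(3,1)]] d(2) by (auto simp: paths_def)
  next
    assume "\<exists>p\<in>paths M ((length w + 2) ^ k). accept_ok M A w p"
    then obtain p where p: "set p \<subseteq> symbols M" "length p = (length w + 2) ^ k" "accept_ok M A w p"
      by (auto simp: paths_def)
    obtain d where d: "(d0 w, d) \<in> sem (fuelP ?X k)" "FS w ([] @ p) d"
      using fuel_complete[OF FS_d0, of p ?X w k] p unfolding X by blast
    then have "ready M w p d" using FS_ready p(1) by simp
    then show "\<exists>e. (d0 w, e) \<in> sem (existsP M P k)"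
      unfolding existsP_def sem_seqs_Cons[of _ _ "fuelP _ _"] using main p(3) d(1) by blast
  qed
qed

lemma exists_NEXP: "{w. \<exists>p\<in>paths M ((length w + 2) ^ k). accept_ok M A w p} \<in> NEXP"
proof -
  let ?X = "[1..<nsym M + 1]"
  let ?c = "cost (fuelP ?X 0)"
  let ?F = "\<lambda>n. (n + 2) ^ k"
  let ?W = "\<lambda>n. (cost (moveP M True) + 30) * (?F n + 1)"
  let ?V = "\<lambda>n. (cost copyP + 20) * (?F n + T (?F n) + 1)"
  have X: "set ?X = symbols M" by (auto simp: symbols_def)
  have "{w. \<exists>e. (d0 w, e) \<in> sem (existsP M P k)} \<in> NEXP"
  proof (rule NEXP_prog)
    fix w :: "bool list"
    let ?n = "length w"
    have "tb (existsP M P k) (d0 w) (Suc (ft ?c ?n k + Suc (?W ?n + Suc (1 + Suc (Suc (1 + Suc (1 + Suc (?V ?n + 1))) + 1)))))"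
      unfolding existsP_def
    proof (intro tb_seqs_Cons tb_Cho')
      show "tb (fuelP ?X k) (d0 w) (ft ?c ?n k)" by (rule fuel_tb[OF FS_d0])
      fix d assume d: "(d0 w, d) \<in> sem (fuelP ?X k)"
      obtain p where p: "set p \<subseteq> symbols M" "length p = ?F ?n" "FS w p d"
        using fuel_sound[OF FS_d0 d] unfolding X by auto
      have r: "ready M w p d" using FS_ready[OF p(3,1)] .
      show "tb (walkP M True) d (?W ?n)" using walk_tb[OF M r] p(2) by simp
      fix e f g assume e: "(d, e) \<in> sem (walkP M True)" "(e, f) \<in> sem (Op (Wr 4 (acc M) (acc M)))"
        "(f, g) \<in> sem (Op (Wr 7 1 1))"
      have gf: "g = e" using e(2,3) by (auto simp: wr_rd')
      obtain e0 c t where e0: "\<And>e'. (d, e') \<in> sem (walkP M True) \<longleftrightarrow> e' = e0" "e0 6 = (t, 0)" "home e0"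
          "t (int (length p)) = 0"
        by (rule walk_end[OF r]) (rule that)
      have "g = e0" using gf e(1) e0(1) by simp
      then show "tb (verP P) g (?V ?n)" using verP_props(3)[OF e0(3,2,4) P] p(2) by simp
    qed auto
    then show "tb (existsP M P k) (d0 w) (ft ?c ?n k + ?W ?n + ?V ?n + 50)" by (rule tb_mono) simp
  next
    have F: "polyb ?F" by (intro polyb_power polyb_add polyb_id polyb_const)
    show "expb (\<lambda>n. ft ?c n k + ?W n + ?V n + 50)"
      by (intro expb_add expb_mult expb_comp[OF deciderD(2)[OF P] F] expb_poly[OF polyb_ft] expb_poly[OF F]
          expb_poly[OF polyb_const])
  qed
  then show ?thesis unfolding exists_sem .
qed

text \<open>There are \<open>nsym M ^ ((n + 2) ^ k)\<close> rounds. A round consists of a polynomial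
  walk, a run of the oracle decider on a polynomially long word, and an increment, so both factors
  are exponentially bounded. The variant is the distance of \<open>val\<close> from the number of
  paths; it applies to every run, also to those that fail on the way.\<close>

lemma forall_NEXP: "{w. \<forall>p\<in>paths M ((length w + 2) ^ k). reject_ok M A w p} \<in> NEXP"
proof -
  let ?E = "nsym M"
  let ?c = "cost (fuelP [1] 0)"
  let ?F = "\<lambda>n. (n + 2) ^ k"
  let ?W = "\<lambda>n. (cost (moveP M False) + 30) * (?F n + 1)"
  let ?V = "\<lambda>n. (cost copyP + 20) * (?F n + T (?F n) + 1)"
  define B where "B = (\<lambda>n. ?W n + ?V n + 10)"
  define G where "G = (\<lambda>n. (cost (incP ?E) + cost (carryP ?E) + 10) * (?F n + 1))"
  have body: "tb (bodyP M P) d (B n)" if r: "ready M w p d" and p: "length p = ?F n" for w p d n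
  proof -
    have "tb (bodyP M P) d (Suc (?W n + Suc (1 + Suc (1 + ?V n))))"
      unfolding bodyP_def
    proof (intro tb_Seq tb_Cho')
      show "tb (walkP M False) d (?W n)" using walk_tb[OF M r] p by simp
      fix e assume e: "(d, e) \<in> sem (walkP M False)"
      obtain e0 c t where e0: "\<And>e'. (d, e') \<in> sem (walkP M False) \<longleftrightarrow> e' = e0" "e0 6 = (t, 0)" "home e0"
          "t (int (length p)) = 0"
        by (rule walk_end[OF r]) (rule that)
      have "e = e0" using e e0(1) by simp
      then show "tb (verP P) e (?V n)" using verP_props(3)[OF e0(3,2,4) P] p by simp
    qed auto
    then show ?thesis by (rule tb_mono) (simp add: B_def)
  qed
  have cnt: "tb (incP ?E) d (G n)" "tb (overP ?E) d (G n)" if "ready M w p d" "length p = ?F n" for w p d n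
    using counter_tb[of d p ?E] ready_home[OF that(1)] that(2) E(1) by (simp_all add: G_def)
  have rnd: "tb (roundP M P) d (B n + G n + 1)" if r: "ready M w p d" "length p = ?F n" for w p d n
  proof -
    have "tb (roundP M P) d (Suc (B n + G n))"
      unfolding roundP_def by (rule tb_Seq[OF body[OF r]]) (use body_sem(2)[OF r(1)] cnt(1)[OF _ r(2)] in blast)
    then show ?thesis by simp
  qed
  have len: "length p' = length p \<and> val ?E p' = Suc (val ?E p)" if "nxt ?E p p'" "ready M w p d" for p p' w d
    using nxt_props[OF that(1) _ E(1)] ready_home[OF that(2)] by blast
  have "{w. \<exists>e. (d0 w, e) \<in> sem (forallP M P k)} \<in> NEXP"
  proof (rule NEXP_prog)
    fix w :: "bool list"
    let ?n = "length w"
    let ?s = "(?E ^ ?F ?n + 1) * (B ?n + G ?n + 1 + 1)"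
    let ?J = "\<lambda>m e. \<exists>q. ready M w q e \<and> length q = ?F ?n \<and> val ?E q = m"
    have st: "\<forall>m e f. ?J m e \<longrightarrow> (e, f) \<in> sem (roundP M P) \<longrightarrow> m < ?E ^ ?F ?n \<and> ?J (Suc m) f"
    proof (intro allI impI)
      fix m e f assume "?J m e" and ef: "(e, f) \<in> sem (roundP M P)"
      then obtain q where q: "ready M w q e" "length q = ?F ?n" "val ?E q = m" by blast
      from round[OF q(1) ef] obtain p' where p': "nxt ?E q p'" "ready M w p' f" by blast
      have "val ?E q < ?E ^ length q" using val_less ready_home[OF q(1)] E(1) by blast
      then show "m < ?E ^ ?F ?n \<and> ?J (Suc m) f" using len[OF p'(1) q(1)] q p'(2) by auto
    qed
    have "tb (forallP M P k) (d0 w) (Suc (ft ?c ?n k + Suc (?s + Suc (B ?n + Suc (G ?n + 1)))))"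
      unfolding forallP_def
    proof (intro tb_seqs_Cons)
      show "tb (fuelP [1] k) (d0 w) (ft ?c ?n k)" by (rule fuel_tb[OF FS_d0])
      fix d assume d: "(d0 w, d) \<in> sem (fuelP [1] k)"
      obtain p where p: "set p \<subseteq> {1}" "length p = ?F ?n" "FS w p d"
        using fuel_sound[OF FS_d0 d] by auto
      have "set p \<subseteq> symbols M" using p(1) by (auto simp: symbols_def nsym_def)
      then have J0: "?J 0 d" using FS_ready[OF p(3)] p(2) val_ones[OF p(1)] by blast
      show "tb (Star (roundP M P)) d ?s"
        using Star_count(2)[where J = ?J, OF J0 st] rnd by fastforce
      fix e assume "(d, e) \<in> sem (Star (roundP M P))"
      then obtain q where q: "ready M w q e" "length q = ?F ?n"
        using Star_count(1)[where J = ?J, OF J0 st] by blast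
      show "tb (bodyP M P) e (B ?n)" using body q by blast
      fix f assume "(e, f) \<in> sem (bodyP M P)"
      then have "ready M w q f" using body_sem(2) q(1) by blast
      then show "tb (overP ?E) f (G ?n)" using cnt(2) q(2) by blast
    qed auto
    \<comment> \<open>By \<open>?E < 2 ^ ?E\<close> the number of paths is bounded by a power of 2
      with polynomial exponent.\<close>
    moreover have "?E ^ ?F ?n \<le> 2 ^ (?E * ?F ?n)"
      unfolding power_mult by (intro power_mono) (auto intro: less_imp_le less_exp)
    then have "?s \<le> (2 ^ (?E * ?F ?n) + 1) * (B ?n + G ?n + 2)" by (intro mult_le_mono) auto
    ultimately show "tb (forallP M P k) (d0 w) (ft ?c ?n k + (2 ^ (?E * ?F ?n) + 1) * (B ?n + G ?n + 2) + B ?n + G ?n + 10)"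
      by (elim tb_mono) simp
  next
    have F: "polyb ?F" by (intro polyb_power polyb_add polyb_id polyb_const)
    have "expb B" unfolding B_def
      by (intro expb_add expb_mult expb_comp[OF deciderD(2)[OF P] F] expb_poly[OF F] expb_poly[OF polyb_const])
    moreover have "expb G" unfolding G_def
      by (intro expb_add expb_mult expb_poly[OF F] expb_poly[OF polyb_const])
    ultimately show "expb (\<lambda>n. ft ?c n k + (2 ^ (?E * ?F n) + 1) * (B n + G n + 2) + B n + G n + 10)"
      by (intro expb_add expb_mult expb_exp polyb_mult F polyb_const expb_poly[OF polyb_ft] expb_poly[OF polyb_const])
  qed
  then show ?thesis unfolding forall_sem .
qed

end

section \<open>Machines with one query\<close>

lemma outcome_snoc: "outcome M ans w (p @ [x]) = act M ans x (outcome M ans w p)"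
  by (simp add: outcome_def)

lemma outcome_pad: "outcome M ans w (p @ replicate m (nsym M)) = outcome M ans w p"
proof -
  have "act M ans (nsym M) v = v" for v by (cases v) (simp add: act_def nsym_def)
  then have "fold (act M ans) (replicate m (nsym M)) v = v" for v by (induction m) auto
  then show ?thesis by (simp add: outcome_def)
qed

text \<open>Before the query the outcome of a path does not depend on \<open>ans\<close>. So the
  path can be built first and the true answer inserted when the query becomes known; the promise
  rules out a second one.\<close>

lemma run_outcome:
  assumes "wf_ntm M" "(ostep M A ^^ n) (init M w) c" "\<forall>n c. (ostep M A ^^ n) (init M w) c \<longrightarrow> nq c \<le> 1"
  shows "\<exists>p t. length p = n \<and> set p \<subseteq> symbols M \<and>
     (nq c = 0 \<longrightarrow> (\<forall>ans. outcome M ans w p = (c, \<lambda>_. 0))) \<and>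
     (nq c = 1 \<longrightarrow> outcome M (query_word t \<in> A) w p = (c, t))"
  using assms(2)
proof (induction n arbitrary: c)
  case 0
  then show ?case by (simp add: outcome_def init_def)
next
  case (Suc n)
  then obtain b where b: "(ostep M A ^^ n) (init M w) b" "ostep M A b c" by auto
  obtain p t where p: "length p = n" "set p \<subseteq> symbols M"
     "nq b = 0 \<longrightarrow> (\<forall>ans. outcome M ans w p = (b, \<lambda>_. 0))"
     "nq b = 1 \<longrightarrow> outcome M (query_word t \<in> A) w p = (b, t)" using Suc.IH[OF b(1)] by (elim exE conjE) (rule that)
  have nb: "nq b \<le> 1" "nq c \<le> 1" using assms(3) b(1) Suc.prems by blast+
  from b(2) consider "step M b c" | "qstep M A b c" by (auto simp: ostep_def)
  then show ?case
  proof cases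
    case 1
    then obtain \<tau> where t: "\<tau> \<in> delta M" "applies \<tau> b" "c = app \<tau> b" unfolding step_iff by blast
    then obtain j where j: "j < length (trs M)" "trs M ! j = \<tau>"
      using set_trs[OF assms(1)] by (metis in_set_conv_nth)
    have a: "act M ans (Suc j) (b, s) = (c, s)" for ans s using j t by (simp add: act_def)
    have "nq c = nq b" using t(3) by simp
    moreover have "Suc j \<in> symbols M" using j by (simp add: symbols_def nsym_def)
    ultimately show ?thesis using p a
      by (intro exI[of _ "p @ [Suc j]"] exI[of _ t]) (auto simp: outcome_snoc)
  next
    case 2
    then have q: "cstate b = qry M" "nq c = Suc (nq b)"
      "c = \<lparr>cstate = (if query_word (tp2 b) \<in> A then qyes M else qno M), tp1 = tp1 b, hd1 = hd1 b,
         tp2 = (\<lambda>_. 0), hd2 = 0, nq = Suc (nq b)\<rparr>" by (auto simp: qstep_def)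
    then have n0: "nq b = 0" using nb by simp
    then have "c = query_conf M (query_word (tp2 b) \<in> A) b" using q(3) by (simp add: query_conf_def)
    then have "act M (query_word (tp2 b) \<in> A) (length (trs M) + 1) (b, \<lambda>_. 0) = (c, tp2 b)"
      using q(1) n0 by (simp add: act_def)
    moreover have "length (trs M) + 1 \<in> symbols M" by (simp add: symbols_def nsym_def)
    ultimately show ?thesis using p n0 q(2)
      by (intro exI[of _ "p @ [length (trs M) + 1]"] exI[of _ "tp2 b"]) (auto simp: outcome_snoc)
  qed
qed

text \<open>Skipped symbols correspond to no machine step, and transitions are faithful by
  definition. The only doubtful step is the query, which is genuine if \<open>ans\<close> is the
  correct answer for the recorded tape; for a wrong answer nothing is claimed.\<close>

lemma outcome_run:
  assumes "wf_ntm M" "outcome M ans w p = (c, t)"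
  shows "(nq c = 0 \<longrightarrow> (ostep M A)\<^sup>*\<^sup>* (init M w) c) \<and>
     (nq c = 1 \<longrightarrow> (query_word t \<in> A \<longleftrightarrow> ans) \<longrightarrow> (ostep M A)\<^sup>*\<^sup>* (init M w) c)"
  using assms(2)
proof (induction p arbitrary: c t rule: rev_induct)
  case Nil
  then show ?case by (auto simp: outcome_def)
next
  case (snoc x p)
  obtain b s where bs: "outcome M ans w p = (b, s)" by fastforce
  have nb: "nq b \<le> 1" using fold_act_bound[OF assms(1) bs[unfolded outcome_def]] by blast
  have st: "act M ans x (b, s) = (c, t)" using snoc.prems bs by (simp add: outcome_snoc)
  note IH = snoc.IH[OF bs]
  consider (step) \<tau> where "\<tau> \<in> delta M" "applies \<tau> b" "c = app \<tau> b" "t = s"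
    | (query) "cstate b = qry M" "nq b = 0" "c = query_conf M ans b" "t = tp2 b" | (skip) "c = b" "t = s"
  proof -
    let ?D = "length (trs M)"
    consider (a) "1 \<le> x" "x \<le> ?D" "applies (trs M ! (x - 1)) b"
      | (b) "x = ?D + 1" "cstate b = qry M" "nq b = 0"
      | (c) "act M ans x (b, s) = (b, s)"
    proof -
      have "(1 \<le> x \<and> x \<le> ?D \<and> applies (trs M ! (x - 1)) b) \<or> (x = ?D + 1 \<and> cstate b = qry M \<and> nq b = 0) \<or>
          act M ans x (b, s) = (b, s)"
        by (simp add: act_def del: One_nat_def)
      then show thesis by (elim disjE conjE) (erule (2) that(1), erule (2) that(2), erule that(3))
    qed
    then show thesis
    proof cases
      case a
      then have "(c, t) = (app (trs M ! (x - 1)) b, s)" unfolding st[symmetric] by (simp add: act_def)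
      then show ?thesis using step trs_nth(1)[OF assms(1) a(1,2)] a(3) by blast
    next
      case b
      then have "(c, t) = (query_conf M ans b, tp2 b)" unfolding st[symmetric] by (simp add: act_def)
      then show ?thesis using query b by blast
    next
      case c
      then show ?thesis using skip st by simp
    qed
  qed
  then show ?case
  proof cases
    case step
    have "ostep M A b c" using step unfolding ostep_def step_iff by blast
    then show ?thesis using IH step(3,4) by (auto intro: rtranclp.rtrancl_into_rtrancl)
  next
    case query
    have "ostep M A b c" if "query_word t \<in> A \<longleftrightarrow> ans"
      using query that by (auto simp: ostep_def qstep_def query_conf_def)
    then show ?thesis using IH query by (auto simp: query_conf_def intro: rtranclp.rtrancl_into_rtrancl)
  qed (use IH in auto)
qed

text \<open>Replaces the clock by a pure power, a length that \<open>fuelP\<close> produces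
  exactly.\<close>

lemma clock_bound: "n ^ k + k \<le> (n + 2) ^ k" for n k :: nat
proof (induction k)
  case (Suc k)
  have "n ^ Suc k + Suc k \<le> n * (n ^ k + k) + 2 * (n ^ k + k)"
  proof -
    have "1 \<le> n ^ k + k" by (cases k) auto
    moreover have "Suc k \<le> 2 * (a + k)" if "1 \<le> a + k" for a using that by presburger
    ultimately have "Suc k \<le> 2 * (n ^ k + k)" by blast
    then show ?thesis by (simp add: algebra_simps)
  qed
  also have "\<dots> = (n + 2) * (n ^ k + k)" by (simp add: algebra_simps)
  also have "\<dots> \<le> (n + 2) * (n + 2) ^ k" using Suc by (rule mult_le_mono2)
  finally show ?case by simp
qed simp

text \<open>No certificate can lie. A path satisfying \<open>accept_ok\<close> asks nothing or asks
  a member of \<open>A\<close> and assumes yes; a path violating \<open>reject_ok\<close> asks a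
  non-member and assumes no. Either way the assumed answers are correct and the path is an accepting
  run.\<close>

lemma NP_NEXP_1_subset: "NP_NEXP_1 \<subseteq> coDExp"
proof
  fix L assume "L \<in> NP_NEXP_1"
  then obtain A M k where A: "A \<in> NEXP" and mM: "wf_ntm M" "decides_in (ostep M A) M L (\<lambda>n. n ^ k + k)"
    "\<And>w n c. (ostep M A ^^ n) (init M w) c \<Longrightarrow> nq c \<le> 1"
    unfolding NP_NEXP_1_def NP_with_oracle_1_def by blast
  obtain P T where P: "decider A P T" using NEXP_decider[OF A] .
  interpret simulation M A P T k by unfold_locales (use mM P in auto)
  let ?Q = "\<lambda>w. paths M ((length w + 2) ^ k)"
  let ?E = "{w. \<exists>p\<in>?Q w. accept_ok M A w p}" and ?U = "{w. \<forall>p\<in>?Q w. reject_ok M A w p}"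
  have acc: "w \<in> L \<longleftrightarrow> (\<exists>c. (ostep M A)\<^sup>*\<^sup>* (init M w) c \<and> cstate c = acc M)" for w
    using mM(2) unfolding decides_in_def rtranclp_power by blast
  have "w \<in> L \<longleftrightarrow> w \<in> ?E \<or> w \<notin> ?U" for w
  proof
    assume "w \<in> L"
    then obtain n c where c: "(ostep M A ^^ n) (init M w) c" "cstate c = acc M"
      using mM(2) unfolding decides_in_def by blast
    have "n \<le> length w ^ k + k" using mM(2) c(1) unfolding decides_in_def by blast
    then have n: "n \<le> (length w + 2) ^ k" using clock_bound le_trans by blast
    obtain p t where p: "length p = n" "set p \<subseteq> symbols M"
       "nq c = 0 \<longrightarrow> (\<forall>ans. outcome M ans w p = (c, \<lambda>_. 0))"
       "nq c = 1 \<longrightarrow> outcome M (query_word t \<in> A) w p = (c, t)"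
      using run_outcome[OF mM(1) c(1)] mM(3) by metis
    \<comment> \<open>The quantifiers range over paths of one fixed length, so the run is filled up
      with the symbol that does nothing.\<close>
    define q where "q = p @ replicate ((length w + 2) ^ k - n) (nsym M)"
    have q: "q \<in> ?Q w" using p(1,2) n by (auto simp: q_def paths_def symbols_def nsym_def)
    have o: "outcome M ans w q = outcome M ans w p" for ans unfolding q_def by (rule outcome_pad)
    have "nq c \<le> 1" using mM(3) c(1) by blast
    then consider "nq c = 0" | "nq c = 1" by linarith
    then show "w \<in> ?E \<or> w \<notin> ?U"
    proof cases
      case 1
      then have "accept_ok M A w q" using p(3) c(2) by (simp add: accept_ok_def o)
      then show ?thesis using q by blast
    next
      case 2
      show ?thesis
      proof (cases "query_word t \<in> A")
        case True
        then have "accept_ok M A w q" using p(4) c(2) 2 by (simp add: accept_ok_def o)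
        then show ?thesis using q by blast
      next
        case False
        then have "\<not> reject_ok M A w q" using p(4) c(2) 2 by (simp add: reject_ok_def o)
        then show ?thesis using q by blast
      qed
    qed
  next
    assume "w \<in> ?E \<or> w \<notin> ?U"
    then obtain p where "accept_ok M A w p \<or> \<not> reject_ok M A w p" by blast
    then show "w \<in> L"
    proof
      assume a: "accept_ok M A w p"
      obtain c t where ct: "outcome M True w p = (c, t)" by fastforce
      from outcome_run[OF mM(1) ct, of A] show ?thesis using a ct unfolding acc accept_ok_def by auto
    next
      assume a: "\<not> reject_ok M A w p"
      obtain c t where ct: "outcome M False w p = (c, t)" by fastforce
      from outcome_run[OF mM(1) ct, of A] show ?thesis using a ct unfolding acc reject_ok_def by auto
    qed
  qed
  then have "- L = ?U \<inter> - ?E" by blast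
  then show "L \<in> coDExp"
    unfolding coDExp_def DExp_def
    by (intro CollectI exI[of _ ?U] exI[of _ "- ?E"] conjI) (simp_all only: exists_NEXP forall_NEXP double_complement)
qed

section \<open>Two queries decide the difference class\<close>

text \<open>Asks \<open>w @ [True]\<close> (copy in state 5) and, after a positive answer, rewinds (state 6) and asks
\<open>w @ [False]\<close> (copy in state 7). Since a query forgets the state, the symbols 3 and 4 behind the
input on tape 1 record which query is being answered.\<close>

definition twoM :: ntm where
  "twoM = \<lparr>delta = {(5, 1, 0, 5, 1, 1, 1, 1), (5, 2, 0, 5, 2, 2, 1, 1), (5, 0, 0, 2, 3, 2, 0, 0),
      (3, 3, 0, 6, 4, 0, -1, 0), (6, 1, 0, 6, 1, 0, -1, 0), (6, 2, 0, 6, 2, 0, -1, 0), (6, 0, 0, 7, 0, 0, 1, 0),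
      (7, 1, 0, 7, 1, 1, 1, 1), (7, 2, 0, 7, 2, 2, 1, 1), (7, 4, 0, 2, 4, 1, 0, 0), (4, 4, 0, 0, 4, 0, 0, 0)},
    start = 5, acc = 0, rej = 1, qry = 2, qyes = 3, qno = 4\<rparr>"

lemma wf_twoM: "wf_ntm twoM"
  by (simp add: wf_ntm_def twoM_def)

text \<open>All transitions read a blank on the oracle tape, so the state and the symbol on tape 1
  determine everything else; the conditional expression below is that function on the transitions
  that exist.\<close>

lemma twoM_fun:
  assumes "(q, a, b, v) \<in> delta twoM" "(q, a, b, v') \<in> delta twoM"
  shows "v = v'"
proof -
  have "u = (if q = 5 then if a = 0 then (2, 3, 2, 0, 0) else (5, a, a, 1, 1)
     else if q = 3 then (6, 4, 0, -1, 0)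
     else if q = 6 then if a = 0 then (7, 0, 0, 1, 0) else (6, a, 0, -1, 0)
     else if q = 7 then if a = 4 then (2, 4, 1, 0, 0) else (7, a, a, 1, 1)
     else (0, 4, 0, 0, 0))" if "(q, a, b, u) \<in> delta twoM" for u
    using that by (auto simp: twoM_def)
  then show ?thesis using assms by metis
qed

lemma twoM_no2: "(2, v) \<notin> delta twoM"
  by (simp add: twoM_def)

lemma twoM_det: "ostep twoM C x y \<Longrightarrow> ostep twoM C x z \<Longrightarrow> y = z"
proof -
  assume yz: "ostep twoM C x y" "ostep twoM C x z"
  show "y = z"
  proof (cases "cstate x = 2")
    case True
    then have "\<not> step twoM x v" for v unfolding step_def using twoM_no2 by simp
    then show ?thesis using yz by (simp add: ostep_def qstep_def)
  next
    case False
    then have "\<not> qstep twoM C x v" for v by (simp add: qstep_def twoM_def)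
    then have "step twoM x y" "step twoM x z" using yz by (auto simp: ostep_def)
    then show ?thesis unfolding step_def using twoM_fun by fast
  qed
qed

text \<open>In a deterministic system every run is a prefix of the one that ends. Exhibiting a
  single halting run therefore bounds and describes all of them.\<close>

lemma det_run:
  assumes det: "\<forall>x y z. R x y \<longrightarrow> R x z \<longrightarrow> y = z" and "(R ^^ T) x y" "\<forall>z. \<not> R y z" "(R ^^ n) x z"
  shows "n \<le> T \<and> (R ^^ (T - n)) z y"
  using assms(2,4)
proof (induction n arbitrary: T x)
  case (Suc n)
  obtain u where u: "R x u" "(R ^^ n) u z" using Suc.prems(2) by (metis relpowp_Suc_D2)
  show ?case
  proof (cases T)
    case 0
    then show ?thesis using Suc.prems(1) u(1) assms(3) by auto
  next
    case (Suc T')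
    then obtain v where "R x v" "(R ^^ T') v y" using Suc.prems(1) by (metis relpowp_Suc_D2)
    then show ?thesis using Suc.IH[of T' u] u det Suc by auto
  qed
qed simp

lemma relpowp_snoc: "(R ^^ m) x y \<Longrightarrow> R y z \<Longrightarrow> k = Suc m \<Longrightarrow> (R ^^ k) x z"
  by auto

lemma relpowp_append: "(R ^^ m) x y \<Longrightarrow> (R ^^ n) y z \<Longrightarrow> k = m + n \<Longrightarrow> (R ^^ k) x z"
  by (auto simp: relpowp_add)

definition mk :: "nat \<Rightarrow> (int \<Rightarrow> nat) \<Rightarrow> int \<Rightarrow> (int \<Rightarrow> nat) \<Rightarrow> int \<Rightarrow> nat \<Rightarrow> conf" where
  "mk q t1 h1 t2 h2 n = \<lparr>cstate = q, tp1 = t1, hd1 = h1, tp2 = t2, hd2 = h2, nq = n\<rparr>"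

lemma ostep_mk: "(q, t1 h1, t2 h2, q', a', b', m1, m2) \<in> delta twoM \<Longrightarrow>
   ostep twoM C (mk q t1 h1 t2 h2 n) (mk q' (t1(h1 := a')) (h1 + m1) (t2(h2 := b')) (h2 + m2) n)"
  unfolding ostep_def step_def mk_def by fastforce

lemma query_enc: "query_word (enc x) = x"
proof -
  have l: "(LEAST k. enc x (int k) \<notin> {1, 2}) = length x"
  proof (rule Least_equality)
    show "enc x (int (length x)) \<notin> {1, 2}" by (simp add: enc_nat)
    show "length x \<le> y" if "enc x (int y) \<notin> {1, 2}" for y
      using that by (auto simp: enc_nat split: if_splits)
  qed
  show ?thesis unfolding query_word_def l by (rule nth_equalityI) (auto simp: enc_nat)
qed

lemma enc_app: "(enc x)(int (length x) := (if b then 2 else 1)) = enc (x @ [b])"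
  by (auto simp: enc_def fun_eq_iff nth_append)

text \<open>Only the first \<open>length w\<close> cells of tape 1 are prescribed, since the cell
  behind them may already hold a mark. The states 5 and 7 copy in the same way.\<close>

lemma copy_run:
  assumes "q \<in> {5, 7}" "\<And>j. j < length w \<Longrightarrow> t1 (int j) = enc w (int j)" "j \<le> length w"
  shows "(ostep twoM C ^^ j) (mk q t1 0 (enc []) 0 n) (mk q t1 (int j) (enc (take j w)) (int j) n)"
  using assms(3)
proof (induction j)
  case (Suc j)
  let ?s = "if w ! j then 2 else 1 :: nat"
  have t: "t1 (int j) = ?s" using assms(2)[of j] Suc.prems by (simp add: enc_nat)
  have e: "enc (take j w) (int j) = 0" using Suc.prems by (simp add: enc_nat)
  have "(q, t1 (int j), enc (take j w) (int j), q, ?s, ?s, 1, 1) \<in> delta twoM"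
    using assms(1) unfolding t e by (auto simp: twoM_def)
  from ostep_mk[of q t1 "int j" "enc (take j w)" "int j", OF this, of C n]
  have "ostep twoM C (mk q t1 (int j) (enc (take j w)) (int j) n)
    (mk q (t1(int j := ?s)) (int j + 1) ((enc (take j w))(int j := ?s)) (int j + 1) n)" .
  moreover have "t1(int j := ?s) = t1" using t by (auto simp: fun_eq_iff)
  moreover have "(enc (take j w))(int j := ?s) = enc (take (Suc j) w)"
    using enc_take_Suc[of j w] Suc.prems by simp
  ultimately have "ostep twoM C (mk q t1 (int j) (enc (take j w)) (int j) n)
    (mk q t1 (int (Suc j)) (enc (take (Suc j) w)) (int (Suc j)) n)" by (simp add: add.commute)
  then show ?case using Suc by auto
qed (simp add: enc_def)

lemma rewind_run:
  assumes "\<And>j. j < length w \<Longrightarrow> t1 (int j) = enc w (int j)" "j \<le> length w"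
  shows "(ostep twoM C ^^ j) (mk 6 t1 (int j - 1) (\<lambda>_. 0) 0 n) (mk 6 t1 (-1) (\<lambda>_. 0) 0 n)"
  using assms(2)
proof (induction j)
  case (Suc j)
  let ?s = "if w ! j then 2 else 1 :: nat"
  have t: "t1 (int j) = ?s" using assms(1)[of j] Suc.prems by (simp add: enc_nat)
  have "(6, t1 (int j), (\<lambda>_. 0) (0::int), 6, ?s, 0, -1, 0) \<in> delta twoM"
    unfolding t by (auto simp: twoM_def)
  from ostep_mk[of 6 t1 "int j" "\<lambda>_. 0" 0, OF this, of C n]
  have "ostep twoM C (mk 6 t1 (int j) (\<lambda>_. 0) 0 n) (mk 6 (t1(int j := ?s)) (int j + - 1) ((\<lambda>_. 0)(0 := 0)) (0 + 0) n)" .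
  moreover have "t1(int j := ?s) = t1" using t by (auto simp: fun_eq_iff)
  moreover have "(\<lambda>_. 0 :: nat)(0 :: int := 0) = (\<lambda>_. 0)" by auto
  ultimately have "ostep twoM C (mk 6 t1 (int (Suc j) - 1) (\<lambda>_. 0) 0 n) (mk 6 t1 (int j - 1) (\<lambda>_. 0) 0 n)" by simp
  from relpowp_Suc_I2[of "ostep twoM C", OF this] show ?case using Suc by simp
qed simp

lemma enc_Nil: "enc [] = (\<lambda>_. 0)"
  by (auto simp: enc_def)

lemma stuck_mk:
  assumes "\<And>q' a' b' m1 m2. (q, t1 h1, t2 h2, q', a', b', m1, m2) \<notin> delta twoM" "q \<noteq> 2"
  shows "\<not> ostep twoM C (mk q t1 h1 t2 h2 n) y"
  using assms by (auto simp: ostep_def step_def qstep_def mk_def twoM_def)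

text \<open>Three passes over the input, two to copy and one to rewind, and seven single steps:
  writing a mark and asking, twice each, turning at both ends, and accepting.\<close>

lemma twoM_run:
  fixes C w defines "n \<equiv> length w"
  shows "\<exists>T y. T \<le> 3 * n + 7 \<and> (ostep twoM C ^^ T) (init twoM w) y \<and> (\<forall>z. \<not> ostep twoM C y z) \<and>
    (cstate y = 0 \<longleftrightarrow> w @ [True] \<in> C \<and> w @ [False] \<notin> C)"
proof -
  let ?R = "ostep twoM C"
  let ?b = "\<lambda>_::int. 0::nat"
  define t3 where "t3 = (enc w)(int n := 3)"
  define t4 where "t4 = (enc w)(int n := 4)"
  have en: "enc w (int n) = 0" by (simp add: n_def enc_nat)
  have i: "init twoM w = mk 5 (enc w) 0 (enc []) 0 0"
    by (simp add: init_enc mk_def twoM_def enc_Nil)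
  have r1: "(?R ^^ n) (init twoM w) (mk 5 (enc w) (int n) (enc w) (int n) 0)"
    unfolding i using copy_run[of 5 w "enc w" n C 0] by (simp add: n_def)
  have s2: "?R (mk 5 (enc w) (int n) (enc w) (int n) 0) (mk 2 t3 (int n) (enc (w @ [True])) (int n) 0)"
    using ostep_mk[of 5 "enc w" "int n" "enc w" "int n" 2 3 2 0 0 C 0] enc_app[of w True] en
    by (simp add: t3_def n_def twoM_def)
  have s3: "?R (mk 2 t3 (int n) (enc (w @ [True])) (int n) 0)
     (mk (if w @ [True] \<in> C then 3 else 4) t3 (int n) ?b 0 1)"
    by (simp add: ostep_def qstep_def mk_def twoM_def query_enc)
  have r3: "(?R ^^ (n + 2)) (init twoM w) (mk (if w @ [True] \<in> C then 3 else 4) t3 (int n) ?b 0 1)"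
    by (rule relpowp_snoc[OF relpowp_snoc[OF r1 s2 refl] s3]) simp
  show ?thesis
  proof (cases "w @ [True] \<in> C")
    case False
    \<comment> \<open>A negative first answer leads to state 4 in front of the symbol 3, for which
      there is no transition; rejecting means getting stuck. A positive second answer is stopped
      likewise, in state 3 in front of the symbol 4.\<close>
    have "\<not> ?R (mk 4 t3 (int n) ?b 0 1) z" for z
      by (rule stuck_mk) (auto simp: t3_def twoM_def)
    then show ?thesis using r3 False
      by (intro exI[of _ "n + 2"] exI[of _ "mk 4 t3 (int n) ?b 0 1"]) (auto simp: mk_def)
  next
    case True
    have b0: "?b(0 := 0) = ?b" by auto
    have "t3(int n := 4) = t4" by (simp add: t3_def t4_def)
    then have s4: "?R (mk 3 t3 (int n) ?b 0 1) (mk 6 t4 (int n - 1) ?b 0 1)"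
      using ostep_mk[of 3 t3 "int n" ?b 0 6 4 0 "-1" 0 C 1] by (simp add: t3_def twoM_def b0)
    have old: "t4 (int j) = enc w (int j)" if "j < length w" for j using that by (simp add: t4_def n_def)
    have r5: "(?R ^^ n) (mk 6 t4 (int n - 1) ?b 0 1) (mk 6 t4 (-1) ?b 0 1)"
      using rewind_run[of w t4 n C 1] old by (simp add: n_def)
    have m1: "t4 (-1) = 0" by (simp add: t4_def enc_def)
    have "t4(-1 := 0) = t4" using m1 by (auto simp: fun_eq_iff)
    then have s6: "?R (mk 6 t4 (-1) ?b 0 1) (mk 7 t4 0 ?b 0 1)"
      using ostep_mk[of 6 t4 "-1" ?b 0 7 0 0 1 0 C 1] m1 by (simp add: twoM_def b0)
    have r7: "(?R ^^ n) (mk 7 t4 0 ?b 0 1) (mk 7 t4 (int n) (enc w) (int n) 1)"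
      using copy_run[of 7 w t4 n C 1] old by (simp add: n_def enc_Nil)
    have "t4(int n := 4) = t4" by (simp add: t4_def)
    then have s8: "?R (mk 7 t4 (int n) (enc w) (int n) 1) (mk 2 t4 (int n) (enc (w @ [False])) (int n) 1)"
      using ostep_mk[of 7 t4 "int n" "enc w" "int n" 2 4 1 0 0 C 1] enc_app[of w False] en
      by (simp add: t4_def n_def twoM_def)
    have s9: "?R (mk 2 t4 (int n) (enc (w @ [False])) (int n) 1)
       (mk (if w @ [False] \<in> C then 3 else 4) t4 (int n) ?b 0 2)"
      by (simp add: ostep_def qstep_def mk_def twoM_def query_enc)
    have r3': "(?R ^^ (n + 2)) (init twoM w) (mk 3 t3 (int n) ?b 0 1)" using r3 True by simp
    have r4: "(?R ^^ (n + 3)) (init twoM w) (mk 6 t4 (int n - 1) ?b 0 1)"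
      by (rule relpowp_snoc[OF r3' s4]) simp
    have r5': "(?R ^^ (2 * n + 3)) (init twoM w) (mk 6 t4 (-1) ?b 0 1)"
      by (rule relpowp_append[OF r4 r5]) simp
    have r6: "(?R ^^ (2 * n + 4)) (init twoM w) (mk 7 t4 0 ?b 0 1)"
      by (rule relpowp_snoc[OF r5' s6]) simp
    have r7': "(?R ^^ (3 * n + 4)) (init twoM w) (mk 7 t4 (int n) (enc w) (int n) 1)"
      by (rule relpowp_append[OF r6 r7]) simp
    have r9: "(?R ^^ (3 * n + 6)) (init twoM w) (mk (if w @ [False] \<in> C then 3 else 4) t4 (int n) ?b 0 2)"
      by (rule relpowp_snoc[OF relpowp_snoc[OF r7' s8 refl] s9]) simp
    show ?thesis
    proof (cases "w @ [False] \<in> C")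
      case F: True
      have "\<not> ?R (mk 3 t4 (int n) ?b 0 2) z" for z
        by (rule stuck_mk) (auto simp: t4_def twoM_def)
      then show ?thesis using r9 F
        by (intro exI[of _ "3 * n + 6"] exI[of _ "mk 3 t4 (int n) ?b 0 2"]) (auto simp: mk_def)
    next
      case F: False
      have "t4(int n := 4) = t4" by (simp add: t4_def)
      then have "?R (mk 4 t4 (int n) ?b 0 2) (mk 0 t4 (int n) ?b 0 2)"
        using ostep_mk[of 4 t4 "int n" ?b 0 0 4 0 0 0 C 2] by (simp add: t4_def twoM_def b0)
      moreover from this have s10: "?R (mk 4 t4 (int n) ?b 0 2) (mk 0 t4 (int n) ?b 0 2)" .
      moreover have r10: "(?R ^^ (3 * n + 6)) (init twoM w) (mk 4 t4 (int n) ?b 0 2)" using r9 F by simp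
      ultimately have "(?R ^^ (3 * n + 7)) (init twoM w) (mk 0 t4 (int n) ?b 0 2)"
        by (intro relpowp_snoc[OF r10 s10]) simp
      moreover have "\<not> ?R (mk 0 t4 (int n) ?b 0 2) z" for z
        by (rule stuck_mk) (auto simp: t4_def twoM_def)
      ultimately show ?thesis using F True
        by (intro exI[of _ "3 * n + 7"] exI[of _ "mk 0 t4 (int n) ?b 0 2"]) (auto simp: mk_def)
    qed
  qed
qed

text \<open>The constant 10 settles \<open>n \<le> 1\<close>; from 2 on the power alone exceeds
  \<open>3 * n\<close>.\<close>

lemma two_query_bound: "3 * n + 7 \<le> n ^ 10 + (10 :: nat)"
proof -
  consider "n = 0" | "n = 1" | "n \<ge> 2" by linarith
  then show ?thesis
  proof cases
    case 3
    have "n * 3 \<le> n * 2 ^ 9" by simp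
    also have "\<dots> \<le> n * n ^ 9" using 3 by (intro mult_le_mono power_mono) auto
    also have "\<dots> = n ^ 10" by (simp flip: power_Suc)
    finally show ?thesis by simp
  qed auto
qed

lemma DExp_subset_NP_NEXP: "DExp \<subseteq> NP_NEXP"
proof
  fix L assume "L \<in> DExp"
  then obtain A B where AB: "L = A \<inter> B" "A \<in> NEXP" "- B \<in> NEXP" unfolding DExp_def by blast
  \<comment> \<open>Of the second half the complement is the one in \<open>NEXP\<close>. Membership
    in \<open>L\<close> thus means the answer yes to the first query and no to the second.\<close>
  let ?C = "join A (- B)"
  let ?R = "ostep twoM ?C"
  have det: "\<forall>x y z. ?R x y \<longrightarrow> ?R x z \<longrightarrow> y = z" using twoM_det by blast
  have "decides_in ?R twoM L (\<lambda>n. n ^ 10 + 10)"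
    unfolding decides_in_def
  proof (intro conjI allI impI)
    fix w n c assume r: "(?R ^^ n) (init twoM w) c"
    obtain T y where T: "T \<le> 3 * length w + 7" "(?R ^^ T) (init twoM w) y" "\<forall>z. \<not> ?R y z"
      using twoM_run[of w ?C] by blast
    have "n \<le> T" using det_run[of ?R T "init twoM w" y n c, OF det T(2,3) r] by blast
    then show "n \<le> length w ^ 10 + 10" using T(1) two_query_bound[of "length w"] by linarith
  next
    fix w
    obtain T y where T: "(?R ^^ T) (init twoM w) y" "\<forall>z. \<not> ?R y z"
      "cstate y = 0 \<longleftrightarrow> w @ [True] \<in> ?C \<and> w @ [False] \<notin> ?C"
      using twoM_run[of w ?C] by (elim exE conjE) (rule that)
    have y: "w \<in> L \<longleftrightarrow> cstate y = 0" unfolding T(3) AB(1) by simp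
    have acc: "acc twoM = 0" by (simp add: twoM_def)
    show "w \<in> L \<longleftrightarrow> (\<exists>n c. (?R ^^ n) (init twoM w) c \<and> cstate c = acc twoM)"
    proof
      assume "w \<in> L"
      then show "\<exists>n c. (?R ^^ n) (init twoM w) c \<and> cstate c = acc twoM" using T(1) y acc by metis
    next
      assume "\<exists>n c. (?R ^^ n) (init twoM w) c \<and> cstate c = acc twoM"
      then obtain n c where c: "(?R ^^ n) (init twoM w) c" "cstate c = 0" using acc by auto
      have "(?R ^^ (T - n)) c y" using det_run[of ?R T "init twoM w" y n c, OF det T(1,2) c(1)] by blast
      \<comment> \<open>An accepting configuration has no successor, so it is the end
        \<open>y\<close> of the unique maximal run.\<close>
      moreover have "\<not> ?R c z" for z using c(2) by (auto simp: ostep_def step_def qstep_def twoM_def)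
      ultimately have "y = c" by (cases "T - n") (auto dest!: relpowp_Suc_D2 simp del: relpowp.simps(2))
      then show "w \<in> L" using y c(2) by simp
    qed
  qed
  then show "L \<in> NP_NEXP"
    unfolding NP_NEXP_def NP_with_oracle_def using wf_twoM NEXP_join[OF AB(2,3)] by blast
qed

section \<open>The difference class and the Boolean hierarchy\<close>

lemma NEXP_subset_DExp: "A \<in> NEXP \<Longrightarrow> A \<in> DExp"
  unfolding DExp_def using NEXP_empty by force

lemma DExp_Int: "X \<in> DExp \<Longrightarrow> Y \<in> DExp \<Longrightarrow> X \<inter> Y \<in> DExp"
proof -
  assume "X \<in> DExp" "Y \<in> DExp"
  then obtain A B C D where *: "X = A \<inter> B" "Y = C \<inter> D" "A \<in> NEXP" "- B \<in> NEXP" "C \<in> NEXP" "- D \<in> NEXP"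
    unfolding DExp_def by blast
  have "X \<inter> Y = (A \<inter> C) \<inter> (B \<inter> D)" using * by blast
  moreover have "- (B \<inter> D) \<in> NEXP" using NEXP_Un[OF *(4,6)] by simp
  ultimately show ?thesis unfolding DExp_def using NEXP_Int[OF *(3,5)] by blast
qed

theorem mainTheorem14:
  assumes "NP_NEXP_1 = NP_NEXP"
  shows "BH_NEXP = coDExp"
proof -
  have sub: "DExp \<subseteq> coDExp" using DExp_subset_NP_NEXP NP_NEXP_1_subset assms by blast
  \<comment> \<open>An inclusion of a class in the class of its complements is an equality, as one
    sees by passing to complements.\<close>
  have compl: "- X \<in> DExp" if "X \<in> DExp" for X using sub that unfolding coDExp_def by blast
  then have eq: "coDExp = DExp" unfolding coDExp_def using sub by (force simp: coDExp_def)
  \<comment> \<open>Taking in one more language changes the parity set by a symmetric difference, a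
    Boolean combination of two members of \<open>DExp\<close>.\<close>
  have parity: "{w. odd (card {z \<in> {1..k}. w \<in> Ls z})} \<in> DExp" if "\<forall>z\<in>{1..k}. Ls z \<in> NEXP"
    for k and Ls :: "nat \<Rightarrow> bool list set"
    using that
  proof (induction k)
    case 0
    then show ?case using NEXP_subset_DExp[OF NEXP_empty] by simp
  next
    case (Suc k)
    let ?X = "{w. odd (card {z \<in> {1..k}. w \<in> Ls z})}"
    let ?Y = "Ls (Suc k)"
    have X: "?X \<in> DExp" and Y: "?Y \<in> DExp" using Suc NEXP_subset_DExp by auto
    have "{z \<in> {1..Suc k}. w \<in> Ls z} =
        (if w \<in> ?Y then insert (Suc k) {z \<in> {1..k}. w \<in> Ls z} else {z \<in> {1..k}. w \<in> Ls z})" for w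
      by (auto simp: le_Suc_eq)
    \<comment> \<open>The symmetric difference of \<open>?X\<close> and \<open>?Y\<close>, written
      with intersection and complement only, the operations under which \<open>DExp\<close> is known
      to be closed.\<close>
    then have "{w. odd (card {z \<in> {1..Suc k}. w \<in> Ls z})} = - (- (?X \<inter> - ?Y) \<inter> - (- ?X \<inter> ?Y))"
      by auto
    also have "\<dots> \<in> DExp" using X Y by (intro compl DExp_Int)
    finally show ?case .
  qed
  have "BH_NEXP \<subseteq> DExp"
  proof
    fix L assume "L \<in> BH_NEXP"
    then obtain k where "L \<in> BH_NEXP_level k" by (auto simp: BH_NEXP_def)
    then obtain Ls where "\<forall>z\<in>{1..k}. Ls z \<in> NEXP" "\<forall>w. w \<in> L \<longleftrightarrow> odd (card {z \<in> {1..k}. w \<in> Ls z})"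
      unfolding BH_NEXP_level_def by (elim CollectE exE conjE) (rule that)
    moreover from this(2) have "L = {w. odd (card {z \<in> {1..k}. w \<in> Ls z})}" by blast
    ultimately show "L \<in> DExp" using parity by simp
  qed
  moreover have "DExp \<subseteq> BH_NEXP"
  proof
    fix L assume "L \<in> DExp"
    then obtain A B where AB: "L = A \<inter> B" "A \<in> NEXP" "- B \<in> NEXP" unfolding DExp_def by blast
    \<comment> \<open>The chain is \<open>A\<close> followed by \<open>A - B\<close>, whose
      difference is \<open>A \<inter> B\<close>; intersecting with \<open>A\<close> makes it
      decreasing.\<close>
    let ?Ls = "\<lambda>z::nat. if z = 1 then A else A \<inter> - B"
    have "{z \<in> {1..2}. w \<in> ?Ls z} = (if w \<in> A then if w \<in> B then {1} else {1, 2} else {})" for w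
      by (auto simp: le_Suc_eq numeral_2_eq_2)
    then have "L \<in> BH_NEXP_level 2"
      unfolding BH_NEXP_level_def using AB NEXP_Int[OF AB(2,3)]
      by (intro CollectI exI[of _ ?Ls]) auto
    then show "L \<in> BH_NEXP" unfolding BH_NEXP_def by force
  qed
  ultimately show ?thesis using eq by blast
qed

end
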